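(* Let $E$ and $F$ be Banach spaces with $F\neq\{0\}$, and let $k\in\mathbb{N}$, $k\ge 1$. The space $\mathcal{P}_{\mathrm{wb}}({}^kE,F)$ contains a copy of $\ell_\infty$ if and only if either $F$ contains a copy of $\ell_\infty$ or $E$ contains a complemented copy of $\ell_1$.
   Context: Banach spaces are over $\mathbb{K}=\mathbb{R}$ or $\mathbb{C}$. $\mathcal{P}({}^kE,F)$ is the Banach space of all continuous $k$-homogeneous polynomials $P:E\to F$ (i.e. $P(x)=A(x,\ldots,x)$ for a continuous $k$-linear map $A:E^k\to F$), with norm $\|P\|=\sup_{\|x\|\le 1}\|P(x)\|$. $\mathcal{P}_{\mathrm{wb}}({}^kE,F)$ is the (closed) subspace of those polynomials whose restriction to every bounded subset of $E$ is continuous from the weak topology of $E$ to the norm topology of $F$. A Banach space contains a copy of $X$ if it has a closed subspace linearly homeomorphic to $X$; it contains a complemented copy of $X$ if such a subspace can be chosen to be the range of a bounded linear projection. "Either ... or" is inclusive.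
   Formalization: The space E is also assumed nonzero: for E = {0} and F = ℓ_∞ the space P_wb(^kE,F) is {0} and contains no copy of ℓ_∞ although F does, so the statement fails there. *)

theory Defs
  imports "HOL-Analysis.Analysis" "HOL-Library.Function_Algebras"
begin

section \<open>Scalars and Banach spaces\<close>

text \<open>
  The class of normed fields that are isometrically isomorphic to the reals or to the
  complex numbers. A statement over a type of this class is a statement over both fields.
\<close>

class real_or_complex = real_normed_field +
  assumes real_or_complex:
    "\<exists>\<phi> :: 'a \<Rightarrow> complex.
       (\<forall>x y. \<phi> (x + y) = \<phi> x + \<phi> y) \<and> (\<forall>x y. \<phi> (x * y) = \<phi> x * \<phi> y) \<and>
       (\<forall>x. norm (\<phi> x) = norm x) \<and> (range \<phi> = \<real> \<or> range \<phi> = UNIV)"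

instance real :: real_or_complex
  by standard (rule exI[of _ complex_of_real], auto simp: Reals_def)

instance complex :: real_or_complex
  by standard (rule exI[of _ id], auto)

text \<open>
  A Banach space over \<open>'k\<close>: the library class \<open>banach\<close> provides the additive group, the
  complete norm and the real scalar multiplication; \<open>scale\<close> extends the latter to \<open>'k\<close>.
  For \<open>'k = real\<close> this forces \<open>scale = scaleR\<close>.
\<close>

locale banach_over = vector_space scale
  for scale :: "'k::real_or_complex \<Rightarrow> 'e::banach \<Rightarrow> 'e" +
  assumes scale_of_real: "scale (of_real r) x = r *\<^sub>R x"
    and norm_scale: "norm (scale c x) = norm c * norm x"

lemma banach_over_real: "banach_over (scaleR :: real \<Rightarrow> 'e::banach \<Rightarrow> 'e)"
  by unfold_locales (auto simp: algebra_simps)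

lemma banach_over_complex: "banach_over ((*) :: complex \<Rightarrow> complex \<Rightarrow> complex)"
  by unfold_locales (auto simp: algebra_simps norm_mult scaleR_conv_of_real)


section \<open>Normed spaces with explicit carrier\<close>

text \<open>
  Zero, addition and subtraction are those of the ambient type \<open>'v\<close>; on function types they
  are pointwise.
\<close>

record ('k, 'v) nspace =
  ns_carrier :: "'v set"
  ns_scale :: "'k \<Rightarrow> 'v \<Rightarrow> 'v"
  ns_norm :: "'v \<Rightarrow> real"

definition whole_space :: "('k \<Rightarrow> 'e \<Rightarrow> 'e) \<Rightarrow> ('k, 'e::real_normed_vector) nspace"
  where "whole_space s = \<lparr>ns_carrier = UNIV, ns_scale = s, ns_norm = norm\<rparr>"

text \<open>
  The distance is set to 0 off the carrier, since the locale \<open>Metric_space\<close> demands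
  nonnegativity on the whole type and \<open>ns_norm\<close> is unspecified outside the carrier.
\<close>

definition ns_dist :: "('k, 'v::ab_group_add) nspace \<Rightarrow> 'v \<Rightarrow> 'v \<Rightarrow> real"
  where "ns_dist X x y =
    (if x \<in> ns_carrier X \<and> y \<in> ns_carrier X then ns_norm X (x - y) else 0)"

definition norm_topology :: "('k, 'v::ab_group_add) nspace \<Rightarrow> 'v topology"
  where "norm_topology X = Metric_space.mtopology (ns_carrier X) (ns_dist X)"

definition linear_map ::
    "('k, 'v::ab_group_add) nspace \<Rightarrow> ('k, 'w::ab_group_add) nspace \<Rightarrow> ('v \<Rightarrow> 'w) \<Rightarrow> bool"
  where "linear_map X Y T \<longleftrightarrow>
    T \<in> ns_carrier X \<rightarrow> ns_carrier Y \<and>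
    (\<forall>x\<in>ns_carrier X. \<forall>y\<in>ns_carrier X. T (x + y) = T x + T y) \<and>
    (\<forall>c. \<forall>x\<in>ns_carrier X. T (ns_scale X c x) = ns_scale Y c (T x))"

definition linearly_homeomorphic ::
    "('k, 'v::ab_group_add) nspace \<Rightarrow> ('k, 'w::ab_group_add) nspace \<Rightarrow> bool"
  where "linearly_homeomorphic X Y \<longleftrightarrow>
    (\<exists>T. linear_map X Y T \<and> homeomorphic_map (norm_topology X) (norm_topology Y) T)"

definition closed_linear_subspace ::
    "('k::field, 'v::ab_group_add) nspace \<Rightarrow> 'v set \<Rightarrow> bool"
  where "closed_linear_subspace X S \<longleftrightarrow>
    S \<subseteq> ns_carrier X \<and> module.subspace (ns_scale X) S \<and> closedin (norm_topology X) S"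

definition bounded_projection_onto ::
    "('k, 'v::ab_group_add) nspace \<Rightarrow> 'v set \<Rightarrow> ('v \<Rightarrow> 'v) \<Rightarrow> bool"
  where "bounded_projection_onto X S p \<longleftrightarrow>
    linear_map X X p \<and>
    (\<exists>C. \<forall>x\<in>ns_carrier X. ns_norm X (p x) \<le> C * ns_norm X x) \<and>
    (\<forall>x\<in>ns_carrier X. p (p x) = p x) \<and>
    p ` ns_carrier X = S"

definition contains_copy ::
    "('k::field, 'v::ab_group_add) nspace \<Rightarrow> ('k, 'w::ab_group_add) nspace \<Rightarrow> bool"
  where "contains_copy X Y \<longleftrightarrow>
    (\<exists>S. closed_linear_subspace X S \<and> linearly_homeomorphic (X\<lparr>ns_carrier := S\<rparr>) Y)"

definition contains_complemented_copy ::
    "('k::field, 'v::ab_group_add) nspace \<Rightarrow> ('k, 'w::ab_group_add) nspace \<Rightarrow> bool"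
  where "contains_complemented_copy X Y \<longleftrightarrow>
    (\<exists>S. closed_linear_subspace X S \<and> linearly_homeomorphic (X\<lparr>ns_carrier := S\<rparr>) Y \<and>
         (\<exists>p. bounded_projection_onto X S p))"


section \<open>The sequence spaces\<close>

definition ell_infty :: "('k::real_or_complex, nat \<Rightarrow> 'k) nspace"
  where "ell_infty =
    \<lparr>ns_carrier = {x. bounded (range x)},
     ns_scale = (\<lambda>c x n. c * x n),
     ns_norm = (\<lambda>x. SUP n. norm (x n))\<rparr>"

definition ell_one :: "('k::real_or_complex, nat \<Rightarrow> 'k) nspace"
  where "ell_one =
    \<lparr>ns_carrier = {x. summable (\<lambda>n. norm (x n))},
     ns_scale = (\<lambda>c x n. c * x n),
     ns_norm = (\<lambda>x. \<Sum>n. norm (x n))\<rparr>"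


section \<open>Homogeneous polynomials and weak continuity\<close>

text \<open>
  The power \<open>E\<^sup>k\<close> is the set of functions \<open>nat \<Rightarrow> 'e\<close> that are extensional on
  \<open>{..<k}\<close>, with the product topology.
\<close>

definition multilinear ::
    "('k::field \<Rightarrow> 'e::ab_group_add \<Rightarrow> 'e) \<Rightarrow> ('k \<Rightarrow> 'f::ab_group_add \<Rightarrow> 'f) \<Rightarrow>
     nat \<Rightarrow> ((nat \<Rightarrow> 'e) \<Rightarrow> 'f) \<Rightarrow> bool"
  where "multilinear sE sF k A \<longleftrightarrow>
    (\<forall>x \<in> {..<k} \<rightarrow>\<^sub>E UNIV. \<forall>i<k. Vector_Spaces.linear sE sF (\<lambda>u. A (x(i := u))))"

definition homogeneous_polynomial ::
    "('k::field \<Rightarrow> 'e::real_normed_vector \<Rightarrow> 'e) \<Rightarrow> ('k \<Rightarrow> 'f::real_normed_vector \<Rightarrow> 'f) \<Rightarrow>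
     nat \<Rightarrow> ('e \<Rightarrow> 'f) \<Rightarrow> bool"
  where "homogeneous_polynomial sE sF k P \<longleftrightarrow>
    (\<exists>A. multilinear sE sF k A \<and>
         continuous_map (product_topology (\<lambda>_. euclidean) {..<k}) euclidean A \<and>
         (\<forall>x. P x = A (\<lambda>i\<in>{..<k}. x)))"

definition weak_topology ::
    "('k::real_normed_field \<Rightarrow> 'e::real_normed_vector \<Rightarrow> 'e) \<Rightarrow> 'e topology"
  where "weak_topology sE = topology_generated_by
    {\<phi> -` U |\<phi> U. Vector_Spaces.linear sE (*) \<phi> \<and> continuous_on UNIV \<phi> \<and> open U}"

definition weakly_continuous_on_bounded ::
    "('k::real_normed_field \<Rightarrow> 'e::real_normed_vector \<Rightarrow> 'e) \<Rightarrow>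
     ('e \<Rightarrow> 'f::real_normed_vector) \<Rightarrow> bool"
  where "weakly_continuous_on_bounded sE P \<longleftrightarrow>
    (\<forall>B. bounded B \<longrightarrow> continuous_map (subtopology (weak_topology sE) B) euclidean P)"

definition P_wb ::
    "('k::real_normed_field \<Rightarrow> 'e::real_normed_vector \<Rightarrow> 'e) \<Rightarrow>
     ('k \<Rightarrow> 'f::real_normed_vector \<Rightarrow> 'f) \<Rightarrow> nat \<Rightarrow> ('k, 'e \<Rightarrow> 'f) nspace"
  where "P_wb sE sF k =
    \<lparr>ns_carrier = {P. homogeneous_polynomial sE sF k P \<and> weakly_continuous_on_bounded sE P},
     ns_scale = (\<lambda>c P x. sF c (P x)),
     ns_norm = (\<lambda>P. SUP x\<in>cball 0 1. norm (P x))\<rparr>"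

end

theory Submission
  imports Defs
begin

text \<open>
  Suppose that \<open>F\<close> contains no copy of \<open>\<ell>\<^sub>\<infinity>\<close> and \<open>E\<close> no complemented copy of \<open>\<ell>\<^sub>1\<close>. By Rosenthal's
  disjointification lemma, every bounded operator \<open>\<ell>\<^sub>\<infinity> \<rightarrow> F\<close> tends to \<open>0\<close> on the unit vectors, and so
  does every weakly unconditionally Cauchy series in the dual of \<open>E\<close>. Following Kalton's theorem on
  spaces of compact operators, the first property passes from a space \<open>G\<close> of functions to the compact
  operators \<open>E \<rightarrow> G\<close>: if \<open>T : \<ell>\<^sub>\<infinity> \<rightarrow> K(E, G)\<close> is bounded below on unit vectors, a gliding hump gives
  an infinite set \<open>M\<close> and bounded vectors \<open>z\<^sub>n\<close>, \<open>n \<in> M\<close>, with \<open>T(1\<^sub>M) z\<^sub>n\<close> close to \<open>T(e\<^sub>n) z\<^sub>n\<close>;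
  since \<open>T(1\<^sub>M)\<close> is compact, one functional \<open>\<psi>\<close> on \<open>G\<close> is large on infinitely many of them, and the
  functionals \<open>\<psi> \<circ> T(e\<^sub>n)\<close> contradict the second property. A polynomial that is weakly continuous on
  bounded sets has a symmetric form whose partial applications are compact in each argument, so
  induction on the degree rules out a copy of \<open>\<ell>\<^sub>\<infinity>\<close> in the polynomials.

  Conversely, \<open>x \<mapsto> \<phi>(x)\<^sup>k f\<close> embeds \<open>F\<close>, and if \<open>g\<^sub>n\<close> are the coordinate functionals of a
  complemented \<open>\<ell>\<^sub>1\<close>, then \<open>a \<mapsto> (\<Sum>n. a\<^sub>n g\<^sub>n\<^sub>+\<^sub>1) g\<^sub>0\<^sup>k\<^sup>-\<^sup>1 y\<close> embeds \<open>\<ell>\<^sub>\<infinity>\<close>.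
\<close>

section \<open>Scalars\<close>

text \<open>An induction on the degree would seem to need spaces of multilinear forms as Banach
  spaces, together with their duals. Instead, a space of functions is represented by a predicate on
  functions on a set X, its norm by the supremum over X, and the only functionals on it are
  functionals on F composed with evaluation at one point of X. Compactness has one form only:
  smallness near 0 in the bounded weak topology, which yields finite nets for images of balls. Weak
  continuity of P at all points turns into smallness of its polar form near 0 because the polar form
  vanishes as soon as one argument is 0. The disjointification lemma serves twice: it makes an
  operator on \<open>ell_infty\<close> bounded below along a subsequence, and it brings a matrix of
  values g_n(z_m) so close to the identity on \<open>ell_one\<close> that a Neumann series inverts
  it. In the converse, g_0 is kept out of the sum so that the factor g_0^(k-1) equals 1 at the
  points where the other coordinates are tested.\<close>

lemma real_or_complex_embedding:
  obtains \<phi> :: "'a::real_or_complex \<Rightarrow> complex"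
  where "\<And>x y. \<phi> (x + y) = \<phi> x + \<phi> y" "\<And>x y. \<phi> (x * y) = \<phi> x * \<phi> y"
    "\<And>x. norm (\<phi> x) = norm x" "\<And>r. \<phi> (of_real r) = of_real r"
    "range \<phi> = \<real> \<or> range \<phi> = UNIV"
proof -
  obtain \<phi> :: "'a \<Rightarrow> complex" where add: "\<And>x y. \<phi> (x + y) = \<phi> x + \<phi> y"
    and mult: "\<And>x y. \<phi> (x * y) = \<phi> x * \<phi> y" and norm: "\<And>x. norm (\<phi> x) = norm x"
    and range: "range \<phi> = \<real> \<or> range \<phi> = UNIV"
    using real_or_complex by blast
  have "\<phi> 1 * \<phi> 1 = \<phi> 1" "\<phi> 1 \<noteq> 0"
    using mult[of 1 1] norm[of 1] by auto
  then have one: "\<phi> 1 = 1" by simp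
  have diff: "\<phi> (x - y) = \<phi> x - \<phi> y" for x y
    using add[of "x - y" y] by (simp add: algebra_simps)
  \<comment> \<open>The image of r lies on the circles of radius |r| about 0 and |r - 1| about 1,
    which meet only in r.\<close>
  have "\<phi> (of_real r) = of_real r" for r
  proof -
    let ?z = "\<phi> (of_real r)"
    have "norm ?z = \<bar>r\<bar>" by (simp add: norm)
    moreover have "norm (?z - 1) = \<bar>r - 1\<bar>"
      by (metis diff norm norm_of_real of_real_1 of_real_diff one)
    ultimately have "(Re ?z)\<^sup>2 + (Im ?z)\<^sup>2 = r\<^sup>2" "(Re ?z - 1)\<^sup>2 + (Im ?z)\<^sup>2 = (r - 1)\<^sup>2"
      by (metis cmod_power2 power2_abs, metis cmod_power2 power2_abs minus_complex.sel one_complex.sel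
          diff_zero)
    then have "Re ?z = r \<and> Im ?z = 0"
      by (auto simp: power2_eq_square algebra_simps)
    then show ?thesis by (simp add: complex_eq_iff)
  qed
  with add mult norm range that show thesis by blast
qed

text \<open>Both possible ranges of the embedding are closed, so limits can be pulled back. Compact
  balls of scalars make bounded functionals totally bounded on balls later on; completeness of the
  scalars follows as well.\<close>

instance real_or_complex \<subseteq> heine_borel
proof
  fix f :: "nat \<Rightarrow> 'a"
  assume bf: "bounded (range f)"
  obtain \<phi> :: "'a \<Rightarrow> complex" where add: "\<And>x y. \<phi> (x + y) = \<phi> x + \<phi> y"
    and norm: "\<And>x. norm (\<phi> x) = norm x" and range: "range \<phi> = \<real> \<or> range \<phi> = UNIV"
    using real_or_complex_embedding by metis
  have diff: "\<phi> (x - y) = \<phi> x - \<phi> y" for x y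
    using add[of "x - y" y] by (simp add: algebra_simps)
  have "bounded (range (\<phi> \<circ> f))"
    using bf by (auto simp: bounded_iff norm)
  then obtain l r where r: "strict_mono (r::nat \<Rightarrow> nat)" "((\<phi> \<circ> f) \<circ> r) \<longlonglongrightarrow> l"
    using bounded_imp_convergent_subsequence by blast
  have "closed (range \<phi>)" using range by (auto simp: closed_complex_Reals)
  then have "l \<in> range \<phi>"
    by (rule closed_sequentially[OF _ _ r(2)]) auto
  then obtain l' where l': "l = \<phi> l'" by auto
  have "(f \<circ> r) \<longlonglongrightarrow> l'"
    using r(2) unfolding tendsto_iff l' dist_norm o_def diff[symmetric] norm .
  with r(1) show "\<exists>l r. strict_mono (r::nat\<Rightarrow>nat) \<and> (f \<circ> r) \<longlonglongrightarrow> l" by blast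
qed

instance real_or_complex \<subseteq> banach ..

section \<open>The Hahn--Banach theorem\<close>

definition sublinear :: "('a::real_vector \<Rightarrow> real) \<Rightarrow> bool"
  where "sublinear q \<longleftrightarrow> (\<forall>x y. q (x + y) \<le> q x + q y) \<and> (\<forall>t\<ge>0. \<forall>x. q (t *\<^sub>R x) = t * q x)"

lemma sublinear_zero: "sublinear q \<Longrightarrow> q 0 = 0"
  unfolding sublinear_def by (metis mult_zero_left order_refl scaleR_zero_left)

lemma sublinear_minus: "sublinear q \<Longrightarrow> - q (- x) \<le> q x"
  using sublinear_zero[of q] unfolding sublinear_def by (metis add.right_inverse add_le_cancel_right le_add_same_cancel1 neg_le_iff_le minus_le_iff add.commute neg_le_0_iff_le real_0_le_add_iff)

text \<open>The largest sublinear functional below \<open>q\<close> that does not exceed \<open>- q y\<close> at \<open>- y\<close>.\<close>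

definition sublinear_shift :: "('a::real_vector \<Rightarrow> real) \<Rightarrow> 'a \<Rightarrow> 'a \<Rightarrow> real"
  where "sublinear_shift q y x = (INF t\<in>{0..}. q (x + t *\<^sub>R y) - t * q y)"

context
  fixes q :: "'a::real_vector \<Rightarrow> real" and y :: 'a
  assumes q: "sublinear q"
begin

private lemma shift_bdd: "bdd_below ((\<lambda>t. q (x + t *\<^sub>R y) - t * q y) ` {0..})"
proof (rule bdd_belowI2)
  fix t :: real assume "t \<in> {0..}"
  then have "t * q y = q (t *\<^sub>R y)" using q by (simp add: sublinear_def)
  also have "\<dots> \<le> q (x + t *\<^sub>R y) + q (- x)"
    using q unfolding sublinear_def by (metis add.commute add_minus_cancel)
  finally show "- q (- x) \<le> q (x + t *\<^sub>R y) - t * q y" by simp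
qed

private lemma shift_le: "t \<ge> 0 \<Longrightarrow> sublinear_shift q y x \<le> q (x + t *\<^sub>R y) - t * q y"
  unfolding sublinear_shift_def by (rule cINF_lower[OF shift_bdd]) simp

lemma sublinear_shift_le: "sublinear_shift q y x \<le> q x"
  using shift_le[of 0 x] by simp

lemma sublinear_shift_le_add: "sublinear_shift q y x \<le> q (x + y) - q y"
  using shift_le[of 1 x] by simp

lemma sublinear_shift: "sublinear (sublinear_shift q y)"
  unfolding sublinear_def
proof (intro conjI allI impI)
  fix u v
  have "sublinear_shift q y (u + v) \<le> (q (u + s *\<^sub>R y) - s * q y) + (q (v + t *\<^sub>R y) - t * q y)"
    if "s \<ge> 0" "t \<ge> 0" for s t
  proof -
    have eq: "(u + v) + (s + t) *\<^sub>R y = (u + s *\<^sub>R y) + (v + t *\<^sub>R y)"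
      by (simp add: algebra_simps)
    have "q ((u + v) + (s + t) *\<^sub>R y) \<le> q (u + s *\<^sub>R y) + q (v + t *\<^sub>R y)"
      unfolding eq using q unfolding sublinear_def by blast
    then show ?thesis using shift_le[of "s + t" "u + v"] that by (simp add: algebra_simps)
  qed
  then have "sublinear_shift q y (u + v) - (q (u + s *\<^sub>R y) - s * q y) \<le> sublinear_shift q y v"
    if "s \<ge> 0" for s
    unfolding sublinear_shift_def[of q y v] using that
    by (intro cINF_greatest) (auto simp: diff_le_eq add.commute)
  then have "sublinear_shift q y (u + v) - sublinear_shift q y v \<le> sublinear_shift q y u"
    unfolding sublinear_shift_def[of q y u] 
    by (intro cINF_greatest) (auto simp: algebra_simps)
  then show "sublinear_shift q y (u + v) \<le> sublinear_shift q y u + sublinear_shift q y v"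
    by simp
next
  fix t :: real and x assume t: "t \<ge> 0"
  \<comment> \<open>One inequality for all positive factors suffices; its instance for the inverse
    factor is the converse.\<close>
  have le: "sublinear_shift q y (c *\<^sub>R x) \<le> c * sublinear_shift q y x" if "c > 0" for c x
  proof -
    have "sublinear_shift q y (c *\<^sub>R x) / c \<le> q (x + s *\<^sub>R y) - s * q y" if "s \<ge> 0" for s
    proof -
      have "q (c *\<^sub>R x + (c * s) *\<^sub>R y) = c * q (x + s *\<^sub>R y)"
        using q \<open>c > 0\<close> unfolding sublinear_def
        by (metis less_eq_real_def scaleR_add_right scaleR_scaleR)
      then show ?thesis
        using shift_le[of "c * s" "c *\<^sub>R x"] \<open>c > 0\<close> that by (simp add: field_simps)
    qed
    then have "sublinear_shift q y (c *\<^sub>R x) / c \<le> sublinear_shift q y x"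
      unfolding sublinear_shift_def[of q y x] by (intro cINF_greatest) auto
    then show ?thesis using that by (simp add: field_simps)
  qed
  show "sublinear_shift q y (t *\<^sub>R x) = t * sublinear_shift q y x"
  proof (cases "t = 0")
    case True
    have "sublinear_shift q y 0 = (INF t\<in>{0::real..}. (0::real))"
      unfolding sublinear_shift_def using q by (intro arg_cong[where f=Inf] image_cong) (simp_all add: sublinear_def)
    then show ?thesis using True by simp
  next
    case False
    then have "sublinear_shift q y x \<le> inverse t * sublinear_shift q y (t *\<^sub>R x)"
      using le[of "inverse t" "t *\<^sub>R x"] t by simp
    then show ?thesis using False t le[of t x] by (auto simp: field_simps)
  qed
qed

end

text \<open>Zorn's lemma for the pointwise order. The infimum over a chain is finite because every
  member q satisfies q x >= - q (- x) >= - q0 (- x). Minimality takes the place of extending a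
  functional by one dimension at a time.\<close>

lemma minimal_sublinear_exists:
  fixes q0 :: "'a::real_vector \<Rightarrow> real"
  assumes q0: "sublinear q0"
  obtains q where "sublinear q" "\<And>x. q x \<le> q0 x"
    "\<And>r. sublinear r \<Longrightarrow> (\<And>x. r x \<le> q x) \<Longrightarrow> r = q"
proof -
  define A where "A = {q. sublinear q \<and> (\<forall>x. q x \<le> q0 x)}"
  define P where "P = (\<lambda>q r :: 'a \<Rightarrow> real. \<forall>x. r x \<le> q x)"
  have "\<exists>m\<in>A. \<forall>a\<in>A. P m a \<longrightarrow> a = m"
  proof (rule predicate_Zorn)
    show "partial_order_on A (relation_of P A)"
      by (rule partial_order_on_relation_ofI) (auto simp: P_def fun_eq_iff intro: order_trans antisym)
  next
    fix C assume C: "C \<in> Chains (relation_of P A)"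
    then have CA: "C \<subseteq> A" and tot: "\<And>q r. q \<in> C \<Longrightarrow> r \<in> C \<Longrightarrow> P q r \<or> P r q"
      by (auto simp: Chains_def relation_of_def)
    show "\<exists>u\<in>A. \<forall>a\<in>C. P a u"
    proof (cases "C = {}")
      case True then show ?thesis using q0 by (auto simp: A_def)
    next
      case False
      define u where "u = (\<lambda>x. INF q\<in>C. q x)"
      have u_eq: "u x = (INF q\<in>C. q x)" for x by (simp add: u_def)
      have bdd: "bdd_below ((\<lambda>q. q x) ` C)" for x
      proof (rule bdd_belowI2)
        fix q assume "q \<in> C"
        then have "q \<in> A" using CA by auto
        then show "- q0 (- x) \<le> q x"
          using sublinear_minus[of q x] unfolding A_def by (smt (verit) mem_Collect_eq)
      qed
      have ule: "u x \<le> q x" if "q \<in> C" for q x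
        unfolding u_def by (rule cINF_lower[OF bdd that])
      have "sublinear u"
        unfolding sublinear_def
      proof (intro conjI allI impI)
        fix x y
        \<comment> \<open>Two members of a chain are comparable, so the smaller one can be used at
          both points.\<close>
        have *: "u (x + y) \<le> q x + r y" if qr: "q \<in> C" "r \<in> C" for q r
        proof -
          obtain p where p: "p \<in> C" "p x \<le> q x" "p y \<le> r y"
            using tot[OF qr] qr by (auto simp: P_def)
          then have "p (x + y) \<le> p x + p y" using CA by (auto simp: A_def sublinear_def)
          then show ?thesis using ule[OF p(1), of "x + y"] p by linarith
        qed
        have "u (x + y) - q x \<le> u y" if q: "q \<in> C" for q
        proof -
          have "u (x + y) - q x \<le> r y" if "r \<in> C" for r using *[OF q that] by simp
          then show ?thesis unfolding u_eq[of y] using False by (intro cINF_greatest) auto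
        qed
        then have "u (x + y) - u y \<le> q x" if "q \<in> C" for q using that by (simp add: algebra_simps)
        then have "u (x + y) - u y \<le> u x"
          unfolding u_eq[of x] using False by (intro cINF_greatest) auto
        then show "u (x + y) \<le> u x + u y" by simp
      next
        fix t :: real and x assume t: "t \<ge> 0"
        have eq: "q (t *\<^sub>R x) = t * q x" if "q \<in> C" for q
          using that CA t by (auto simp: A_def sublinear_def)
        show "u (t *\<^sub>R x) = t * u x"
        proof (cases "t = 0")
          case True
          then have "u (t *\<^sub>R x) = (INF q\<in>C. 0)"
            unfolding u_def using eq True by (intro arg_cong[where f=Inf] image_cong) auto
          then show ?thesis using True False by simp
        next
          case tn: False
          have "u (t *\<^sub>R x) / t \<le> u x"
            unfolding u_eq[of x] using False tn t ule[of _ "t *\<^sub>R x"] eq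
            by (intro cINF_greatest) (auto simp: field_simps)
          moreover have "t * u x \<le> u (t *\<^sub>R x)"
            unfolding u_eq[of "t *\<^sub>R x"]
            using False mult_left_mono[OF ule t] by (intro cINF_greatest) (simp_all add: eq)
          ultimately show ?thesis using tn t by (simp add: field_simps)
        qed
      qed
      moreover have "u x \<le> q0 x" for x
      proof -
        obtain q where "q \<in> C" using False by blast
        then have "u x \<le> q x" "q x \<le> q0 x" using ule[of q x] CA by (auto simp: A_def)
        then show ?thesis by simp
      qed
      ultimately show ?thesis using ule by (auto simp: A_def P_def)
    qed
  qed
  then obtain q where "q \<in> A" and min: "\<And>a. a \<in> A \<Longrightarrow> P q a \<Longrightarrow> a = q" by blast
  have le: "q x \<le> q0 x" for x using \<open>q \<in> A\<close> by (auto simp: A_def)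
  show thesis
  proof (rule that)
    show "sublinear q" using \<open>q \<in> A\<close> by (auto simp: A_def)
    show "q x \<le> q0 x" for x by (rule le)
    show "r = q" if "sublinear r" "\<And>x. r x \<le> q x" for r
      using that order_trans[OF that(2) le] by (intro min) (auto simp: A_def P_def)
  qed
qed

text \<open>A minimal functional coincides with each of its shifts, and
  \<open>sublinear_shift_le_add\<close> then reads p x <= p (x + y) - p y, the missing half of
  additivity.\<close>

lemma sublinear_dominates_linear:
  fixes q :: "'a::real_vector \<Rightarrow> real"
  assumes "sublinear q"
  obtains p where "linear p" "\<And>x. p x \<le> q x"
proof -
  obtain p where p: "sublinear p" "\<And>x. p x \<le> q x"
    and min: "\<And>r. sublinear r \<Longrightarrow> (\<And>x. r x \<le> p x) \<Longrightarrow> r = p"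
    using minimal_sublinear_exists[OF assms] by blast
  have add: "p (x + y) = p x + p y" for x y
  proof -
    have "sublinear_shift p y = p"
      by (intro min sublinear_shift p(1) sublinear_shift_le)
    then show ?thesis
      using sublinear_shift_le_add[OF p(1), of y x] p(1) unfolding sublinear_def
      by (metis add_le_cancel_right diff_add_cancel order_antisym)
  qed
  have "p (- x) = - p x" for x
    using add[of x "-x"] sublinear_zero[OF p(1)] by simp
  then have "p (t *\<^sub>R x) = t * p x" for t x
    using p(1) unfolding sublinear_def
    by (cases "t \<ge> 0") (metis, metis add.inverse_inverse linorder_linear mult_minus_left neg_0_le_iff_le scaleR_minus_left)
  with add have "linear p" by (intro linearI) auto
  then show thesis using that p(2) by blast
qed

text \<open>Dominating by the shift of the norm at y, rather than by the norm, forces p (- y) <= -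
  norm y and hence the exact value at y.\<close>

lemma real_norming_functional:
  fixes y :: "'a::real_normed_vector"
  obtains p where "linear p" "\<And>x. \<bar>p x\<bar> \<le> norm x" "p y = norm y"
proof -
  have nrm: "sublinear (norm :: 'a \<Rightarrow> real)"
    by (auto simp: sublinear_def norm_triangle_ineq)
  obtain p where p: "linear p" "\<And>x. p x \<le> sublinear_shift norm y x"
    using sublinear_dominates_linear[OF sublinear_shift[OF nrm]] by blast
  have le: "p x \<le> norm x" for x
    using p(2)[of x] sublinear_shift_le[OF nrm, of y x] by linarith
  have neg: "p (- x) = - p x" for x using p(1) by (rule linear_neg)
  have "\<bar>p x\<bar> \<le> norm x" for x
    using le[of x] le[of "-x"] neg[of x] by simp
  moreover have "p (- y) \<le> - norm y"
    using p(2)[of "-y"] sublinear_shift_le_add[OF nrm, of y "-y"] by simp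
  then have "p y = norm y" using neg[of y] le[of y] by simp
  ultimately show thesis using that p(1) by blast
qed

section \<open>Norming functionals over the scalar field\<close>

lemma linear_vector_spaceI:
  assumes "vector_space s" "vector_space s'" "\<And>u v. f (u + v) = f u + f v" "\<And>c u. f (s c u) = s' c (f u)"
  shows "Vector_Spaces.linear s s' f"
  using assms
  by (auto simp: Vector_Spaces.linear_def module_hom_def module_hom_axioms_def module_iff_vector_space)

lemma vector_space_field: "vector_space ((*) :: 'k::field \<Rightarrow> 'k \<Rightarrow> 'k)"
  by unfold_locales (auto simp: algebra_simps)

lemma banach_over_field: "banach_over ((*) :: 'k::real_or_complex \<Rightarrow> 'k \<Rightarrow> 'k)"
  by (intro banach_over.intro banach_over_axioms.intro vector_space_field)
    (auto simp: norm_mult scaleR_conv_of_real)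

lemma (in banach_over) norming_functional:
  obtains f where "Vector_Spaces.linear scale (*) f" "\<And>x. norm (f x) \<le> norm x"
    "norm (f y) = norm y"
proof -
  obtain p where p: "linear p" "\<And>x. \<bar>p x\<bar> \<le> norm x" "p y = norm y"
    using real_norming_functional[of y] by blast
  have padd: "p (u + v) = p u + p v" and pscale: "p (r *\<^sub>R u) = r * p u" for u v r
    using p(1) by (auto simp: linear_add linear_scale)
  obtain \<phi> :: "'k \<Rightarrow> complex" where add: "\<And>x y. \<phi> (x + y) = \<phi> x + \<phi> y"
    and mult: "\<And>x y. \<phi> (x * y) = \<phi> x * \<phi> y"
    and norm: "\<And>x. norm (\<phi> x) = norm x" and real: "\<And>r. \<phi> (of_real r) = of_real r"
    and range: "range \<phi> = \<real> \<or> range \<phi> = UNIV"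
    using real_or_complex_embedding by metis
  have diff: "\<phi> (x - y) = \<phi> x - \<phi> y" for x y
    using add[of "x - y" y] by (simp add: algebra_simps)
  have inj: "x = y" if "\<phi> x = \<phi> y" for x y
    using norm[of "x - y"] that by (simp add: diff)
  note lin = linear_vector_spaceI[OF vector_space_axioms vector_space_field]
  show thesis using range
  proof
    assume r: "range \<phi> = \<real>"
    have c: "\<exists>r. c = of_real r" for c :: 'k
    proof -
      have "\<phi> c \<in> \<real>" using r by auto
      then obtain s where "\<phi> c = of_real s" by (auto elim: Reals_cases)
      then show ?thesis using inj[of c "of_real s"] real by auto
    qed
    define f where "f = (\<lambda>x. of_real (p x) :: 'k)"
    have "Vector_Spaces.linear scale (*) f"
    proof (rule lin)
      show "f (u + v) = f u + f v" for u v by (simp add: f_def padd)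
      show "f (scale c u) = c * f u" for c u
        using c[of c] by (auto simp: f_def scale_of_real pscale)
    qed
    then show thesis using that[of f] p by (auto simp: f_def)
  next
    assume r: "range \<phi> = UNIV"
    then obtain i where i: "\<phi> i = \<i>" by (metis UNIV_I imageE)
    have ii: "i * i = - 1"
      by (rule inj) (metis i mult complex_i_mult_minus mult_1_right of_real_1 of_real_minus real i_squared)
    have c: "\<exists>a b. c = of_real a + of_real b * i" for c :: 'k
      by (intro exI[of _ "Re (\<phi> c)"] exI[of _ "Im (\<phi> c)"] inj)
        (simp add: add mult real i complex_eq_iff)
    \<comment> \<open>The complexification of p: the only scalar-linear functional with real part
      p.\<close>
    define f where "f = (\<lambda>x. of_real (p x) - i * of_real (p (scale i x)))"
    have fadd: "f (u + v) = f u + f v" for u v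
      by (simp add: f_def padd scale_right_distrib algebra_simps)
    have fr: "f (scale (of_real r) u) = of_real r * f u" for r u
    proof -
      have "scale i (scale (of_real r) u) = scale (of_real r) (scale i u)"
        by (simp add: mult.commute)
      then show ?thesis by (simp add: f_def scale_of_real pscale algebra_simps del: scale_scale)
    qed
    have pneg: "p (- u) = - p u" for u using p(1) by (rule linear_neg)
    have fi: "f (scale i u) = i * f u" for u
    proof -
      have "scale i (scale i u) = - u" by (simp add: ii)
      then have "f (scale i u) = of_real (p (scale i u)) + i * of_real (p u)"
        by (simp add: f_def pneg del: scale_scale)
      also have "\<dots> = i * f u"
        unfolding f_def right_diff_distrib mult.assoc[symmetric] ii by simp
      finally show ?thesis .
    qed
    have fs: "f (scale c u) = c * f u" for c u
    proof -
      obtain a b where "c = of_real a + of_real b * i" using c by blast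
      then have "scale c u = scale (of_real a) u + scale (of_real b) (scale i u)"
        by (simp add: scale_left_distrib)
      then show ?thesis
        using \<open>c = _\<close> by (simp add: fadd fr fi algebra_simps del: scale_scale)
    qed
    have re: "Re (\<phi> (f x)) = p x" for x
      by (simp add: f_def diff mult real i)
    have le: "norm (f x) \<le> norm x" for x
    proof (cases "f x = 0")
      case False
      \<comment> \<open>Rotating x by u makes the value of f a nonnegative real, and there f agrees
        with p, whose bound is known.\<close>
      define u where "u = of_real (norm (f x)) / f x"
      have "norm u = 1" using False by (simp add: u_def norm_divide)
      have "u * f x = of_real (norm (f x))" using False by (simp add: u_def)
      then have "f (scale u x) = of_real (norm (f x))" by (simp add: fs)
      then have "norm (f x) = p (scale u x)" using re[of "scale u x"] real by simp
      also have "\<dots> \<le> norm (scale u x)" using p(2)[of "scale u x"] by linarith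
      also have "\<dots> = norm x" by (simp add: norm_scale \<open>norm u = 1\<close>)
      finally show ?thesis .
    qed simp
    have "norm y \<le> norm (f y)"
      using re[of y] p(3) complex_Re_le_cmod[of "\<phi> (f y)"] by (simp add: norm)
    with le[of y] have "norm (f y) = norm y" by simp
    then show thesis using that[of f] lin fadd fs le by blast
  qed
qed

section \<open>Copies and operators bounded below\<close>

text \<open>The norm axioms are confined to the carrier, since a supremum norm says nothing about
  functions outside it. The scalar laws hold on the whole type because
  \<open>module.subspace\<close> refers to the ambient module.\<close>

locale normed_nspace =
  fixes X :: "('k::real_normed_field, 'v::ab_group_add) nspace"
  assumes vector_space_scale: "vector_space (ns_scale X)"
    and zero_mem: "0 \<in> ns_carrier X"
    and add_mem: "\<And>x y. x \<in> ns_carrier X \<Longrightarrow> y \<in> ns_carrier X \<Longrightarrow> x + y \<in> ns_carrier X"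
    and scale_mem: "\<And>c x. x \<in> ns_carrier X \<Longrightarrow> ns_scale X c x \<in> ns_carrier X"
    and norm_nonneg: "\<And>x. x \<in> ns_carrier X \<Longrightarrow> 0 \<le> ns_norm X x"
    and norm_eq_0D: "\<And>x. x \<in> ns_carrier X \<Longrightarrow> ns_norm X x = 0 \<Longrightarrow> x = 0"
    and norm_triangle: "\<And>x y. x \<in> ns_carrier X \<Longrightarrow> y \<in> ns_carrier X \<Longrightarrow>
      ns_norm X (x + y) \<le> ns_norm X x + ns_norm X y"
    and norm_homogeneous: "\<And>c x. x \<in> ns_carrier X \<Longrightarrow>
      ns_norm X (ns_scale X c x) = norm c * ns_norm X x"
begin

sublocale vs: vector_space "ns_scale X" by (rule vector_space_scale)

lemma norm_zero: "ns_norm X 0 = 0"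
  using norm_homogeneous[OF zero_mem, of 0] by simp

lemma minus_mem: "x \<in> ns_carrier X \<Longrightarrow> - x \<in> ns_carrier X"
  using scale_mem[of x "-1"] by simp

lemma diff_mem: "x \<in> ns_carrier X \<Longrightarrow> y \<in> ns_carrier X \<Longrightarrow> x - y \<in> ns_carrier X"
  using add_mem[of x "- y"] minus_mem[of y] by simp

lemma norm_minus: "x \<in> ns_carrier X \<Longrightarrow> ns_norm X (- x) = ns_norm X x"
  using norm_homogeneous[of x "-1"] by simp

lemma norm_minus_commute:
  "x \<in> ns_carrier X \<Longrightarrow> y \<in> ns_carrier X \<Longrightarrow> ns_norm X (x - y) = ns_norm X (y - x)"
  using norm_minus[of "x - y"] diff_mem[of x y] by simp

lemma norm_triangle_diff:
  assumes "x \<in> ns_carrier X" "y \<in> ns_carrier X" "z \<in> ns_carrier X"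
  shows "ns_norm X (x - z) \<le> ns_norm X (x - y) + ns_norm X (y - z)"
  using norm_triangle[of "x - y" "y - z"] diff_mem assms by simp

lemma Metric_space: "Metric_space (ns_carrier X) (ns_dist X)"
proof
  show "0 \<le> ns_dist X x y" for x y
    by (simp add: ns_dist_def norm_nonneg diff_mem)
  show "ns_dist X x y = ns_dist X y x" for x y
    by (simp add: ns_dist_def norm_minus_commute)
  show "ns_dist X x y = 0 \<longleftrightarrow> x = y" if "x \<in> ns_carrier X" "y \<in> ns_carrier X" for x y
    using that norm_eq_0D[of "x - y"] diff_mem by (auto simp: ns_dist_def norm_zero)
  show "ns_dist X x z \<le> ns_dist X x y + ns_dist X y z"
    if "x \<in> ns_carrier X" "y \<in> ns_carrier X" "z \<in> ns_carrier X" for x y z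
    using that by (simp add: ns_dist_def norm_triangle_diff)
qed

lemma topspace_norm_topology: "topspace (norm_topology X) = ns_carrier X"
  unfolding norm_topology_def by (simp add: Metric_space.topspace_mtopology[OF Metric_space])

lemma normed_subspace:
  assumes "S \<subseteq> ns_carrier X" "vs.subspace S"
  shows "normed_nspace (X\<lparr>ns_carrier := S\<rparr>)"
proof -
  have "ns_norm X (x + y) \<le> ns_norm X x + ns_norm X y" if "x \<in> S" "y \<in> S" for x y
    using that assms(1) norm_triangle by blast
  moreover have "ns_norm X (ns_scale X c x) = norm c * ns_norm X x" if "x \<in> S" for c x
    using that assms(1) norm_homogeneous by blast
  moreover have "0 \<le> ns_norm X x" if "x \<in> S" for x using that assms(1) norm_nonneg by blast
  moreover have "x = 0" if "x \<in> S" "ns_norm X x = 0" for x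
    using that assms(1) norm_eq_0D by blast
  ultimately show ?thesis
    using assms(2) vector_space_scale
    by (intro normed_nspace.intro) (simp_all add: vs.subspace_0 vs.subspace_add vs.subspace_scale)
qed

lemma closedin_norm_topologyI:
  assumes S: "S \<subseteq> ns_carrier X"
    and lim: "\<And>\<sigma> l. (\<And>n. \<sigma> n \<in> S) \<Longrightarrow> l \<in> ns_carrier X \<Longrightarrow>
      (\<lambda>n. ns_norm X (\<sigma> n - l)) \<longlonglongrightarrow> 0 \<Longrightarrow> l \<in> S"
  shows "closedin (norm_topology X) S"
proof -
  interpret M: Metric_space "ns_carrier X" "ns_dist X" by (rule Metric_space)
  have "l \<in> S" if \<sigma>: "range \<sigma> \<subseteq> S" "limitin M.mtopology \<sigma> l sequentially" for \<sigma> l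
  proof -
    have l: "l \<in> ns_carrier X" using that(2) by (simp add: M.limitin_metric)
    have "(\<lambda>n. ns_dist X (\<sigma> n) l) \<longlonglongrightarrow> 0"
      using that(2) unfolding M.limitin_metric tendsto_iff by (auto elim: eventually_mono)
    moreover have "ns_dist X (\<sigma> n) l = ns_norm X (\<sigma> n - l)" for n
      using \<sigma>(1) S l by (auto simp: ns_dist_def)
    ultimately show ?thesis using lim[of \<sigma> l] \<sigma>(1) l by auto
  qed
  then show ?thesis
    unfolding norm_topology_def M.metric_closedin_iff_sequentially_closed using S by blast
qed

end

section \<open>Bounded linear maps and isomorphic embeddings\<close>

lemma linear_mapD:
  assumes "linear_map X Y T"
  shows "\<And>x. x \<in> ns_carrier X \<Longrightarrow> T x \<in> ns_carrier Y"
    "\<And>x y. x \<in> ns_carrier X \<Longrightarrow> y \<in> ns_carrier X \<Longrightarrow> T (x + y) = T x + T y"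
    "\<And>c x. x \<in> ns_carrier X \<Longrightarrow> T (ns_scale X c x) = ns_scale Y c (T x)"
  using assms by (auto simp: linear_map_def)

lemma linear_map_diff:
  assumes "normed_nspace X" "normed_nspace Y" "linear_map X Y T" "x \<in> ns_carrier X" "y \<in> ns_carrier X"
  shows "T (x - y) = T x - T y"
proof -
  interpret X: normed_nspace X by fact
  have "x - y \<in> ns_carrier X" using assms X.diff_mem by auto
  from linear_mapD(2)[OF assms(3) this assms(5)] show ?thesis by simp
qed

lemma linear_map_continuous_iff:
  assumes "normed_nspace X" "normed_nspace Y" and T: "linear_map X Y T"
  shows "continuous_map (norm_topology X) (norm_topology Y) T \<longleftrightarrow>
    (\<exists>C>0. \<forall>x\<in>ns_carrier X. ns_norm Y (T x) \<le> C * ns_norm X x)"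
proof -
  interpret X: normed_nspace X by fact
  interpret Y: normed_nspace Y by fact
  interpret MX: Metric_space "ns_carrier X" "ns_dist X" by (rule X.Metric_space)
  interpret MY: Metric_space "ns_carrier Y" "ns_dist Y" by (rule Y.Metric_space)
  have T0: "T 0 = 0"
    using linear_map_diff[OF assms X.zero_mem X.zero_mem] by simp
  have cont: "continuous_map (norm_topology X) (norm_topology Y) T \<longleftrightarrow>
    (\<forall>a\<in>ns_carrier X. \<forall>\<epsilon>>0. \<exists>\<delta>>0. \<forall>x. x \<in> ns_carrier X \<and> ns_dist X a x < \<delta> \<longrightarrow> ns_dist Y (T a) (T x) < \<epsilon>)"
    unfolding norm_topology_def MX.metric_continuous_map[OF Y.Metric_space]
    using linear_mapD(1)[OF T] by blast
  show ?thesis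
  proof
    assume "continuous_map (norm_topology X) (norm_topology Y) T"
    then obtain \<delta> where "\<delta> > 0" and
      \<delta>: "\<And>x. x \<in> ns_carrier X \<Longrightarrow> ns_dist X 0 x < \<delta> \<Longrightarrow> ns_dist Y (T 0) (T x) < 1"
      unfolding cont using X.zero_mem by (meson zero_less_one)
    have \<delta>': "ns_norm Y (T x) < 1" if x: "x \<in> ns_carrier X" "ns_norm X x < \<delta>" for x
      using \<delta>[OF x(1)] x X.zero_mem Y.zero_mem linear_mapD(1)[OF T x(1)] T0
      by (simp add: ns_dist_def X.norm_minus Y.norm_minus)
    have "ns_norm Y (T x) \<le> (2 / \<delta>) * ns_norm X x" if x: "x \<in> ns_carrier X" for x
    proof (cases "ns_norm X x = 0")
      case True
      then show ?thesis using X.norm_eq_0D[OF x] T0 Y.norm_zero by simp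
    next
      case False
      then have pos: "ns_norm X x > 0" using X.norm_nonneg[OF x] by simp
      define c where "c = (of_real (\<delta> / 2 / ns_norm X x) :: 'a)"
      have c: "norm c = \<delta> / 2 / ns_norm X x"
        unfolding c_def norm_of_real using pos \<open>\<delta> > 0\<close> by simp
      then have "ns_norm X (ns_scale X c x) < \<delta>"
        using pos \<open>\<delta> > 0\<close> by (simp add: X.norm_homogeneous[OF x])
      from \<delta>'[OF X.scale_mem[OF x] this] have "norm c * ns_norm Y (T x) < 1"
        by (simp add: linear_mapD(3)[OF T x] Y.norm_homogeneous linear_mapD(1)[OF T x])
      then show ?thesis unfolding c using pos \<open>\<delta> > 0\<close> by (simp add: field_simps)
    qed
    then show "\<exists>C>0. \<forall>x\<in>ns_carrier X. ns_norm Y (T x) \<le> C * ns_norm X x"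
      using \<open>\<delta> > 0\<close> by (intro exI[of _ "2 / \<delta>"]) auto
  next
    assume "\<exists>C>0. \<forall>x\<in>ns_carrier X. ns_norm Y (T x) \<le> C * ns_norm X x"
    then obtain C where "C > 0" and C: "\<And>x. x \<in> ns_carrier X \<Longrightarrow> ns_norm Y (T x) \<le> C * ns_norm X x"
      by blast
    have "ns_dist Y (T a) (T x) < \<epsilon>"
      if "a \<in> ns_carrier X" "\<epsilon> > 0" "x \<in> ns_carrier X" "ns_dist X a x < \<epsilon> / C" for a x \<epsilon>
    proof -
      have "ns_dist Y (T a) (T x) = ns_norm Y (T (a - x))"
        using that linear_mapD(1)[OF T] by (simp add: ns_dist_def linear_map_diff[OF assms])
      also have "\<dots> \<le> C * ns_dist X a x"
        using C[OF X.diff_mem[of a x]] that by (simp add: ns_dist_def)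
      also have "\<dots> < \<epsilon>" using that \<open>C > 0\<close> by (simp add: field_simps)
      finally show ?thesis .
    qed
    then show "continuous_map (norm_topology X) (norm_topology Y) T"
      unfolding cont using \<open>C > 0\<close> by (meson divide_pos_pos)
  qed
qed

lemma linearly_homeomorphicD:
  fixes X :: "('k::real_normed_field, 'v::ab_group_add) nspace"
    and Y :: "('k, 'w::ab_group_add) nspace"
  assumes "normed_nspace X" "normed_nspace Y" and hom: "linearly_homeomorphic X Y"
  obtains h u C where "linear_map X Y h" "linear_map Y X u" "C > 0"
    "\<And>x. x \<in> ns_carrier X \<Longrightarrow> u (h x) = x" "\<And>y. y \<in> ns_carrier Y \<Longrightarrow> h (u y) = y"
    "\<And>x. x \<in> ns_carrier X \<Longrightarrow> ns_norm Y (h x) \<le> C * ns_norm X x"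
    "\<And>y. y \<in> ns_carrier Y \<Longrightarrow> ns_norm X (u y) \<le> C * ns_norm Y y"
proof -
  interpret X: normed_nspace X by fact
  interpret Y: normed_nspace Y by fact
  obtain h where h: "linear_map X Y h" and "homeomorphic_map (norm_topology X) (norm_topology Y) h"
    using hom by (auto simp: linearly_homeomorphic_def)
  then obtain u where "homeomorphic_maps (norm_topology X) (norm_topology Y) h u"
    by (auto simp: homeomorphic_map_maps)
  then have ch: "continuous_map (norm_topology X) (norm_topology Y) h"
    and cu: "continuous_map (norm_topology Y) (norm_topology X) u"
    and uh: "\<And>x. x \<in> ns_carrier X \<Longrightarrow> u (h x) = x" and hu: "\<And>y. y \<in> ns_carrier Y \<Longrightarrow> h (u y) = y"
    by (auto simp: homeomorphic_maps_def X.topspace_norm_topology Y.topspace_norm_topology)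
  have uX: "u y \<in> ns_carrier X" if "y \<in> ns_carrier Y" for y
    using continuous_map_image_subset_topspace[OF cu] that
    by (auto simp: X.topspace_norm_topology Y.topspace_norm_topology)
  have u: "linear_map Y X u"
    unfolding linear_map_def
  proof (intro conjI ballI allI funcsetI)
    fix x y assume "x \<in> ns_carrier Y" "y \<in> ns_carrier Y"
    then show "u (x + y) = u x + u y"
      using uh[of "u x + u y"] by (simp add: uX X.add_mem linear_mapD(2)[OF h] hu)
  next
    fix c x assume "x \<in> ns_carrier Y"
    then show "u (ns_scale Y c x) = ns_scale X c (u x)"
      using uh[of "ns_scale X c (u x)"] by (simp add: uX X.scale_mem linear_mapD(3)[OF h] hu)
  qed (use uX in auto)
  obtain C1 C2 where C1: "C1 > 0" "\<And>x. x \<in> ns_carrier X \<Longrightarrow> ns_norm Y (h x) \<le> C1 * ns_norm X x"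
    and C2: "C2 > 0" "\<And>y. y \<in> ns_carrier Y \<Longrightarrow> ns_norm X (u y) \<le> C2 * ns_norm Y y"
    using linear_map_continuous_iff[OF assms(1,2) h] linear_map_continuous_iff[OF assms(2,1) u] ch cu
    by blast
  have "ns_norm Y (h x) \<le> max C1 C2 * ns_norm X x" if "x \<in> ns_carrier X" for x
    using C1(2)[OF that] mult_right_mono[OF max.cobounded1 X.norm_nonneg[OF that], of C1 C2] by linarith
  moreover have "ns_norm X (u y) \<le> max C1 C2 * ns_norm Y y" if "y \<in> ns_carrier Y" for y
    using C2(2)[OF that] mult_right_mono[OF max.cobounded2 Y.norm_nonneg[OF that], of C2 C1] by linarith
  moreover have "max C1 C2 > 0" using C1 by auto
  ultimately show thesis using that[OF h u _ uh hu] by blast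
qed

text \<open>Replaces the homeomorphism by two-sided estimates with a single constant, the form in
  which a given copy of \<open>ell_infty\<close> is used.\<close>

lemma contains_copyD:
  fixes X :: "('k::real_normed_field, 'v::ab_group_add) nspace"
    and Y :: "('k, 'w::ab_group_add) nspace"
  assumes X: "normed_nspace X" and Y: "normed_nspace Y" and copy: "contains_copy X Y"
  obtains u C where "linear_map Y X u" "C > 0"
    "\<And>y. y \<in> ns_carrier Y \<Longrightarrow> ns_norm X (u y) \<le> C * ns_norm Y y"
    "\<And>y. y \<in> ns_carrier Y \<Longrightarrow> ns_norm Y y \<le> C * ns_norm X (u y)"
proof -
  obtain W where W: "W \<subseteq> ns_carrier X" "module.subspace (ns_scale X) W"
    and hom: "linearly_homeomorphic (X\<lparr>ns_carrier := W\<rparr>) Y"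
    using copy unfolding contains_copy_def closed_linear_subspace_def by blast
  obtain h u C where u: "linear_map Y (X\<lparr>ns_carrier := W\<rparr>) u" and "C > 0"
    and hu: "\<And>y. y \<in> ns_carrier Y \<Longrightarrow> h (u y) = y"
    and h: "\<And>x. x \<in> ns_carrier (X\<lparr>ns_carrier := W\<rparr>) \<Longrightarrow>
      ns_norm Y (h x) \<le> C * ns_norm (X\<lparr>ns_carrier := W\<rparr>) x"
    and uC: "\<And>y. y \<in> ns_carrier Y \<Longrightarrow> ns_norm (X\<lparr>ns_carrier := W\<rparr>) (u y) \<le> C * ns_norm Y y"
    using linearly_homeomorphicD[OF normed_nspace.normed_subspace[OF X W] Y hom] by metis
  show thesis
  proof (rule that[OF _ \<open>C > 0\<close>])
    show "linear_map Y X u" using u W(1) by (auto simp: linear_map_def)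
    show "ns_norm X (u y) \<le> C * ns_norm Y y" if "y \<in> ns_carrier Y" for y using uC[OF that] by simp
    show "ns_norm Y y \<le> C * ns_norm X (u y)" if "y \<in> ns_carrier Y" for y
      using h[OF linear_mapD(1)[OF u that]] hu[OF that] by simp
  qed
qed

text \<open>Closedness of the image is left to the applications: for \<open>ell_infty\<close> it
  comes from completeness of the sequence space, for \<open>ell_one\<close> from the
  projection.\<close>

lemma bounded_below_linearly_homeomorphic:
  fixes X :: "('k::real_normed_field, 'v::ab_group_add) nspace"
    and Y :: "('k, 'w::ab_group_add) nspace"
  assumes "normed_nspace X" "normed_nspace Y" and u: "linear_map Y X u"
    and "c > 0" "\<And>y. y \<in> ns_carrier Y \<Longrightarrow> c * ns_norm Y y \<le> ns_norm X (u y)"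
    and "\<And>y. y \<in> ns_carrier Y \<Longrightarrow> ns_norm X (u y) \<le> C * ns_norm Y y"
  shows "u ` ns_carrier Y \<subseteq> ns_carrier X" "module.subspace (ns_scale X) (u ` ns_carrier Y)"
    "linearly_homeomorphic (X\<lparr>ns_carrier := u ` ns_carrier Y\<rparr>) Y"
proof -
  interpret X: normed_nspace X by fact
  interpret Y: normed_nspace Y by fact
  let ?S = "u ` ns_carrier Y" and ?X = "X\<lparr>ns_carrier := u ` ns_carrier Y\<rparr>"
  show sub: "?S \<subseteq> ns_carrier X" using linear_mapD(1)[OF u] by auto
  have u0: "u 0 = 0" using linear_map_diff[OF assms(2,1) u Y.zero_mem Y.zero_mem] by simp
  have uadd: "u y + u z = u (y + z)" if "y \<in> ns_carrier Y" "z \<in> ns_carrier Y" for y z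
    using linear_mapD(2)[OF u that] by simp
  have uscale: "ns_scale X a (u y) = u (ns_scale Y a y)" if "y \<in> ns_carrier Y" for a y
    using linear_mapD(3)[OF u that] by simp
  show subs: "X.vs.subspace ?S"
  proof (rule X.vs.subspaceI)
    show "0 \<in> ?S" using Y.zero_mem u0 by (metis image_eqI)
  qed (use Y.add_mem Y.scale_mem in \<open>auto simp: uadd uscale\<close>)
  interpret S: normed_nspace ?X by (rule X.normed_subspace[OF sub subs])
  have inj: "inj_on u (ns_carrier Y)"
  proof (rule inj_onI)
    fix y z assume yz: "y \<in> ns_carrier Y" "z \<in> ns_carrier Y" "u y = u z"
    have "c * ns_norm Y (y - z) \<le> 0"
      using assms(5)[OF Y.diff_mem[OF yz(1,2)]] linear_map_diff[OF assms(2,1) u yz(1,2)] yz(3) X.norm_zero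
      by simp
    then have "ns_norm Y (y - z) = 0"
      using \<open>c > 0\<close> Y.norm_nonneg[OF Y.diff_mem[OF yz(1,2)]] by (simp add: mult_le_0_iff)
    then show "y = z" using Y.norm_eq_0D[OF Y.diff_mem[OF yz(1,2)]] by simp
  qed
  define h where "h = the_inv_into (ns_carrier Y) u"
  have hu: "h (u y) = y" if "y \<in> ns_carrier Y" for y
    unfolding h_def by (rule the_inv_into_f_f[OF inj that])
  have h: "linear_map ?X Y h"
    unfolding linear_map_def by (auto simp: hu uadd uscale Y.add_mem Y.scale_mem)
  have u': "linear_map Y ?X u"
    using u by (auto simp: linear_map_def)
  have "ns_norm Y (h x) \<le> (1 / c) * ns_norm ?X x" if x: "x \<in> ?S" for x
    using x assms(5) \<open>c > 0\<close> by (auto simp: hu field_simps)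
  then have "continuous_map (norm_topology ?X) (norm_topology Y) h"
    unfolding linear_map_continuous_iff[OF S.normed_nspace_axioms assms(2) h]
    using \<open>c > 0\<close> by (intro exI[of _ "1 / c"]) auto
  moreover have "ns_norm ?X (u y) \<le> max C 1 * ns_norm Y y" if "y \<in> ns_carrier Y" for y
    using assms(6)[OF that] mult_right_mono[OF max.cobounded1 Y.norm_nonneg[OF that], of C 1] by simp
  then have "continuous_map (norm_topology Y) (norm_topology ?X) u"
    unfolding linear_map_continuous_iff[OF assms(2) S.normed_nspace_axioms u']
    by (intro exI[of _ "max C 1"]) auto
  ultimately have "homeomorphic_maps (norm_topology ?X) (norm_topology Y) h u"
    unfolding homeomorphic_maps_def S.topspace_norm_topology Y.topspace_norm_topology
    by (auto simp: hu)
  then show "linearly_homeomorphic ?X Y"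
    unfolding linearly_homeomorphic_def homeomorphic_map_maps using h by blast
qed

subsection \<open>The sequence spaces\<close>

lemma vector_space_fun: "vector_space s \<Longrightarrow> vector_space (\<lambda>c f x. s c (f x))"
  unfolding vector_space_def by (auto simp: fun_eq_iff)

lemma (in banach_over) normed_nspace_whole_space: "normed_nspace (whole_space scale)"
  by (rule normed_nspace.intro)
    (simp_all add: whole_space_def vector_space_axioms norm_triangle_ineq norm_scale)

lemma ell_infty_norm_ge: "bounded (range x) \<Longrightarrow> norm (x n) \<le> ns_norm ell_infty x"
  unfolding ell_infty_def by (auto intro!: cSUP_upper simp: bounded_iff bdd_above_def)

lemma ell_infty_norm_le: "(\<And>n. norm (x n) \<le> K) \<Longrightarrow> ns_norm ell_infty x \<le> K"
  unfolding ell_infty_def by (auto intro!: cSUP_least)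

lemma bounded_range_add:
  "bounded (range x) \<Longrightarrow> bounded (range y) \<Longrightarrow> bounded (range (x + y))"
  for x y :: "nat \<Rightarrow> 'a::real_normed_vector"
  using bounded_plus_comp[of x UNIV y] by (simp add: plus_fun_def)

lemma bounded_range_mult:
  "bounded (range x) \<Longrightarrow> bounded (range (\<lambda>n. c * x n))"
  for x :: "nat \<Rightarrow> 'a::real_normed_field"
  using bounded_linear_image[OF _ bounded_linear_mult_right, of "range x" c] by (simp add: image_image)

lemma ell_infty_carrier [simp]: "x \<in> ns_carrier ell_infty \<longleftrightarrow> bounded (range x)"
  by (simp add: ell_infty_def)

lemma ell_infty_scale [simp]: "ns_scale ell_infty c x = (\<lambda>n. c * x n)"
  by (simp add: ell_infty_def)

lemma normed_nspace_ell_infty: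
  "normed_nspace (ell_infty :: ('k::real_or_complex, nat \<Rightarrow> 'k) nspace)"
proof (rule normed_nspace.intro)
  show "vector_space (ns_scale (ell_infty :: ('k, nat \<Rightarrow> 'k) nspace))"
    using vector_space_fun[OF vector_space_field[where 'k='k]] by (simp add: ell_infty_def)
next
  fix x y :: "nat \<Rightarrow> 'k" and c :: 'k
  show "(0 :: nat \<Rightarrow> 'k) \<in> ns_carrier ell_infty" by (simp add: zero_fun_def)
  show "x + y \<in> ns_carrier ell_infty" if "x \<in> ns_carrier ell_infty" "y \<in> ns_carrier ell_infty"
    using that bounded_range_add by simp
  assume x: "x \<in> ns_carrier ell_infty"
  then show "ns_scale ell_infty c x \<in> ns_carrier ell_infty" by (simp add: bounded_range_mult)
  show "0 \<le> ns_norm ell_infty x"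
    using order_trans[OF norm_ge_zero ell_infty_norm_ge[of x 0]] x by simp
  show "x = 0" if "ns_norm ell_infty x = 0"
  proof
    show "x n = 0 n" for n using ell_infty_norm_ge[of x n] x that by simp
  qed
  show "ns_norm ell_infty (x + y) \<le> ns_norm ell_infty x + ns_norm ell_infty y"
    if "y \<in> ns_carrier ell_infty"
  proof (rule ell_infty_norm_le)
    fix n
    show "norm ((x + y) n) \<le> ns_norm ell_infty x + ns_norm ell_infty y"
      using norm_triangle_ineq[of "x n" "y n"] ell_infty_norm_ge[of x n] ell_infty_norm_ge[of y n] x that
      by simp
  qed
  have le: "ns_norm ell_infty (\<lambda>n. d * z n) \<le> norm d * ns_norm ell_infty z"
    if "bounded (range z)" for d and z :: "nat \<Rightarrow> 'k"
    by (rule ell_infty_norm_le) (simp add: norm_mult mult_left_mono ell_infty_norm_ge[OF that])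
  show "ns_norm ell_infty (ns_scale ell_infty c x) = norm c * ns_norm ell_infty x"
  proof (cases "c = 0")
    case True
    then show ?thesis by (simp add: ell_infty_def)
  next
    case False
    have "ns_norm ell_infty x \<le> norm (inverse c) * ns_norm ell_infty (\<lambda>n. c * x n)"
      using le[of "\<lambda>n. c * x n" "inverse c"] x False by (simp add: bounded_range_mult mult.assoc[symmetric])
    from mult_left_mono[OF this norm_ge_zero[of c]]
    have "norm c * ns_norm ell_infty x \<le> (norm c * norm (inverse c)) * ns_norm ell_infty (\<lambda>n. c * x n)"
      by (simp add: mult.assoc)
    also have "norm c * norm (inverse c) = 1" using False by (simp add: norm_mult[symmetric])
    finally show ?thesis using le[of x c] x by simp
  qed
qed

text \<open>Completeness of \<open>ell_infty\<close> closes the image: if u (a n) converges, the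
  lower estimate makes a n uniformly Cauchy, the coordinatewise limit b is then a uniform limit, and
  the upper estimate identifies u b with the given limit.\<close>

lemma contains_copy_ell_inftyI:
  fixes X :: "('k::real_or_complex, 'v::ab_group_add) nspace"
  assumes X: "normed_nspace X" and u: "linear_map ell_infty X u" and "c > 0"
    and lower: "\<And>a. bounded (range a) \<Longrightarrow> c * ns_norm ell_infty a \<le> ns_norm X (u a)"
    and upper: "\<And>a. bounded (range a) \<Longrightarrow> ns_norm X (u a) \<le> C * ns_norm ell_infty a"
  shows "contains_copy X (ell_infty :: ('k, nat \<Rightarrow> 'k) nspace)"
proof -
  interpret X: normed_nspace X by fact
  interpret Y: normed_nspace "ell_infty :: ('k, nat \<Rightarrow> 'k) nspace" by (rule normed_nspace_ell_infty)
  note copy = bounded_below_linearly_homeomorphic[OF X normed_nspace_ell_infty u \<open>c > 0\<close> lower upper, simplified]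
  have "closedin (norm_topology X) (u ` ns_carrier ell_infty)"
  proof (rule X.closedin_norm_topologyI)
    show "u ` ns_carrier ell_infty \<subseteq> ns_carrier X" using linear_mapD(1)[OF u] by auto
    fix \<sigma> l assume "\<And>n::nat. \<sigma> n \<in> u ` ns_carrier ell_infty" and l: "l \<in> ns_carrier X"
      and lim: "(\<lambda>n. ns_norm X (\<sigma> n - l)) \<longlonglongrightarrow> 0"
    then have "\<forall>n. \<exists>a. bounded (range a) \<and> \<sigma> n = u a"
      by (metis ell_infty_carrier imageE)
    then obtain a where a: "\<And>n. bounded (range (a n))" and \<sigma>: "\<And>n. \<sigma> n = u (a n)" by metis
    have \<sigma>X: "\<sigma> n \<in> ns_carrier X" for n using linear_mapD(1)[OF u, of "a n"] a \<sigma> by simp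
    have diff: "u (x - y) = u x - u y" if "bounded (range x)" "bounded (range y)" for x y
      using linear_map_diff[OF normed_nspace_ell_infty X u] that by simp
    have close: "\<exists>N. \<forall>m\<ge>N. \<forall>n\<ge>N. \<forall>i. norm (a m i - a n i) \<le> e" if "e > 0" for e
    proof -
      have "eventually (\<lambda>n. ns_norm X (\<sigma> n - l) < c * e / 2) sequentially"
        using lim \<open>c > 0\<close> \<open>e > 0\<close> by (intro order_tendstoD) auto
      then obtain N where N: "\<And>n. n \<ge> N \<Longrightarrow> ns_norm X (\<sigma> n - l) < c * e / 2"
        by (auto simp: eventually_sequentially)
      have "norm (a m i - a n i) \<le> e" if "m \<ge> N" "n \<ge> N" for m n i
      proof -
        have bd: "bounded (range (a m - a n))" using Y.diff_mem[of "a m" "a n"] a by simp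
        have "c * norm (a m i - a n i) \<le> c * ns_norm ell_infty (a m - a n)"
          using ell_infty_norm_ge[OF bd, of i] \<open>c > 0\<close> by simp
        also have "\<dots> \<le> ns_norm X (\<sigma> m - \<sigma> n)"
          using lower[OF bd] by (simp add: diff a \<sigma>)
        also have "\<dots> \<le> ns_norm X (\<sigma> m - l) + ns_norm X (\<sigma> n - l)"
          using X.norm_triangle_diff[OF \<sigma>X l \<sigma>X, of m n] X.norm_minus_commute[OF l \<sigma>X, of n] by simp
        also have "\<dots> \<le> c * e" using N[OF that(1)] N[OF that(2)] by simp
        finally show ?thesis using \<open>c > 0\<close> by simp
      qed
      then show ?thesis by blast
    qed
    have "Cauchy (\<lambda>m. a m i)" for i
      unfolding Cauchy_iff
    proof (intro allI impI)
      fix e :: real assume "e > 0"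
      then have "e / 2 > 0" "e / 2 < e" by simp_all
      then obtain N where "\<And>m n. m \<ge> N \<Longrightarrow> n \<ge> N \<Longrightarrow> norm (a m i - a n i) \<le> e / 2"
        using close by meson
      then show "\<exists>M. \<forall>m\<ge>M. \<forall>n\<ge>M. norm (a m i - a n i) < e"
        using \<open>e / 2 < e\<close> by (meson le_less_trans)
    qed
    then have "\<forall>i. \<exists>z. (\<lambda>m. a m i) \<longlonglongrightarrow> z"
      by (auto simp: Cauchy_convergent_iff convergent_def)
    then obtain b where b: "\<And>i. (\<lambda>m. a m i) \<longlonglongrightarrow> b i" by metis
    have unif: "\<exists>N. \<forall>m\<ge>N. \<forall>i. norm (a m i - b i) \<le> e" if e: "e > 0" for e
    proof -
      obtain N where N: "\<forall>m\<ge>N. \<forall>n\<ge>N. \<forall>i. norm (a m i - a n i) \<le> e"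
        using close[OF e] by blast
      have "norm (a m i - b i) \<le> e" if "m \<ge> N" for m i
      proof (rule tendsto_upperbound)
        show "(\<lambda>n. norm (a m i - a n i)) \<longlonglongrightarrow> norm (a m i - b i)"
          by (intro tendsto_intros b)
        show "eventually (\<lambda>n. norm (a m i - a n i) \<le> e) sequentially"
          using N that by (auto simp: eventually_sequentially)
      qed simp
      then show ?thesis by blast
    qed
    have bb: "bounded (range b)"
    proof -
      obtain N where N: "\<forall>m\<ge>N. \<forall>i. norm (a m i - b i) \<le> 1" using unif[of 1] by auto
      have "norm (b i) \<le> ns_norm ell_infty (a N) + 1" for i
        using ell_infty_norm_ge[OF a, of N i] N norm_triangle_sub[of "b i" "a N i"]
        by (smt (verit) le_refl norm_minus_commute)
      then show ?thesis by (auto simp: bounded_iff)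
    qed
    have "ns_norm X (u b - l) \<le> 0"
    proof (rule field_le_epsilon)
      fix e :: real assume "e > 0"
      \<comment> \<open>The denominator |C| + 1 is positive whatever the sign of C.\<close>
      define e' where "e' = e / 2 / (\<bar>C\<bar> + 1)"
      have e': "e' > 0" using \<open>e > 0\<close> by (simp add: e'_def)
      obtain N where N: "\<forall>m\<ge>N. \<forall>i. norm (a m i - b i) \<le> e'" using unif[OF e'] by auto
      have "eventually (\<lambda>n. ns_norm X (\<sigma> n - l) < e / 2) sequentially"
        using lim \<open>e > 0\<close> by (intro order_tendstoD) auto
      then obtain m where m: "m \<ge> N" "ns_norm X (\<sigma> m - l) < e / 2"
        using eventually_happens'[OF sequentially_bot eventually_conj[OF _ eventually_ge_at_top[of N]]]
        by blast
      have bd: "bounded (range (b - a m))" using Y.diff_mem[of b "a m"] a bb by simp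
      have ubX: "u b \<in> ns_carrier X" using linear_mapD(1)[OF u, of b] bb by simp
      have le: "ns_norm ell_infty (b - a m) \<le> e'"
        using N m by (intro ell_infty_norm_le) (simp add: norm_minus_commute)
      have "ns_norm X (u b - l) \<le> ns_norm X (u b - \<sigma> m) + ns_norm X (\<sigma> m - l)"
        by (rule X.norm_triangle_diff[OF ubX \<sigma>X l])
      also have "ns_norm X (u b - \<sigma> m) = ns_norm X (u (b - a m))" by (simp add: diff a bb \<sigma>)
      also have "\<dots> \<le> C * ns_norm ell_infty (b - a m)" by (rule upper[OF bd])
      also have "\<dots> \<le> (\<bar>C\<bar> + 1) * ns_norm ell_infty (b - a m)"
        using Y.norm_nonneg[of "b - a m"] bd by (intro mult_right_mono) auto
      also have "\<dots> \<le> (\<bar>C\<bar> + 1) * e'" using le by (intro mult_left_mono) auto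
      also have "(\<bar>C\<bar> + 1) * e' = e / 2"
      proof -
        have "\<bar>C\<bar> + 1 \<noteq> 0" by linarith
        then show ?thesis
          unfolding e'_def by (metis nonzero_mult_div_cancel_left times_divide_eq_right)
      qed
      finally show "ns_norm X (u b - l) \<le> 0 + e" using m by simp
    qed
    moreover have "u b - l \<in> ns_carrier X"
      using X.diff_mem[OF _ l] linear_mapD(1)[OF u, of b] bb by simp
    ultimately have "u b - l = 0"
      using X.norm_eq_0D X.norm_nonneg by (meson order_antisym)
    then show "l \<in> u ` ns_carrier ell_infty" using bb by auto
  qed
  then show ?thesis
    unfolding contains_copy_def closed_linear_subspace_def using copy by blast
qed

section \<open>Rosenthal's disjointification lemma\<close>

definition unit_seq :: "nat \<Rightarrow> nat \<Rightarrow> 'k::zero_neq_one"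
  where "unit_seq n = (\<lambda>i. if i = n then 1 else 0)"

definition ball_on :: "nat set \<Rightarrow> (nat \<Rightarrow> 'k::real_normed_vector) set"
  where "ball_on A = {x. (\<forall>i. norm (x i) \<le> 1) \<and> (\<forall>i. i \<notin> A \<longrightarrow> x i = 0)}"

definition ell_infty_linear ::
    "('k::real_normed_field \<Rightarrow> 'f::ab_group_add \<Rightarrow> 'f) \<Rightarrow> ((nat \<Rightarrow> 'k) \<Rightarrow> 'f) \<Rightarrow> bool"
  where "ell_infty_linear s S \<longleftrightarrow>
    (\<forall>x y. bounded (range x) \<longrightarrow> bounded (range y) \<longrightarrow> S (x + y) = S x + S y) \<and>
    (\<forall>c x. bounded (range x) \<longrightarrow> S (\<lambda>i. c * x i) = s c (S x))"

lemma ell_infty_linearD: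
  assumes "ell_infty_linear s S" "bounded (range x)"
  shows "bounded (range y) \<Longrightarrow> S (x + y) = S x + S y" "S (\<lambda>i. c * x i) = s c (S x)"
  using assms by (auto simp: ell_infty_linear_def)

lemma ball_on_bounded: "x \<in> ball_on A \<Longrightarrow> bounded (range x)"
  by (auto simp: ball_on_def bounded_iff)

lemma ball_on_mono: "A \<subseteq> B \<Longrightarrow> ball_on A \<subseteq> ball_on B"
  by (auto simp: ball_on_def)

lemma unit_seq_ball: "(unit_seq n :: nat \<Rightarrow> 'k::real_normed_field) \<in> ball_on {n}"
  by (auto simp: unit_seq_def ball_on_def)

lemma indicator_ball: "(indicator A :: nat \<Rightarrow> 'k::real_normed_field) \<in> ball_on A"
  by (auto simp: ball_on_def indicator_def)

lemma ell_infty_linear_bound: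
  fixes s :: "'k::real_or_complex \<Rightarrow> 'f::banach \<Rightarrow> 'f"
  assumes "banach_over s" and S: "ell_infty_linear s S"
    and B: "\<And>x. x \<in> ball_on A \<Longrightarrow> norm (S x) \<le> B"
    and x: "\<And>i. norm (x i) \<le> K" "\<And>i. i \<notin> A \<Longrightarrow> x i = 0"
  shows "norm (S x) \<le> K * B"
proof -
  interpret banach_over s by fact
  have K: "K \<ge> 0" using order_trans[OF norm_ge_zero x(1)] .
  show ?thesis
  proof (cases "K = 0")
    case True
    then have "x = (\<lambda>i. 0 * x i)" using x(1) by auto
    moreover have "bounded (range x)" using x(1) by (auto simp: bounded_iff)
    ultimately have "S x = s 0 (S x)" using ell_infty_linearD(2)[OF S] by metis
    then have "S x = 0" by (simp only: scale_zero_left)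
    then show ?thesis using True by simp
  next
    case False
    define y where "y = (\<lambda>i. inverse (of_real K) * x i)"
    have y: "y \<in> ball_on A"
      using x K False by (auto simp: ball_on_def y_def norm_divide norm_mult norm_inverse field_simps)
    have "x = (\<lambda>i. of_real K * y i)" using False by (auto simp: y_def)
    then have "S x = s (of_real K) (S y)"
      using ell_infty_linearD(2)[OF S ball_on_bounded[OF y]] by metis
    then show ?thesis
      using mult_left_mono[OF B[OF y] K] K by (simp add: norm_scale)
  qed
qed

lemma infinite_disjoint_split:
  assumes "infinite (M :: nat set)"
  shows "\<exists>P :: nat \<Rightarrow> nat set. (\<forall>p. infinite (P p) \<and> P p \<subseteq> M) \<and>
    (\<forall>p q i. i \<in> P p \<longrightarrow> i \<in> P q \<longrightarrow> p = q)"
proof -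
  have inj: "inj (enumerate M)" using strict_mono_enumerate[OF assms] by (rule strict_mono_imp_inj_on)
  define P where "P p = range (\<lambda>q. enumerate M (prod_encode (p, q)))" for p
  have "inj (\<lambda>q. enumerate M (prod_encode (p, q)))" for p
    using inj by (intro injI) (auto simp: prod_encode_eq dest!: injD)
  then have "infinite (P p)" for p
    unfolding P_def using infinite_UNIV_nat by (meson finite_imageD)
  moreover have "P p \<subseteq> M" for p using assms by (auto simp: P_def enumerate_in_set)
  moreover have "p = q" if "i \<in> P p" "i \<in> P q" for p q i
    using that inj by (auto simp: P_def prod_encode_eq dest!: injD)
  ultimately show ?thesis by (intro exI[of _ P]) simp
qed

lemma unimodular_multiple:
  fixes z :: "'k::real_normed_field"
  obtains u where "norm u = 1" "u * z = of_real (norm z)"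
proof (cases "z = 0")
  case True
  then show thesis using that[of 1] by simp
next
  case False
  then show thesis using that[of "of_real (norm z) / z"] by (simp add: norm_divide)
qed

text \<open>Induction on j, where j * e bounds all functionals on the ball over M. Split M into
  infinitely many infinite blocks. If no block works, each contains an index n p and a vector x p,
  vanishing at n p, on which h (n p) exceeds e. On the set of these indices the bound drops by e,
  because x p can be added to any vector supported there. After finitely many drops some block must
  work.\<close>

lemma rosenthal_disjointification:
  fixes h :: "nat \<Rightarrow> (nat \<Rightarrow> 'k::real_or_complex) \<Rightarrow> 'k"
  assumes lin: "\<And>n. ell_infty_linear (*) (h n)"
    and bound: "\<And>n x. x \<in> ball_on UNIV \<Longrightarrow> norm (h n x) \<le> C"
    and "e > 0" and "infinite N"
  shows "\<exists>M\<subseteq>N. infinite M \<and> (\<forall>n\<in>M. \<forall>x\<in>ball_on (M - {n}). norm (h n x) \<le> e)"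
proof -
  have step: "\<exists>M'\<subseteq>M. infinite M' \<and> (\<forall>n\<in>M'. \<forall>x\<in>ball_on (M' - {n}). norm (h n x) \<le> e)"
    if "infinite M" "\<And>n x. n \<in> M \<Longrightarrow> x \<in> ball_on M \<Longrightarrow> norm (h n x) \<le> real j * e" for j M
    using that
  proof (induction j arbitrary: M)
    case 0
    have "norm (h n x) \<le> e" if "n \<in> M" "x \<in> ball_on (M - {n})" for n x
      using 0(2)[of n x] that ball_on_mono[of "M - {n}" M] \<open>e > 0\<close> by fastforce
    with 0 show ?case by blast
  next
    case (Suc j)
    obtain P :: "nat \<Rightarrow> nat set" where P': "\<forall>p. infinite (P p) \<and> P p \<subseteq> M"
      and disj': "\<forall>p q i. i \<in> P p \<longrightarrow> i \<in> P q \<longrightarrow> p = q"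
      using infinite_disjoint_split[OF Suc.prems(1)] by (elim exE conjE) (rule that)
    have P: "infinite (P p)" "P p \<subseteq> M" for p using P' by auto
    have disj: "p = q" if "i \<in> P p" "i \<in> P q" for p q i using disj' that by blast
    show ?case
    proof (cases "\<exists>p. \<forall>n\<in>P p. \<forall>x\<in>ball_on (P p - {n}). norm (h n x) \<le> e")
      case True
      then show ?thesis using P by blast
    next
      case False
      then have "\<forall>p. \<exists>n x. n \<in> P p \<and> x \<in> ball_on (P p - {n}) \<and> norm (h n x) > e"
        by (meson not_le)
      then obtain n x where n: "\<And>p. n p \<in> P p" and x: "\<And>p. x p \<in> ball_on (P p - {n p})"
        and big: "\<And>p. norm (h (n p) (x p)) > e"
        by metis
      have "inj n" using n disj by (metis injI)
      then have inf: "infinite (range n)" by (simp add: finite_image_iff)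
      have sub: "range n \<subseteq> M" using n P by blast
      have small: "norm (h m y) \<le> real j * e" if m: "m \<in> range n" and y: "y \<in> ball_on (range n)" for m y
      proof -
        obtain p where p: "m = n p" using m by auto
        obtain a where a: "norm a = 1" "a * h m y = of_real (norm (h m y))" by (rule unimodular_multiple)
        obtain b where b: "norm b = 1" "b * h m (x p) = of_real (norm (h m (x p)))" by (rule unimodular_multiple)
        \<comment> \<open>The range of n meets P p in n p alone, where x p vanishes. Hence y and x p
          have disjoint supports, w stays in the unit ball, and the two rotations make the values
          add up without cancellation.\<close>
        define w where "w = (\<lambda>i. a * y i) + (\<lambda>i. b * x p i)"
        have dj: "y i = 0 \<or> x p i = 0" for i
        proof (rule ccontr)
          assume *: "\<not> ?thesis"
          then have "i \<in> range n" "i \<in> P p - {n p}"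
            using y x[of p] by (auto simp: ball_on_def)
          then show False using n disj by blast
        qed
        have wi: "norm (w i) = norm (y i) \<or> norm (w i) = norm (x p i)" for i
          using dj[of i] a(1) b(1) by (auto simp: w_def norm_mult)
        have "norm (w i) \<le> 1" for i
          using wi[of i] y x[of p] by (auto simp: ball_on_def)
        moreover have "w i = 0" if "i \<notin> M" for i
        proof -
          have "i \<notin> range n" "i \<notin> P p" using that sub P(2)[of p] by blast+
          then have "y i = 0" "x p i = 0" using y x[of p] unfolding ball_on_def by blast+
          then show ?thesis by (simp add: w_def)
        qed
        ultimately have w: "w \<in> ball_on M" by (auto simp: ball_on_def)
        have "h m w = a * h m y + b * h m (x p)"
          unfolding w_def using ball_on_bounded[OF y] ball_on_bounded[OF x]
          by (simp add: ell_infty_linearD[OF lin] bounded_range_mult)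
        also have "\<dots> = of_real (norm (h m y) + norm (h m (x p)))" by (simp add: a b)
        finally have "norm (h m w) = norm (h m y) + norm (h m (x p))"
          by (metis norm_of_real abs_of_nonneg add_nonneg_nonneg norm_ge_zero)
        moreover have "m \<in> M" using m sub by blast
        ultimately have "norm (h m y) + e \<le> real (Suc j) * e"
          using Suc.prems(2)[OF _ w, of m] big[of p] p by simp
        then show ?thesis by (simp add: algebra_simps)
      qed
      obtain M' where "M' \<subseteq> range n" "infinite M' \<and> (\<forall>n\<in>M'. \<forall>x\<in>ball_on (M' - {n}). norm (h n x) \<le> e)"
        using Suc.IH[OF inf small] by blast
      then show ?thesis using sub by blast
    qed
  qed
  obtain j :: nat where "C / e \<le> real j" using real_arch_simple by blast
  then have "C \<le> real j * e" using \<open>e > 0\<close> by (simp add: field_simps)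
  then have "norm (h n x) \<le> real j * e" if "x \<in> ball_on N" for n x
    using bound[of x n] that ball_on_mono[of N UNIV] by fastforce
  then show ?thesis using step[OF \<open>infinite N\<close>, of j] by blast
qed

text \<open>Rosenthal's theorem on operators from \<open>ell_infty\<close>: take functionals norming
  S at unit sequences where its values stay above d, and thin the index set until each functional
  nearly ignores the other indices. On sequences supported by the thinned set, S is bounded
  below.\<close>

theorem (in banach_over) contains_ell_inftyI:
  fixes S :: "(nat \<Rightarrow> 'k) \<Rightarrow> 'e"
  assumes S: "ell_infty_linear scale S" and bound: "\<And>x. x \<in> ball_on UNIV \<Longrightarrow> norm (S x) \<le> C"
    and not_null: "\<not> (\<lambda>n. S (unit_seq n)) \<longlonglongrightarrow> 0"
  shows "contains_copy (whole_space scale) (ell_infty :: ('k, nat \<Rightarrow> 'k) nspace)"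
proof -
  obtain d where "d > 0" and "\<not> eventually (\<lambda>n. norm (S (unit_seq n)) < d) sequentially"
    using not_null unfolding tendsto_iff by (auto simp: dist_norm)
  then have inf: "infinite {n. d \<le> norm (S (unit_seq n))}"
    unfolding not_eventually not_less frequently_cofinite[symmetric] cofinite_eq_sequentially
    by simp
  have "\<forall>n. \<exists>f. Vector_Spaces.linear scale (*) f \<and> (\<forall>x. norm (f x) \<le> norm x) \<and>
      norm (f (S (unit_seq n))) = norm (S (unit_seq n))"
    by (metis norming_functional)
  then obtain f where f: "\<And>n. Vector_Spaces.linear scale (*) (f n)" "\<And>n x. norm (f n x) \<le> norm x"
    and norming: "\<And>n. norm (f n (S (unit_seq n))) = norm (S (unit_seq n))" by metis
  have fadd: "f n (x + y) = f n x + f n y" and fscale: "f n (scale c x) = c * f n x" for n x y c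
    using f(1)[of n] by (auto simp: Vector_Spaces.linear_def module_hom_def module_hom_axioms_def)
  have lin: "ell_infty_linear (*) (\<lambda>x. f n (S x))" for n
    using S by (auto simp: ell_infty_linear_def fadd fscale)
  have fS: "norm (f n (S x)) \<le> C" if "x \<in> ball_on UNIV" for n x
    using f(2)[of n "S x"] bound[OF that] by linarith
  have "d / 2 > 0" using \<open>d > 0\<close> by simp
  obtain M where M: "infinite M" "M \<subseteq> {n. d \<le> norm (S (unit_seq n))}"
    and small: "\<And>n x. n \<in> M \<Longrightarrow> x \<in> ball_on (M - {n}) \<Longrightarrow> norm (f n (S x)) \<le> d / 2"
    using rosenthal_disjointification[where h = "\<lambda>n x. f n (S x)", OF lin fS \<open>d / 2 > 0\<close> inf]
    by meson
  define r where "r = enumerate M"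
  have inj: "inj r" unfolding r_def by (rule strict_mono_imp_inj_on[OF strict_mono_enumerate[OF M(1)]])
  have rM: "r n \<in> M" for n unfolding r_def by (rule enumerate_in_set[OF M(1)])
  \<comment> \<open>Transplants a sequence to the thinned index set; \<open>inv r\<close> is only
    read on the range of r.\<close>
  define push where "push x = (\<lambda>i. if i \<in> range r then x (inv r i) else 0)" for x :: "nat \<Rightarrow> 'k"
  have push_r: "push x (r n) = x n" for x n using inj by (simp add: push_def)
  have push_le: "norm (push x i) \<le> K" if "\<And>n. norm (x n) \<le> K" for x i K
    using that order_trans[OF norm_ge_zero that] by (auto simp: push_def)
  have push_supp: "push x i = 0" if "i \<notin> M" for x i using that rM by (auto simp: push_def)
  have push_bd: "bounded (range (push x))" if bx: "bounded (range x)" for x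
  proof -
    obtain K where K: "\<And>n. norm (x n) \<le> K" using bx by (auto simp: bounded_iff)
    have "norm (push x i) \<le> K" for i using K by (rule push_le)
    then show ?thesis by (auto simp: bounded_iff)
  qed
  have push_add: "push (x + y) = push x + push y" for x y by (auto simp: push_def)
  have push_scale: "push (\<lambda>i. c * x i) = (\<lambda>i. c * push x i)" for c x by (auto simp: push_def)
  have ge: "norm (x n) \<le> ns_norm ell_infty x" if "bounded (range x)" for x :: "nat \<Rightarrow> 'k" and n
    by (rule ell_infty_norm_ge[OF that])
  show ?thesis
  proof (rule contains_copy_ell_inftyI[OF normed_nspace_whole_space])
    show "linear_map ell_infty (whole_space scale) (\<lambda>x. S (push x))"
      by (auto simp: linear_map_def whole_space_def push_add push_scale push_bd ell_infty_linearD[OF S])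
    show "d / 2 > 0" using \<open>d > 0\<close> by simp
    fix x :: "nat \<Rightarrow> 'k" assume x: "bounded (range x)"
    let ?K = "ns_norm ell_infty x"
    have pK: "norm (push x i) \<le> ?K" for i using ge[OF x] by (rule push_le)
    have "norm (S (push x)) \<le> ?K * C"
      using bound pK
      by (intro ell_infty_linear_bound[OF banach_over_axioms S, where A = UNIV]) auto
    then show "ns_norm (whole_space scale) (S (push x)) \<le> C * ?K"
      by (simp add: whole_space_def mult.commute)
    \<comment> \<open>The functional at r n sees the coordinate x n with weight at least d and all
      the others together with at most K d / 2. The supremum over n is taken afterwards, which
      leaves d / 2 as lower constant.\<close>
    have "norm (x n) \<le> (norm (S (push x)) + ?K * (d / 2)) / d" for n
    proof -
      let ?m = "r n"
      define y where "y = push x - (\<lambda>i. x n * unit_seq ?m i)"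
      have y_eq: "y i = (if i = ?m then 0 else push x i)" for i
        by (simp add: y_def unit_seq_def push_r)
      have K0: "0 \<le> ?K" using order_trans[OF norm_ge_zero ge[OF x]] .
      have y: "norm (y i) \<le> ?K" "i \<notin> M - {?m} \<Longrightarrow> y i = 0" for i
        using pK[of i] push_supp[of i x] K0 by (auto simp: y_eq)
      have ybd: "bounded (range y)" using y by (auto simp: bounded_iff)
      have ubd: "bounded (range (unit_seq ?m :: nat \<Rightarrow> 'k))" using ball_on_bounded[OF unit_seq_ball] .
      have "norm (f ?m (S y)) \<le> ?K * (d / 2)"
        using small[OF rM] y
        by (intro ell_infty_linear_bound[OF banach_over_field lin, where A = "M - {?m}"]) auto
      moreover have "push x = y + (\<lambda>i. x n * unit_seq ?m i)" by (simp add: y_def)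
      then have "f ?m (S (push x)) = f ?m (S y) + x n * f ?m (S (unit_seq ?m))"
        by (simp add: ell_infty_linearD[OF S] ybd ubd bounded_range_mult fadd fscale)
      then have "norm (x n) * norm (f ?m (S (unit_seq ?m))) \<le> norm (f ?m (S (push x))) + norm (f ?m (S y))"
        using norm_triangle_ineq4[of "f ?m (S (push x))" "f ?m (S y)"] by (simp add: norm_mult)
      moreover have "norm (x n) * d \<le> norm (x n) * norm (f ?m (S (unit_seq ?m)))"
        using M(2) rM[of n] norming[of ?m] by (intro mult_left_mono) auto
      ultimately have "norm (x n) * d \<le> norm (S (push x)) + ?K * (d / 2)"
        using f(2)[of ?m "S (push x)"] by linarith
      then show ?thesis using \<open>d > 0\<close> by (simp add: field_simps)
    qed
    then have "?K \<le> (norm (S (push x)) + ?K * (d / 2)) / d" by (rule ell_infty_norm_le)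
    then show "d / 2 * ?K \<le> ns_norm (whole_space scale) (S (push x))"
      using \<open>d > 0\<close> by (simp add: whole_space_def field_simps)
  qed
qed

section \<open>Complemented copies of \<open>\<ell>\<^sub>1\<close>\<close>

lemma ell_one_carrier [simp]: "x \<in> ns_carrier ell_one \<longleftrightarrow> summable (\<lambda>n. norm (x n))"
  by (simp add: ell_one_def)

lemma ell_one_scale [simp]: "ns_scale ell_one c x = (\<lambda>n. c * x n)"
  by (simp add: ell_one_def)

lemma ell_one_norm: "ns_norm ell_one x = (\<Sum>n. norm (x n))"
  by (simp add: ell_one_def)

lemma summable_norm_add:
  fixes x y :: "nat \<Rightarrow> 'a::real_normed_vector"
  assumes "summable (\<lambda>n. norm (x n))" "summable (\<lambda>n. norm (y n))"
  shows "summable (\<lambda>n. norm (x n + y n))"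
  by (rule summable_comparison_test'[OF summable_add[OF assms], of 0]) (simp add: norm_triangle_ineq)

lemma normed_nspace_ell_one:
  "normed_nspace (ell_one :: ('k::real_or_complex, nat \<Rightarrow> 'k) nspace)"
proof (rule normed_nspace.intro)
  show "vector_space (ns_scale (ell_one :: ('k, nat \<Rightarrow> 'k) nspace))"
    using vector_space_fun[OF vector_space_field[where 'k='k]] by (simp add: ell_one_def)
next
  fix x y :: "nat \<Rightarrow> 'k" and c :: 'k
  show "(0 :: nat \<Rightarrow> 'k) \<in> ns_carrier ell_one" by simp
  show "x + y \<in> ns_carrier ell_one" if "x \<in> ns_carrier ell_one" "y \<in> ns_carrier ell_one"
    using that summable_norm_add[of x y] by simp
  assume "x \<in> ns_carrier ell_one"
  then have x: "summable (\<lambda>n. norm (x n))" by simp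
  then show "ns_scale ell_one c x \<in> ns_carrier ell_one" by (simp add: norm_mult summable_mult)
  show "0 \<le> ns_norm ell_one x" by (simp add: ell_one_norm suminf_nonneg x)
  show "x = 0" if "ns_norm ell_one x = 0"
    using that suminf_eq_zero_iff[OF x] by (auto simp: ell_one_norm)
  show "ns_norm ell_one (x + y) \<le> ns_norm ell_one x + ns_norm ell_one y"
    if "y \<in> ns_carrier ell_one"
    unfolding ell_one_norm using x that summable_norm_add[of x y]
    by (simp add: suminf_add suminf_le summable_add norm_triangle_ineq)
  show "ns_norm ell_one (ns_scale ell_one c x) = norm c * ns_norm ell_one x"
    using x by (simp add: ell_one_norm norm_mult suminf_mult)
qed

section \<open>Absolutely convergent combinations and biorthogonal systems\<close>

lemma summable_norm_finite_bound:
  fixes f :: "nat \<Rightarrow> 'a::real_normed_vector"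
  assumes "\<And>A. finite A \<Longrightarrow> (\<Sum>n\<in>A. norm (f n)) \<le> C"
  shows "summable (\<lambda>n. norm (f n))" "(\<Sum>n. norm (f n)) \<le> C"
proof -
  show s: "summable (\<lambda>n. norm (f n))"
    by (rule bounded_imp_summable[of _ C]) (use assms in auto)
  show "(\<Sum>n. norm (f n)) \<le> C" by (rule suminf_le_const[OF s]) (use assms in auto)
qed

lemma (in banach_over) bounded_linear_scale: "bounded_linear (scale c)"
proof (rule bounded_linear_intro[where K = "norm c"])
  show "scale c (r *\<^sub>R x) = r *\<^sub>R scale c x" for r x
    by (simp add: scale_of_real[symmetric] mult.commute)
qed (simp_all add: scale_right_distrib norm_scale mult.commute)

context banach_over
begin

lemma linear_scalarD:
  assumes "Vector_Spaces.linear scale (*) f"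
  shows "f (x + y) = f x + f y" "f (scale c x) = c * f x" "f (x - y) = f x - f y" "f 0 = 0"
    "f (r *\<^sub>R x) = r *\<^sub>R f x"
proof -
  interpret Vector_Spaces.linear scale "(*)" f by fact
  show "f (x + y) = f x + f y" "f (scale c x) = c * f x" "f (x - y) = f x - f y" "f 0 = 0"
    by (rule add scale diff zero)+
  show "f (r *\<^sub>R x) = r *\<^sub>R f x"
    by (simp add: scale_of_real[symmetric] scale scaleR_conv_of_real)
qed

lemma combination_summable:
  fixes x :: "nat \<Rightarrow> 'e" and \<eta> :: "nat \<Rightarrow> 'k"
  assumes "\<And>m. norm (x m) \<le> L" "summable (\<lambda>m. norm (\<eta> m))"
  shows "summable (\<lambda>m. norm (scale (\<eta> m) (x m)))"
    "norm (\<Sum>m. scale (\<eta> m) (x m)) \<le> L * (\<Sum>m. norm (\<eta> m))"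
proof -
  have le: "norm (scale (\<eta> m) (x m)) \<le> L * norm (\<eta> m)" for m
    using mult_right_mono[OF assms(1)[of m] norm_ge_zero[of "\<eta> m"]] by (simp add: norm_scale mult.commute)
  show s: "summable (\<lambda>m. norm (scale (\<eta> m) (x m)))"
    by (rule summable_comparison_test'[OF summable_mult[OF assms(2)], of 0]) (use le in auto)
  have "norm (\<Sum>m. scale (\<eta> m) (x m)) \<le> (\<Sum>m. norm (scale (\<eta> m) (x m)))"
    by (rule summable_norm[OF s])
  also have "\<dots> \<le> (\<Sum>m. L * norm (\<eta> m))"
    by (intro suminf_le s summable_mult assms(2) le)
  finally show "norm (\<Sum>m. scale (\<eta> m) (x m)) \<le> L * (\<Sum>m. norm (\<eta> m))"
    by (simp add: suminf_mult[OF assms(2)])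
qed

lemma bounded_linear_scalar:
  assumes "Vector_Spaces.linear scale (*) f" "\<And>x. norm (f x) \<le> C * norm x"
  shows "bounded_linear f"
  by (rule bounded_linear_intro[where K = C])
    (use assms(2) in \<open>auto simp: linear_scalarD[OF assms(1)] mult.commute\<close>)

lemma functional_combination:
  fixes x :: "nat \<Rightarrow> 'e" and \<eta> :: "nat \<Rightarrow> 'k"
  assumes f: "Vector_Spaces.linear scale (*) f" "\<And>x. norm (f x) \<le> C * norm x"
    and x: "\<And>m. norm (x m) \<le> L" "summable (\<lambda>m. norm (\<eta> m))"
  shows "(\<lambda>m. \<eta> m * f (x m)) sums f (\<Sum>m. scale (\<eta> m) (x m))"
  using bounded_linear.sums[OF bounded_linear_scalar[OF f] summable_sums[OF summable_norm_cancel[OF combination_summable(1)[OF x]]]]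
  by (simp add: linear_scalarD[OF f(1)])

text \<open>The coordinate map R and the synthesis map u satisfy R u = id on \<open>ell_one\<close>.
  Hence u R is a projection onto the range of u, and boundedness of R bounds u from below.\<close>

lemma contains_complemented_ell_one_biorthogonal:
  fixes g :: "nat \<Rightarrow> 'e \<Rightarrow> 'k" and y :: "nat \<Rightarrow> 'e"
  assumes g: "\<And>n. Vector_Spaces.linear scale (*) (g n)"
    and sum: "\<And>x A. finite A \<Longrightarrow> (\<Sum>n\<in>A. norm (g n x)) \<le> C * norm x"
    and y: "\<And>n. norm (y n) \<le> L" and bi: "\<And>n m. g n (y m) = (if n = m then 1 else 0)"
  shows "contains_complemented_copy (whole_space scale) (ell_one :: ('k, nat \<Rightarrow> 'k) nspace)"
proof -
  let ?X = "whole_space scale" and ?l = "ell_one :: ('k, nat \<Rightarrow> 'k) nspace"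
  interpret X: normed_nspace ?X by (rule normed_nspace_whole_space)
  define u where "u \<eta> = (\<Sum>m. scale (\<eta> m) (y m))" for \<eta>
  define R where "R x = (\<lambda>n. g n x)" for x
  have gb: "norm (g n x) \<le> C * norm x" for n x using sum[of "{n}" x] by simp
  have R: "summable (\<lambda>n. norm (R x n))" "ns_norm ?l (R x) \<le> C * norm x" for x
    using summable_norm_finite_bound[of "\<lambda>n. g n x", OF sum] by (auto simp: R_def ell_one_norm)
  have u_norm: "norm (u \<eta>) \<le> L * ns_norm ?l \<eta>" if "\<eta> \<in> ns_carrier ?l" for \<eta>
    unfolding u_def ell_one_norm using that by (intro combination_summable y) simp
  have sm: "summable (\<lambda>m. scale (\<eta> m) (y m))" if "summable (\<lambda>m. norm (\<eta> m))" for \<eta>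
    by (rule summable_norm_cancel[OF combination_summable(1)[OF y that]])
  have lin: "linear_map ?l ?X u"
    unfolding linear_map_def
  proof (intro conjI funcsetI ballI allI)
    fix \<eta> \<zeta> assume *: "\<eta> \<in> ns_carrier ?l" "\<zeta> \<in> ns_carrier ?l"
    show "u (\<eta> + \<zeta>) = u \<eta> + u \<zeta>"
      using suminf_add[OF sm sm, of \<eta> \<zeta>] * by (simp add: u_def scale_left_distrib)
  next
    fix c \<eta> assume *: "\<eta> \<in> ns_carrier ?l"
    show "u (ns_scale ?l c \<eta>) = ns_scale ?X c (u \<eta>)"
      using bounded_linear.suminf[OF bounded_linear_scale sm, of \<eta> c] * by (simp add: u_def whole_space_def)
  qed (simp add: whole_space_def)
  have Ru: "R (u \<eta>) = \<eta>" if "\<eta> \<in> ns_carrier ?l" for \<eta>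
  proof
    fix n
    have "(\<lambda>m. \<eta> m * g n (y m)) sums R (u \<eta>) n"
      unfolding R_def u_def using that by (intro functional_combination[OF g gb y]) simp
    moreover have "(\<lambda>m. \<eta> m * g n (y m)) = (\<lambda>m. if m = n then \<eta> m else 0)" by (auto simp: bi)
    moreover have "(\<lambda>m. if m = n then \<eta> m else 0) sums \<eta> n" using sums_single[of n \<eta>] by simp
    ultimately show "R (u \<eta>) n = \<eta> n" by (metis sums_unique2)
  qed
  have C: "\<bar>C\<bar> + 1 > 0" by simp
  have lower: "1 / (\<bar>C\<bar> + 1) * ns_norm ?l \<eta> \<le> ns_norm ?X (u \<eta>)" if "\<eta> \<in> ns_carrier ?l" for \<eta>
  proof -
    have "ns_norm ?l \<eta> \<le> C * norm (u \<eta>)" using R(2)[of "u \<eta>"] Ru[OF that] by simp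
    also have "\<dots> \<le> (\<bar>C\<bar> + 1) * norm (u \<eta>)" by (intro mult_right_mono) auto
    finally show ?thesis using C by (simp add: whole_space_def field_simps)
  qed
  have upper: "ns_norm ?X (u \<eta>) \<le> L * ns_norm ?l \<eta>" if "\<eta> \<in> ns_carrier ?l" for \<eta>
    using u_norm[OF that] by (simp add: whole_space_def)
  have C': "1 / (\<bar>C\<bar> + 1) > 0" using C by simp
  note copy = bounded_below_linearly_homeomorphic[OF normed_nspace_whole_space normed_nspace_ell_one lin C' lower upper]
  define p where "p x = u (R x)" for x
  have R_mem: "R x \<in> ns_carrier ?l" for x using R(1)[of x] by simp
  have R_add: "R (x + z) = R x + R z" and R_scale: "R (scale c x) = ns_scale ?l c (R x)" for x z c
    by (auto simp: R_def linear_scalarD[OF g])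
  have p_add: "p (x + z) = p x + p z" for x z
    unfolding p_def R_add by (rule linear_mapD(2)[OF lin R_mem R_mem])
  have p_scale: "p (scale c x) = scale c (p x)" for c x
    unfolding p_def R_scale linear_mapD(3)[OF lin R_mem] by (simp add: whole_space_def)
  have pp: "p (p x) = p x" for x unfolding p_def by (simp only: Ru[OF R_mem])
  have p_norm: "norm (p x) \<le> (\<bar>L\<bar> * C) * norm x" for x
  proof -
    have "norm (p x) \<le> L * ns_norm ?l (R x)" unfolding p_def by (rule u_norm[OF R_mem])
    also have "\<dots> \<le> \<bar>L\<bar> * ns_norm ?l (R x)"
      by (intro mult_right_mono normed_nspace.norm_nonneg[OF normed_nspace_ell_one] R_mem) simp
    also have "\<dots> \<le> \<bar>L\<bar> * (C * norm x)" by (intro mult_left_mono R) simp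
    finally show ?thesis by simp
  qed
  have range_p: "range p = u ` ns_carrier ?l"
  proof
    show "range p \<subseteq> u ` ns_carrier ?l" using R_mem by (auto simp: p_def)
    show "u ` ns_carrier ?l \<subseteq> range p"
    proof
      fix z assume "z \<in> u ` ns_carrier ?l"
      then obtain \<eta> where "\<eta> \<in> ns_carrier ?l" "z = u \<eta>" by blast
      then have "z = p z" by (simp only: p_def Ru)
      then show "z \<in> range p" by blast
    qed
  qed
  \<comment> \<open>The range is the set of fixed points of the bounded projection p.\<close>
  have "closedin (norm_topology ?X) (u ` ns_carrier ?l)"
  proof (rule X.closedin_norm_topologyI[OF copy(1)])
    fix \<sigma> l assume \<sigma>: "\<And>n::nat. \<sigma> n \<in> u ` ns_carrier ?l" and "(\<lambda>n. ns_norm ?X (\<sigma> n - l)) \<longlonglongrightarrow> 0"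
    then have lim: "(\<lambda>n. norm (\<sigma> n - l)) \<longlonglongrightarrow> 0" by (simp add: whole_space_def)
    have "p (\<sigma> n) = \<sigma> n" for n using \<sigma>[of n] pp unfolding range_p[symmetric] by auto
    moreover have pdiff: "p (x - z) = p x - p z" for x z using p_add[of "x - z" z] by (simp add: algebra_simps)
    ultimately have "norm (\<sigma> n - p l) \<le> (\<bar>L\<bar> * C) * norm (\<sigma> n - l)" for n
      using p_norm[of "\<sigma> n - l"] by simp
    then have "(\<lambda>n. \<sigma> n - p l) \<longlonglongrightarrow> 0"
      using tendsto_mult_right_zero[OF lim, of "\<bar>L\<bar> * C"] by (intro Lim_null_comparison[of "\<lambda>n. \<sigma> n - p l"]) auto
    then have "\<sigma> \<longlonglongrightarrow> p l" by (simp add: LIM_zero_iff)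
    moreover have "\<sigma> \<longlonglongrightarrow> l" using lim by (simp add: LIM_zero_iff tendsto_norm_zero_iff)
    ultimately have "l = p l" by (rule LIMSEQ_unique[symmetric])
    then show "l \<in> u ` ns_carrier ?l" unfolding range_p[symmetric] by blast
  qed
  moreover have "bounded_projection_onto ?X (u ` ns_carrier ?l) p"
    unfolding bounded_projection_onto_def linear_map_def
    using p_add p_scale pp p_norm range_p by (auto simp: whole_space_def)
  ultimately show ?thesis
    unfolding contains_complemented_copy_def closed_linear_subspace_def using copy by blast
qed

text \<open>Once g n (w n) = 1, disjointification applied to the columns of the matrix g n (w m)
  yields a subsequence whose off-diagonal column sums are at most 1/2. As an operator on
  \<open>ell_one\<close> that matrix differs from the identity by norm at most 1/2, and its inverse
  corrects the vectors to an exactly biorthogonal system.\<close>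

lemma contains_complemented_ell_oneI:
  fixes g :: "nat \<Rightarrow> 'e \<Rightarrow> 'k" and z :: "nat \<Rightarrow> 'e"
  assumes g: "\<And>n. Vector_Spaces.linear scale (*) (g n)"
    and sum: "\<And>x A. finite A \<Longrightarrow> (\<Sum>n\<in>A. norm (g n x)) \<le> C * norm x"
    and z: "\<And>n. norm (z n) \<le> K" and "d > 0" and big: "\<And>n. norm (g n (z n)) \<ge> d"
  shows "contains_complemented_copy (whole_space scale) (ell_one :: ('k, nat \<Rightarrow> 'k) nspace)"
proof -
  define L where "L = K / d"
  define w where "w n = scale (inverse (g n (z n))) (z n)" for n
  have gnz: "g n (z n) \<noteq> 0" for n using big[of n] \<open>d > 0\<close> by auto
  have gw: "g n (w n) = 1" for n using gnz by (simp add: w_def linear_scalarD[OF g])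
  have wL: "norm (w n) \<le> L" for n
  proof -
    have "norm (w n) = norm (z n) / norm (g n (z n))"
      by (simp add: w_def norm_scale norm_inverse divide_inverse)
    also have "\<dots> \<le> K / d" using z[of n] big[of n] \<open>d > 0\<close> order_trans[OF norm_ge_zero z[of n]]
      by (intro frac_le) auto
    finally show ?thesis by (simp add: L_def)
  qed
  have gb: "norm (g n x) \<le> C * norm x" for n x using sum[of "{n}" x] by simp
  note gsum = summable_norm_finite_bound[OF sum]
  have bnd: "summable (\<lambda>n. norm (\<xi> n * g n x))" if \<xi>: "bounded (range \<xi>)" for \<xi> x
  proof -
    obtain B where B: "\<And>n. norm (\<xi> n) \<le> B" using \<xi> by (auto simp: bounded_iff)
    show ?thesis
      by (rule summable_comparison_test'[OF summable_mult[OF gsum(1)[of x], of B], of 0])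
        (use B in \<open>auto simp: norm_mult intro!: mult_right_mono\<close>)
  qed
  \<comment> \<open>Column m of the matrix, read as a functional on \<open>ell_infty\<close>; its
    norm is at most |C| L for every m.\<close>
  define h where "h m \<xi> = (\<Sum>n. \<xi> n * g n (w m))" for m \<xi>
  have h_lin: "ell_infty_linear (*) (h m)" for m
    unfolding ell_infty_linear_def h_def
    using suminf_add[OF summable_norm_cancel[OF bnd] summable_norm_cancel[OF bnd]]
      suminf_mult[OF summable_norm_cancel[OF bnd]]
    by (auto simp: distrib_right mult.assoc)
  have h_le: "norm (h m \<xi>) \<le> (\<Sum>n. norm (g n (w m)))" if "\<xi> \<in> ball_on UNIV" for m \<xi>
  proof -
    have "norm (h m \<xi>) \<le> (\<Sum>n. norm (\<xi> n * g n (w m)))"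
      unfolding h_def by (rule summable_norm[OF bnd[OF ball_on_bounded[OF that]]])
    also have "\<dots> \<le> (\<Sum>n. norm (g n (w m)))"
      using that bnd[OF ball_on_bounded[OF that]] gsum(1)
      by (intro suminf_le) (auto simp: ball_on_def norm_mult intro!: mult_left_le_one_le)
    finally show ?thesis .
  qed
  have h_bd: "norm (h m \<xi>) \<le> \<bar>C\<bar> * L" if "\<xi> \<in> ball_on UNIV" for m \<xi>
  proof -
    have "norm (h m \<xi>) \<le> C * norm (w m)" using h_le[OF that, of m] gsum(2)[of "w m"] by linarith
    also have "\<dots> \<le> \<bar>C\<bar> * norm (w m)" by (intro mult_right_mono) auto
    also have "\<dots> \<le> \<bar>C\<bar> * L" by (intro mult_left_mono wL) auto
    finally show ?thesis .
  qed
  have half: "(1/2::real) > 0" by simp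
  obtain M where M: "infinite M"
    and small: "\<And>m \<xi>. m \<in> M \<Longrightarrow> \<xi> \<in> ball_on (M - {m}) \<Longrightarrow> norm (h m \<xi>) \<le> 1/2"
    using rosenthal_disjointification[where h = h, OF h_lin h_bd half infinite_UNIV_nat] by meson
  define r where "r = enumerate M"
  have inj: "inj r" unfolding r_def by (rule strict_mono_imp_inj_on[OF strict_mono_enumerate[OF M]])
  have rM: "r n \<in> M" for n unfolding r_def by (rule enumerate_in_set[OF M])
  define G where "G n = g (r n)" for n
  define x where "x n = w (r n)" for n
  have G: "Vector_Spaces.linear scale (*) (G n)" for n by (simp add: G_def g)
  have Gsum: "(\<Sum>n\<in>A. norm (G n v)) \<le> C * norm v" if "finite A" for v A
    using sum[of "r ` A" v] that sum.reindex[OF inj_on_subset[OF inj], of A "\<lambda>n. norm (g n v)"]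
    by (simp add: G_def)
  have Gb: "norm (G n v) \<le> C * norm v" for n v using gb by (simp add: G_def)
  have Gx: "G n (x n) = 1" for n by (simp add: G_def x_def gw)
  have xL: "norm (x n) \<le> L" for n by (simp add: x_def wL)
  \<comment> \<open>A unimodular sequence carried by the rows in A turns the sum of norms into a
    single value of h, which the choice of M keeps below 1/2.\<close>
  have off: "(\<Sum>n\<in>A. norm (G n (x m))) \<le> 1/2" if "finite A" "m \<notin> A" for A m
  proof -
    have "\<forall>n. \<exists>a. norm a = 1 \<and> a * g n (x m) = of_real (norm (g n (x m)))"
      by (metis unimodular_multiple)
    then obtain a where a: "\<And>n. norm (a n) = 1" "\<And>n. a n * g n (x m) = of_real (norm (g n (x m)))"
      by metis
    define \<xi> where "\<xi> n = (if n \<in> r ` A then a n else 0)" for n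
    have "\<xi> \<in> ball_on (M - {r m})"
      using rM that inj by (auto simp: ball_on_def \<xi>_def a dest: injD)
    then have "norm (h (r m) \<xi>) \<le> 1/2" by (intro small rM)
    also have "h (r m) \<xi> = (\<Sum>n\<in>r ` A. \<xi> n * g n (w (r m)))"
      unfolding h_def by (rule suminf_finite) (use that in \<open>auto simp: \<xi>_def\<close>)
    also have "\<dots> = (\<Sum>n\<in>r ` A. of_real (norm (g n (x m))))"
      by (rule sum.cong) (auto simp: \<xi>_def a(2)[unfolded x_def] x_def)
    also have "\<dots> = of_real (\<Sum>n\<in>A. norm (G n (x m)))"
      using sum.reindex[OF inj_on_subset[OF inj], of A "\<lambda>n. of_real (norm (g n (x m))) :: 'k"]
      by (simp add: G_def)
    also have "norm (\<dots> :: 'k) = (\<Sum>n\<in>A. norm (G n (x m)))"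
      by (subst norm_of_real) (simp add: sum_nonneg)
    finally show ?thesis .
  qed
  define u where "u \<eta> = (\<Sum>m. scale (\<eta> m) (x m))" for \<eta>
  \<comment> \<open>Identity minus matrix, acting on \<open>ell_one\<close>; its norm is the largest
    off-diagonal column sum.\<close>
  define N where "N \<eta> = (\<lambda>n. \<eta> n - G n (u \<eta>))" for \<eta>
  have N: "summable (\<lambda>n. norm (N \<eta> n)) \<and> (\<Sum>n. norm (N \<eta> n)) \<le> (\<Sum>n. norm (\<eta> n)) / 2"
    if \<eta>: "summable (\<lambda>n. norm (\<eta> n))" for \<eta>
  proof -
    have "(\<Sum>n\<in>A. norm (N \<eta> n)) \<le> (\<Sum>n. norm (\<eta> n)) / 2" if A: "finite A" for A
    proof -
      have N_le: "norm (N \<eta> n) \<le> (\<Sum>m. norm (\<eta> m) * (if m = n then 0 else norm (G n (x m))))"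
        and sm: "summable (\<lambda>m. norm (\<eta> m) * (if m = n then 0 else norm (G n (x m))))" for n
      proof -
        have "(\<lambda>m. \<eta> m * G n (x m)) sums G n (u \<eta>)"
          unfolding u_def by (rule functional_combination[OF G Gb xL \<eta>])
        moreover have "(\<lambda>m. if m = n then \<eta> m else 0) sums \<eta> n" using sums_single[of n \<eta>] by simp
        ultimately have "(\<lambda>m. (if m = n then \<eta> m else 0) - \<eta> m * G n (x m)) sums N \<eta> n"
          unfolding N_def by (rule sums_diff[rotated])
        also have "(\<lambda>m. (if m = n then \<eta> m else 0) - \<eta> m * G n (x m)) =
          (\<lambda>m. if m = n then 0 else - (\<eta> m * G n (x m)))" by (auto simp: Gx)
        finally have s: "(\<lambda>m. if m = n then 0 else - (\<eta> m * G n (x m))) sums N \<eta> n" .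
        have eq: "norm (if m = n then 0 else - (\<eta> m * G n (x m))) =
          norm (\<eta> m) * (if m = n then 0 else norm (G n (x m)))" for m by (simp add: norm_mult)
        have Gn: "norm (G n (x m)) \<le> \<bar>C\<bar> * L" for m
        proof -
          have "norm (G n (x m)) \<le> \<bar>C\<bar> * norm (x m)"
            using Gb[of n "x m"] mult_right_mono[OF abs_ge_self norm_ge_zero, of C "x m"] by linarith
          also have "\<dots> \<le> \<bar>C\<bar> * L" by (intro mult_left_mono xL) auto
          finally show ?thesis .
        qed
        have "norm (\<eta> m) * (if m = n then 0 else norm (G n (x m))) \<le> norm (\<eta> m) * (\<bar>C\<bar> * L)" for m
          using Gn[of m] order_trans[OF norm_ge_zero Gn[of m]] by (intro mult_left_mono) auto
        then show sm: "summable (\<lambda>m. norm (\<eta> m) * (if m = n then 0 else norm (G n (x m))))"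
          by (intro summable_comparison_test'[OF summable_mult2[OF \<eta>, of "\<bar>C\<bar> * L"], of 0])
            (auto simp: abs_mult)
        then show "norm (N \<eta> n) \<le> (\<Sum>m. norm (\<eta> m) * (if m = n then 0 else norm (G n (x m))))"
          using summable_norm[of "\<lambda>m. if m = n then 0 else - (\<eta> m * G n (x m))"] s
          unfolding eq by (simp add: sums_iff)
      qed
      have "(\<Sum>n\<in>A. norm (N \<eta> n)) \<le> (\<Sum>n\<in>A. \<Sum>m. norm (\<eta> m) * (if m = n then 0 else norm (G n (x m))))"
        by (intro sum_mono N_le)
      also have "\<dots> = (\<Sum>m. \<Sum>n\<in>A. norm (\<eta> m) * (if m = n then 0 else norm (G n (x m))))"
        by (rule suminf_sum[symmetric]) (rule sm)
      also have "\<dots> \<le> (\<Sum>m. norm (\<eta> m) * (1/2))"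
      proof (intro suminf_le summable_sum sm summable_mult2 \<eta>)
        fix m
        have "(\<Sum>n\<in>A. norm (\<eta> m) * (if m = n then 0 else norm (G n (x m)))) =
          norm (\<eta> m) * (\<Sum>n\<in>A - {m}. norm (G n (x m)))"
          unfolding sum_distrib_left[symmetric] using A
          by (intro arg_cong[where f = "\<lambda>t. norm (\<eta> m) * t"] sum.mono_neutral_cong_right) auto
        also have "\<dots> \<le> norm (\<eta> m) * (1/2)"
          using off[of "A - {m}" m] A by (intro mult_left_mono) auto
        finally show "(\<Sum>n\<in>A. norm (\<eta> m) * (if m = n then 0 else norm (G n (x m)))) \<le> norm (\<eta> m) * (1/2)" .
      qed
      also have "\<dots> = (\<Sum>n. norm (\<eta> n)) / 2"
        using suminf_mult2[OF \<eta>, of "1/2"] by simp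
      finally show ?thesis .
    qed
    then show ?thesis using summable_norm_finite_bound[of "N \<eta>"] by blast
  qed
  \<comment> \<open>Terms of the Neumann series: summed over k they give column m of the inverse
    matrix, and y m below is the combination of the x n with these coefficients.\<close>
  define \<eta> where "\<eta> m k = (N ^^ k) (unit_seq m)" for m k
  have \<eta>: "summable (\<lambda>n. norm (\<eta> m k n)) \<and> (\<Sum>n. norm (\<eta> m k n)) \<le> (1/2)^k" for m k
  proof (induction k)
    case 0
    have "(\<lambda>n. norm (unit_seq m n :: 'k)) = (\<lambda>n. if n = m then 1 else 0)" by (auto simp: unit_seq_def)
    then have "(\<lambda>n. norm (\<eta> m 0 n)) sums 1" using sums_single[of m "\<lambda>_. 1::real"] by (simp add: \<eta>_def)
    then show ?case by (simp add: sums_iff)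
  next
    case (Suc k)
    then show ?case using N[of "\<eta> m k"] by (auto simp: \<eta>_def)
  qed
  have L: "L \<ge> 0" using order_trans[OF norm_ge_zero xL[of 0]] .
  have u\<eta>: "norm (u (\<eta> m k)) \<le> L * (1/2)^k" for m k
    using combination_summable(2)[OF xL, of "\<eta> m k"] \<eta>[of m k] mult_left_mono[OF _ L, of _ "(1/2)^k"]
    unfolding u_def by (meson order_trans)
  have geo: "summable (\<lambda>k. L * (1/2::real)^k)" by (intro summable_mult summable_geometric) simp
  have su: "summable (\<lambda>k. norm (u (\<eta> m k)))" for m
    by (rule summable_comparison_test'[OF geo, of 0]) (use u\<eta> in auto)
  define y where "y m = (\<Sum>k. u (\<eta> m k))" for m
  show ?thesis
  proof (rule contains_complemented_ell_one_biorthogonal[OF G Gsum])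
    fix m
    have "norm (y m) \<le> (\<Sum>k. norm (u (\<eta> m k)))" unfolding y_def by (rule summable_norm[OF su])
    also have "\<dots> \<le> (\<Sum>k. L * (1/2)^k)" by (intro suminf_le su geo u\<eta>)
    finally show "norm (y m) \<le> (\<Sum>k. L * (1/2)^k)" .
  next
    fix n m
    have "(\<lambda>k. G n (u (\<eta> m k))) sums G n (y m)"
      unfolding y_def
      by (rule bounded_linear.sums[OF bounded_linear_scalar[OF G Gb] summable_sums[OF summable_norm_cancel[OF su]]])
    \<comment> \<open>By definition of N the matrix sends \<eta> m k to the difference of
      consecutive terms, so the series telescopes to the unit sequence.\<close>
    moreover have "G n (u (\<eta> m k)) = \<eta> m k n - \<eta> m (Suc k) n" for k
      by (simp add: \<eta>_def N_def)
    moreover have "(\<lambda>k. \<eta> m k n) \<longlonglongrightarrow> 0"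
    proof (rule Lim_null_comparison)
      show "(\<lambda>k. (1/2::real)^k) \<longlonglongrightarrow> 0" by (rule LIMSEQ_realpow_zero) auto
      have "norm (\<eta> m k n) \<le> (1/2)^k" for k
        using sum_le_suminf[of "\<lambda>n. norm (\<eta> m k n)" "{n}"] \<eta>[of m k] by simp
      then show "eventually (\<lambda>k. norm (\<eta> m k n) \<le> (1/2)^k) sequentially" by simp
    qed
    from telescope_sums'[OF this] have "(\<lambda>k. \<eta> m k n - \<eta> m (Suc k) n) sums \<eta> m 0 n" by simp
    ultimately have "G n (y m) = \<eta> m 0 n" by (simp add: sums_iff)
    then show "G n (y m) = (if n = m then 1 else 0)" by (simp add: \<eta>_def unit_seq_def)
  qed
qed

end

section \<open>Bounded weak neighbourhoods of the origin\<close>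

context banach_over
begin

definition dual :: "('e \<Rightarrow> 'k) set"
  where "dual = {\<phi>. Vector_Spaces.linear scale (*) \<phi> \<and> continuous_on UNIV \<phi>}"

text \<open>The weak neighbourhood filter of 0 traced on the ball of radius R; for R < 0 it is the
  trivial filter. As a filter it combines finitely many smallness conditions without naming
  neighbourhoods.\<close>

definition wnf :: "real \<Rightarrow> 'e filter"
  where "wnf R = inf (principal (cball 0 R)) (INF \<phi>\<in>dual. filtercomap \<phi> (nhds 0))"

lemma dual_linear: "\<phi> \<in> dual \<Longrightarrow> Vector_Spaces.linear scale (*) \<phi>"
  by (simp add: dual_def)

lemma dualI:
  assumes "Vector_Spaces.linear scale (*) \<phi>" "\<And>x. norm (\<phi> x) \<le> C * norm x"
  shows "\<phi> \<in> dual"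
  using assms bounded_linear.continuous_on[OF bounded_linear_scalar[OF assms] continuous_on_id]
  by (simp add: dual_def)

lemma dual_bounded:
  assumes \<phi>: "\<phi> \<in> dual"
  obtains C where "C > 0" "\<And>x. norm (\<phi> x) \<le> C * norm x"
proof -
  note lin = linear_scalarD[OF dual_linear[OF \<phi>]]
  have "continuous_on UNIV \<phi>" using \<phi> by (simp add: dual_def)
  then obtain \<delta> where \<delta>: "\<delta> > 0" "\<And>x. dist x 0 < \<delta> \<Longrightarrow> dist (\<phi> x) (\<phi> 0) < 1"
    unfolding continuous_on_iff by (metis UNIV_I zero_less_one)
  have "norm (\<phi> x) \<le> 2 / \<delta> * norm x" for x
  proof (cases "x = 0")
    case False
    have "norm ((\<delta> / 2 / norm x) *\<^sub>R x) < \<delta>" using False \<delta>(1) by simp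
    then have "norm (\<phi> ((\<delta> / 2 / norm x) *\<^sub>R x)) < 1" using \<delta>(2) lin(4) by simp
    then show ?thesis using False \<delta>(1) by (simp add: lin(5) field_simps)
  qed (simp add: lin(4))
  then show thesis using that[of "2 / \<delta>"] \<delta>(1) by simp
qed

lemma eventually_wnf_norm: "eventually (\<lambda>v. norm v \<le> R) (wnf R)"
  unfolding wnf_def by (rule filter_leD[OF inf_le1]) (simp add: eventually_principal)

lemma eventually_wnf_dual:
  assumes "\<phi> \<in> dual" "\<eta> > 0"
  shows "eventually (\<lambda>v. norm (\<phi> v) < \<eta>) (wnf R)"
proof -
  have "wnf R \<le> filtercomap \<phi> (nhds 0)"
    unfolding wnf_def by (rule order_trans[OF inf_le2 INF_lower[OF assms(1)]])
  moreover have "eventually (\<lambda>v. norm (\<phi> v) < \<eta>) (filtercomap \<phi> (nhds 0))"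
    using eventually_nhds_metric[of "\<lambda>z. norm z < \<eta>" 0] assms(2)
    by (intro eventually_filtercomapI) auto
  ultimately show ?thesis by (rule filter_leD)
qed

lemma wnf_mono: "R \<le> R' \<Longrightarrow> wnf R \<le> wnf R'"
  unfolding wnf_def by (intro inf_mono order_refl) auto

lemma eventually_wnfD:
  assumes "eventually P (wnf R)"
  obtains \<Phi> \<eta> where "finite \<Phi>" "\<Phi> \<subseteq> dual" "\<eta> > 0"
    "\<And>v. norm v \<le> R \<Longrightarrow> (\<And>\<phi>. \<phi> \<in> \<Phi> \<Longrightarrow> norm (\<phi> v) < \<eta>) \<Longrightarrow> P v"
proof -
  obtain Q where Q: "eventually Q (INF \<phi>\<in>dual. filtercomap \<phi> (nhds 0))"
    and PQ: "\<And>v. norm v \<le> R \<Longrightarrow> Q v \<Longrightarrow> P v"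
    using assms unfolding wnf_def eventually_inf eventually_principal by (metis mem_cball_0)
  obtain \<Phi> where \<Phi>: "\<Phi> \<subseteq> dual" "finite \<Phi>" "eventually Q (INF \<phi>\<in>\<Phi>. filtercomap \<phi> (nhds 0))"
    using Q unfolding eventually_INF[of _ _ dual] by blast
  then obtain q where q: "\<And>\<phi>. \<phi> \<in> \<Phi> \<Longrightarrow> eventually (q \<phi>) (filtercomap \<phi> (nhds 0))"
    and qQ: "\<And>v. (\<And>\<phi>. \<phi> \<in> \<Phi> \<Longrightarrow> q \<phi> v) \<Longrightarrow> Q v"
    unfolding eventually_INF_finite[OF \<Phi>(2)] by metis
  have "\<exists>\<eta>>0. \<forall>v. norm (\<phi> v) < \<eta> \<longrightarrow> q \<phi> v" if \<phi>: "\<phi> \<in> \<Phi>" for \<phi>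
  proof -
    obtain W where W: "eventually W (nhds 0)" "\<And>v. W (\<phi> v) \<Longrightarrow> q \<phi> v"
      using q[OF \<phi>] unfolding eventually_filtercomap by blast
    then show ?thesis unfolding eventually_nhds_metric by (auto simp: dist_norm)
  qed
  then obtain h where h: "\<And>\<phi>. \<phi> \<in> \<Phi> \<Longrightarrow> h \<phi> > 0" "\<And>\<phi> v. \<phi> \<in> \<Phi> \<Longrightarrow> norm (\<phi> v) < h \<phi> \<Longrightarrow> q \<phi> v"
    by metis
  \<comment> \<open>The inserted 1 gives \<open>Min\<close> a meaning when \<Phi> is empty.\<close>
  define \<eta> where "\<eta> = Min (insert (1::real) (h ` \<Phi>))"
  have "\<eta> > 0" using h(1) \<Phi>(2) by (auto simp: \<eta>_def)
  moreover have le: "\<eta> \<le> h \<phi>" if "\<phi> \<in> \<Phi>" for \<phi> using that \<Phi>(2) by (auto simp: \<eta>_def)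
  have "P v" if "norm v \<le> R" "\<And>\<phi>. \<phi> \<in> \<Phi> \<Longrightarrow> norm (\<phi> v) < \<eta>" for v
    by (rule PQ[OF that(1) qQ]) (use that(2) h(2) le in \<open>blast intro: less_le_trans\<close>)
  ultimately show thesis using that \<Phi> by blast
qed

text \<open>Balls are weakly totally bounded: a functional maps the ball into a compact ball of
  scalars, and the cover is refined by one functional at a time.\<close>

lemma finite_cover_functionals:
  assumes "finite \<Phi>" "\<Phi> \<subseteq> dual" "\<eta> > 0"
  shows "\<exists>\<C>. finite \<C> \<and> cball 0 R \<subseteq> \<Union>\<C> \<and>
    (\<forall>C\<in>\<C>. \<forall>x\<in>C. \<forall>y\<in>C. \<forall>\<phi>\<in>\<Phi>. norm (\<phi> (x - y)) < \<eta>)"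
  using assms(1,2)
proof (induction \<Phi>)
  case empty
  show ?case by (rule exI[of _ "{cball 0 R}"]) auto
next
  case (insert \<phi> \<Phi>)
  then obtain \<C> where \<C>: "finite \<C>" "cball 0 R \<subseteq> \<Union>\<C>"
    "\<forall>C\<in>\<C>. \<forall>x\<in>C. \<forall>y\<in>C. \<forall>\<phi>\<in>\<Phi>. norm (\<phi> (x - y)) < \<eta>" by auto
  have \<phi>: "\<phi> \<in> dual" using insert.prems by simp
  note lin = linear_scalarD[OF dual_linear[OF \<phi>]]
  obtain C where C: "C > 0" "\<And>x. norm (\<phi> x) \<le> C * norm x" using dual_bounded[OF \<phi>] by blast
  have "\<eta> / 2 > 0" using assms(3) by simp
  then have "\<exists>K. finite K \<and> K \<subseteq> cball (0::'k) (C * R) \<and> cball 0 (C * R) \<subseteq> (\<Union>z\<in>K. ball z (\<eta> / 2))"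
    by (rule seq_compact_imp_totally_bounded[OF compact_imp_seq_compact[OF compact_cball], rule_format])
  then obtain K where K: "finite K" "cball 0 (C * R) \<subseteq> (\<Union>z\<in>K. ball (z::'k) (\<eta> / 2))"
    by (elim exE conjE) (rule that)
  define \<D> where "\<D> = (\<lambda>(A, z). A \<inter> \<phi> -` ball z (\<eta> / 2)) ` (\<C> \<times> K)"
  have "cball 0 R \<subseteq> \<Union>\<D>"
  proof
    fix x :: 'e assume x: "x \<in> cball 0 R"
    then have "norm (\<phi> x) \<le> C * R"
      using order_trans[OF C(2)[of x] mult_left_mono[of "norm x" R C]] C(1) by simp
    then obtain z where "z \<in> K" "\<phi> x \<in> ball z (\<eta> / 2)" using K(2) by auto
    moreover obtain A where "A \<in> \<C>" "x \<in> A" using \<C>(2) x by blast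
    ultimately show "x \<in> \<Union>\<D>" by (auto simp: \<D>_def)
  qed
  moreover have "norm (\<psi> (x - y)) < \<eta>" if A: "A \<in> \<D>" "x \<in> A" "y \<in> A" and \<psi>: "\<psi> \<in> insert \<phi> \<Phi>" for A x y \<psi>
  proof -
    obtain B' z where B': "B' \<in> \<C>" "A = B' \<inter> \<phi> -` ball z (\<eta> / 2)"
      using A(1) unfolding \<D>_def by auto
    obtain B where B: "B \<in> \<C>" "x \<in> B" "y \<in> B" "dist z (\<phi> x) < \<eta> / 2" "dist z (\<phi> y) < \<eta> / 2"
      using B' A(2,3) by (intro that[of B']) (simp_all add: mem_ball)
    have "norm (\<phi> (x - y)) < \<eta>"
      using B(4,5) dist_triangle_half_r[of z "\<phi> x" \<eta> "\<phi> y"] by (simp add: lin(3) dist_norm)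
    then show ?thesis using \<psi> B(1-3) \<C>(3) by blast
  qed
  ultimately show ?case
    using \<C>(1) K(1) by (intro exI[of _ \<D>]) (auto simp: \<D>_def)
qed

text \<open>Two points of the ball of radius R differ by norm at most 2R, whence the radius of the
  filter. When P says that an operator is small, the result is a finite net for the image of the
  ball, the form in which compactness is used.\<close>

lemma eventually_wnf_cover:
  assumes "eventually P (wnf (2 * R))"
  shows "\<exists>D. finite D \<and> D \<subseteq> cball 0 R \<and> (\<forall>x\<in>cball 0 R. \<exists>a\<in>D. P (x - a))"
proof -
  obtain \<Phi> \<eta> where \<Phi>: "finite \<Phi>" "\<Phi> \<subseteq> dual" "\<eta> > 0"
    and P: "\<And>v. norm v \<le> 2 * R \<Longrightarrow> (\<And>\<phi>. \<phi> \<in> \<Phi> \<Longrightarrow> norm (\<phi> v) < \<eta>) \<Longrightarrow> P v"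
    using eventually_wnfD[OF assms] by blast
  obtain \<C> where \<C>: "finite \<C>" "cball 0 R \<subseteq> \<Union>\<C>"
    "\<forall>C\<in>\<C>. \<forall>x\<in>C. \<forall>y\<in>C. \<forall>\<phi>\<in>\<Phi>. norm (\<phi> (x - y)) < \<eta>"
    using finite_cover_functionals[OF \<Phi>, of R] by (elim exE conjE) (rule that)
  define pick where "pick C = (SOME a. a \<in> C \<inter> cball 0 R)" for C :: "'e set"
  define D where "D = pick ` {C \<in> \<C>. C \<inter> cball 0 R \<noteq> {}}"
  have pick: "pick C \<in> C \<inter> cball 0 R" if "C \<inter> cball 0 R \<noteq> {}" for C
  proof -
    have "\<exists>a. a \<in> C \<inter> cball 0 R" using that by (simp only: ex_in_conv not_False_eq_True)
    then show ?thesis unfolding pick_def by (rule someI_ex)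
  qed
  have "\<exists>a\<in>D. P (x - a)" if x: "x \<in> cball 0 R" for x
  proof -
    obtain C where C: "C \<in> \<C>" "x \<in> C" using \<C>(2) x by blast
    then have ne: "C \<inter> cball 0 R \<noteq> {}" using x by blast
    have "P (x - pick C)"
    proof (rule P)
      have "norm (pick C) \<le> R" using pick[OF ne] by simp
      then show "norm (x - pick C) \<le> 2 * R"
        using x norm_triangle_ineq4[of x "pick C"] by simp
      show "norm (\<phi> (x - pick C)) < \<eta>" if "\<phi> \<in> \<Phi>" for \<phi>
        using \<C>(3) C pick[OF ne] that by blast
    qed
    then show ?thesis using C(1) ne by (auto simp: D_def)
  qed
  moreover have "D \<subseteq> cball 0 R" unfolding D_def using pick by blast
  moreover have "finite D" using \<C>(1) by (simp add: D_def)
  ultimately show ?thesis by (intro exI[of _ D]) simp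
qed

end

section \<open>Null operators and a step of Kalton type\<close>

text \<open>G stands for a space of functions on X under the supremum norm, S for a bounded operator
  from \<open>ell_infty\<close> into it. Everything is tested pointwise on X, so G needs no type,
  norm or dual of its own, and the uniform limit is norm convergence.\<close>

definition null_on :: "('k::real_or_complex \<Rightarrow> 'f::real_normed_vector \<Rightarrow> 'f) \<Rightarrow> 'x set \<Rightarrow> (('x \<Rightarrow> 'f) \<Rightarrow> bool) \<Rightarrow> bool"
  where "null_on s X G \<longleftrightarrow> (\<forall>S. (\<forall>t\<in>X. ell_infty_linear s (\<lambda>\<xi>. S \<xi> t)) \<longrightarrow>
    (\<exists>C. \<forall>\<xi>\<in>ball_on UNIV. \<forall>t\<in>X. norm (S \<xi> t) \<le> C) \<longrightarrow>
    (\<forall>\<xi>. bounded (range \<xi>) \<longrightarrow> G (S \<xi>)) \<longrightarrow>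
    uniform_limit X (\<lambda>n. S (unit_seq n)) (\<lambda>_. 0) sequentially)"

lemma null_onD:
  assumes "null_on s X G" "\<And>t. t \<in> X \<Longrightarrow> ell_infty_linear s (\<lambda>\<xi>. S \<xi> t)"
    "\<And>\<xi> t. \<xi> \<in> ball_on UNIV \<Longrightarrow> t \<in> X \<Longrightarrow> norm (S \<xi> t) \<le> C"
    "\<And>\<xi>. bounded (range \<xi>) \<Longrightarrow> G (S \<xi>)" "e > 0"
  shows "eventually (\<lambda>n. \<forall>t\<in>X. norm (S (unit_seq n) t) < e) sequentially"
proof -
  have "uniform_limit X (\<lambda>n. S (unit_seq n)) (\<lambda>_. 0) sequentially"
    using assms(1-4) unfolding null_on_def by blast
  then show ?thesis using \<open>e > 0\<close> by (auto simp: uniform_limit_iff)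
qed

text \<open>If every block carried a bad vector \<xi> p, the map J sending the unit sequences to
  these vectors would be bounded on \<open>ell_infty\<close> by disjointness, and S composed with J
  would violate \<open>null_on\<close>. This passes from single unit sequences to whole
  blocks.\<close>

lemma null_on_exhaustive:
  assumes null: "null_on s X G" and lin: "\<And>t. t \<in> X \<Longrightarrow> ell_infty_linear s (\<lambda>\<xi>. S \<xi> t)"
    and bd: "\<And>\<xi> t. \<xi> \<in> ball_on UNIV \<Longrightarrow> t \<in> X \<Longrightarrow> norm (S \<xi> t) \<le> C"
    and G: "\<And>\<xi>. bounded (range \<xi>) \<Longrightarrow> G (S \<xi>)" and "e > 0"
    and disj: "\<And>p q i. i \<in> P p \<Longrightarrow> i \<in> P q \<Longrightarrow> p = (q::nat)"
  shows "\<exists>p. \<forall>\<xi>\<in>ball_on (P p). \<forall>t\<in>X. norm (S \<xi> t) \<le> e"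
proof (rule ccontr)
  assume "\<not> ?thesis"
  then have "\<forall>p. \<exists>\<xi> t. \<xi> \<in> ball_on (P p) \<and> t \<in> X \<and> norm (S \<xi> t) > e" by (meson not_le)
  then obtain \<xi> t where \<xi>: "\<And>p. \<xi> p \<in> ball_on (P p)" and t: "\<And>p. t p \<in> X"
    and big: "\<And>p. norm (S (\<xi> p) (t p)) > e" by metis
  \<comment> \<open>Outside all blocks idx is arbitrary, which is harmless since every \<xi> p
    vanishes there.\<close>
  define idx where "idx i = (SOME p. i \<in> P p)" for i
  have idx: "idx i = p" if "i \<in> P p" for i p
    unfolding idx_def using that disj by (intro some_equality) blast+
  define J where "J \<zeta> = (\<lambda>i. \<zeta> (idx i) * \<xi> (idx i) i)" for \<zeta>
  have \<xi>1: "norm (\<xi> p i) \<le> 1" for p i using \<xi>[of p] by (simp add: ball_on_def)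
  have J_le: "norm (J \<zeta> i) \<le> norm (\<zeta> (idx i))" for \<zeta> i
    unfolding J_def norm_mult using \<xi>1 by (simp add: mult_left_le)
  have J_bd: "bounded (range (J \<zeta>))" if \<zeta>: "bounded (range \<zeta>)" for \<zeta>
  proof -
    obtain B where B: "\<And>n. norm (\<zeta> n) \<le> B" using \<zeta> by (auto simp: bounded_iff)
    have "norm (J \<zeta> i) \<le> B" for i using order_trans[OF J_le B] .
    then show ?thesis by (auto simp: bounded_iff)
  qed
  have J_ball: "J \<zeta> \<in> ball_on UNIV" if "\<zeta> \<in> ball_on UNIV" for \<zeta>
    using that order_trans[OF J_le] by (auto simp: ball_on_def)
  have J_unit: "J (unit_seq p) = \<xi> p" for p
  proof
    fix i show "J (unit_seq p) i = \<xi> p i"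
    proof (cases "i \<in> P p")
      case True then show ?thesis by (simp add: J_def idx unit_seq_def)
    next
      case False
      then have "\<xi> p i = 0" using \<xi>[of p] by (simp add: ball_on_def)
      then show ?thesis by (auto simp: J_def unit_seq_def)
    qed
  qed
  have J_add: "J (x + y) = J x + J y" and J_scale: "J (\<lambda>i. c * x i) = (\<lambda>i. c * J x i)" for x y c
    by (auto simp: J_def algebra_simps)
  have "ell_infty_linear s (\<lambda>\<zeta>. S (J \<zeta>) u)" if "u \<in> X" for u
    unfolding ell_infty_linear_def J_add J_scale
    using ell_infty_linearD[OF lin[OF that] J_bd] J_bd by simp
  from null_onD[OF null, where S = "\<lambda>\<zeta>. S (J \<zeta>)", OF this bd G \<open>e > 0\<close>]
  have "eventually (\<lambda>n. \<forall>t\<in>X. norm (S (J (unit_seq n)) t) < e) sequentially"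
    using J_ball J_bd by blast
  then obtain p where "\<forall>t\<in>X. norm (S (J (unit_seq p)) t) < e"
    using eventually_happens'[OF sequentially_bot] by blast
  then show False using big[of p] t[of p] by (fastforce simp: J_unit)
qed

text \<open>Unimodular coefficients align the values on finitely many unit sequences. This turns a
  bounded map on \<open>ell_infty\<close> into a weakly unconditionally Cauchy series.\<close>

lemma ell_infty_linear_sum_bound:
  fixes S :: "(nat \<Rightarrow> 'k::real_or_complex) \<Rightarrow> 'k"
  assumes S: "ell_infty_linear (*) S" and bd: "\<And>\<xi>. \<xi> \<in> ball_on UNIV \<Longrightarrow> norm (S \<xi>) \<le> B"
    and "finite A"
  shows "(\<Sum>n\<in>A. norm (S (unit_seq n))) \<le> B"
proof -
  have "\<forall>n. \<exists>a. norm a = 1 \<and> a * S (unit_seq n) = of_real (norm (S (unit_seq n)))"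
    by (metis unimodular_multiple)
  then obtain a where a: "\<And>n. norm (a n) = 1"
    and aS: "\<And>n. a n * S (unit_seq n) = of_real (norm (S (unit_seq n)))" by metis
  define \<xi> where "\<xi> A = (\<lambda>i. if i \<in> A then a i else 0)" for A
  have ball: "\<xi> A \<in> ball_on UNIV" for A by (auto simp: ball_on_def \<xi>_def a)
  have "S (\<xi> A) = of_real (\<Sum>n\<in>A. norm (S (unit_seq n)))"
    using \<open>finite A\<close>
  proof (induction A)
    case empty
    have "\<xi> {} = (\<lambda>i. 0 * \<xi> {} i)" by (auto simp: \<xi>_def)
    then show ?case using ell_infty_linearD(2)[OF S ball_on_bounded[OF ball[of "{}"]], of 0] by simp
  next
    case (insert n A)
    have eq: "\<xi> (insert n A) = (\<lambda>i. a n * unit_seq n i) + \<xi> A"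
      using insert.hyps by (auto simp: \<xi>_def unit_seq_def)
    have ub: "bounded (range (unit_seq n :: nat \<Rightarrow> 'k))" by (rule ball_on_bounded[OF unit_seq_ball])
    have "S (\<xi> (insert n A)) = a n * S (unit_seq n) + S (\<xi> A)"
      unfolding eq ell_infty_linearD(1)[OF S bounded_range_mult[OF ub] ball_on_bounded[OF ball]]
        ell_infty_linearD(2)[OF S ub] ..
    then show ?case using insert by (simp add: aS)
  qed
  moreover have "norm (S (\<xi> A)) \<le> B" by (rule bd[OF ball])
  ultimately show ?thesis by (simp add: sum_nonneg del: of_real_sum)
qed

section \<open>From a function space to the compact operators into it\<close>

locale banach_pair = E: banach_over sE + F: banach_over sF
  for sE :: "'k::real_or_complex \<Rightarrow> 'e::banach \<Rightarrow> 'e" and sF :: "'k \<Rightarrow> 'f::banach \<Rightarrow> 'f"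

text \<open>Here T \<xi> is an operator from E into functions on X, and \<open>wk\<close> is its
  compactness. The hump is controlled on both sides: the vector for n is chosen after the earlier
  indices, whose joint effect on it is made small by compactness; then the reservoir of later
  indices is thinned until their joint effect is small by \<open>null_on_exhaustive\<close>.\<close>

lemma (in banach_pair) kalton_step:
  fixes T :: "(nat \<Rightarrow> 'k) \<Rightarrow> 'e \<Rightarrow> 'x \<Rightarrow> 'f"
  assumes lin1: "\<And>x t. t \<in> X \<Longrightarrow> ell_infty_linear sF (\<lambda>\<xi>. T \<xi> x t)"
    and lin2: "\<And>\<xi> t. bounded (range \<xi>) \<Longrightarrow> t \<in> X \<Longrightarrow> Vector_Spaces.linear sE sF (\<lambda>x. T \<xi> x t)"
    and bd: "\<And>\<xi> x t. \<xi> \<in> ball_on UNIV \<Longrightarrow> t \<in> X \<Longrightarrow> norm (T \<xi> x t) \<le> C * norm x"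
    and G: "\<And>\<xi> x. bounded (range \<xi>) \<Longrightarrow> G (T \<xi> x)"
    and wk: "\<And>\<xi> R e. bounded (range \<xi>) \<Longrightarrow> e > 0 \<Longrightarrow>
      eventually (\<lambda>v. \<forall>t\<in>X. norm (T \<xi> v t) \<le> e) (E.wnf R)"
    and null: "null_on sF X G"
    and no_ell_one: "\<not> contains_complemented_copy (whole_space sE) (ell_one :: ('k, nat \<Rightarrow> 'k) nspace)"
  shows "uniform_limit (cball 0 1 \<times> X) (\<lambda>n (x, t). T (unit_seq n) x t) (\<lambda>_. 0) sequentially"
proof (rule ccontr)
  assume "\<not> ?thesis"
  then obtain d where "d > 0" and d:
    "\<not> eventually (\<lambda>n. \<forall>p\<in>cball 0 1 \<times> X. dist (case p of (x, t) \<Rightarrow> T (unit_seq n) x t) 0 < d) sequentially"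
    unfolding uniform_limit_iff by blast
  have N0_freq: "frequently (\<lambda>n. \<exists>x t. norm x \<le> 1 \<and> t \<in> X \<and> d \<le> norm (T (unit_seq n) x t)) sequentially"
    using d[unfolded not_eventually] by (rule frequently_elim1) (force simp: not_less)
  define N0 where "N0 = {n. \<exists>x t. norm x \<le> 1 \<and> t \<in> X \<and> d \<le> norm (T (unit_seq n) x t)}"
  have N0: "infinite N0"
    using N0_freq unfolding N0_def frequently_cofinite[symmetric] cofinite_eq_sequentially .
  have "\<exists>x t. n \<in> N0 \<longrightarrow> norm x \<le> 1 \<and> t \<in> X \<and> d \<le> norm (T (unit_seq n) x t)" for n
    by (auto simp: N0_def)
  then obtain x t where x: "\<And>n. n \<in> N0 \<Longrightarrow> norm (x n) \<le> 1" and tX: "\<And>n. n \<in> N0 \<Longrightarrow> t n \<in> X"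
    and xt: "\<And>n. n \<in> N0 \<Longrightarrow> d \<le> norm (T (unit_seq n) (x n) (t n))" by metis
  \<comment> \<open>Of the 16 units, 8 are lost when a net point is subtracted from x n, 3 when the
    values at the unit sequences are compared with one fixed vector, and 3 on the way back; 2
    remain.\<close>
  define e where "e = d / 16"
  have e: "e > 0" using \<open>d > 0\<close> by (simp add: e_def)
  have Tdiff: "T \<xi> (u - v) s = T \<xi> u s - T \<xi> v s" if "bounded (range \<xi>)" "s \<in> X" for \<xi> u v s
  proof -
    interpret Vector_Spaces.linear sE sF "\<lambda>x. T \<xi> x s" by (rule lin2[OF that])
    show ?thesis by (rule diff)
  qed
  have unit_bd: "bounded (range (unit_seq n :: nat \<Rightarrow> 'k))" for n by (rule ball_on_bounded[OF unit_seq_ball])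
  define big where "big n z \<longleftrightarrow> norm z \<le> 2 \<and> (\<exists>s\<in>X. 8 * e \<le> norm (T (unit_seq n) z s))" for n z
  \<comment> \<open>Infinitely many x n are close, as seen by T \<xi>, to one point a of a finite
    net. Since T (unit_seq n) a tends to 0, subtracting a makes the value of T \<xi> small but keeps
    that of T (unit_seq n) large.\<close>
  have step1: "\<exists>n\<in>N. \<exists>z. big n z \<and> (\<forall>s\<in>X. norm (T \<xi> z s) \<le> e)"
    if N: "infinite N" "N \<subseteq> N0" and \<xi>: "bounded (range \<xi>)" for N \<xi>
  proof -
    obtain D where D: "finite D" "D \<subseteq> cball 0 1"
      and cover: "\<forall>x\<in>cball 0 1. \<exists>a\<in>D. \<forall>s\<in>X. norm (T \<xi> (x - a) s) \<le> e"
      using E.eventually_wnf_cover[where R = 1, OF wk[OF \<xi> e]] by (elim exE conjE) (rule that)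
    have "\<exists>a\<in>D. infinite {n\<in>N. \<forall>s\<in>X. norm (T \<xi> (x n - a) s) \<le> e}"
    proof (rule ccontr)
      assume "\<not> ?thesis"
      then have "finite (\<Union>a\<in>D. {n\<in>N. \<forall>s\<in>X. norm (T \<xi> (x n - a) s) \<le> e})" using D(1) by blast
      moreover have "N \<subseteq> (\<Union>a\<in>D. {n\<in>N. \<forall>s\<in>X. norm (T \<xi> (x n - a) s) \<le> e})"
      proof
        fix n assume n: "n \<in> N"
        then have "x n \<in> cball 0 1" using x N(2) by auto
        from bspec[OF cover this] n show "n \<in> (\<Union>a\<in>D. {n\<in>N. \<forall>s\<in>X. norm (T \<xi> (x n - a) s) \<le> e})" by blast
      qed
      ultimately show False using N(1) finite_subset by blast
    qed
    then obtain a where a: "a \<in> D" "infinite {n\<in>N. \<forall>s\<in>X. norm (T \<xi> (x n - a) s) \<le> e}" by blast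
    have "eventually (\<lambda>n. \<forall>s\<in>X. norm (T (unit_seq n) a s) < 8 * e) sequentially"
      using e by (intro null_onD[OF null lin1 bd G]) auto
    then obtain m where m: "\<And>n s. n \<ge> m \<Longrightarrow> s \<in> X \<Longrightarrow> norm (T (unit_seq n) a s) < 8 * e"
      by (auto simp: eventually_sequentially)
    obtain n where n: "n \<in> N" "n \<ge> m" "\<forall>s\<in>X. norm (T \<xi> (x n - a) s) \<le> e"
      using a(2) unfolding infinite_nat_iff_unbounded_le by blast
    have nN0: "n \<in> N0" using n(1) N(2) by blast
    have "16 * e \<le> norm (T (unit_seq n) (x n) (t n))" using xt[OF nN0] by (simp add: e_def)
    also have "\<dots> \<le> norm (T (unit_seq n) (x n - a) (t n)) + norm (T (unit_seq n) a (t n))"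
      using Tdiff[OF unit_bd tX[OF nN0]] norm_triangle_sub by (metis add.commute)
    finally have "8 * e \<le> norm (T (unit_seq n) (x n - a) (t n))"
      using m[OF n(2) tX[OF nN0]] by linarith
    moreover have "norm (x n - a) \<le> 2"
      using x[OF nN0] a(1) D(2) norm_triangle_ineq4[of "x n" a] by (auto dest!: subsetD)
    ultimately have "big n (x n - a)" using tX[OF nN0] by (auto simp: big_def)
    then show ?thesis using n by blast
  qed
  \<comment> \<open>Among infinitely many disjoint infinite subsets of N, one is harmless for
    z.\<close>
  have step2: "\<exists>N'\<subseteq>N. infinite N' \<and> (\<forall>\<xi>\<in>ball_on N'. \<forall>s\<in>X. norm (T \<xi> z s) \<le> e)"
    if N: "infinite N" for N z
  proof -
    obtain P :: "nat \<Rightarrow> nat set" where P: "\<forall>p. infinite (P p) \<and> P p \<subseteq> N"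
      and disj: "\<forall>p q i. i \<in> P p \<longrightarrow> i \<in> P q \<longrightarrow> p = q"
      using infinite_disjoint_split[OF N] by (elim exE conjE) (rule that)
    have "\<exists>p. \<forall>\<xi>\<in>ball_on (P p). \<forall>s\<in>X. norm (T \<xi> z s) \<le> e"
      by (rule null_on_exhaustive[OF null lin1 bd G e]) (use disj in blast)+
    then show ?thesis using P by blast
  qed
  \<comment> \<open>State of the recursion: J holds the indices used before n, N the reservoir for
    all later ones, z the vector for n. The index n itself enters J only in the next state.\<close>
  define Q where "Q s \<longleftrightarrow> (case s of (J, N, n, z) \<Rightarrow> infinite N \<and> N \<subseteq> N0 \<and> N \<subseteq> {n<..} \<and> big n z \<and>
    (\<forall>s\<in>X. norm (T (indicator J) z s) \<le> e) \<and> (\<forall>\<xi>\<in>ball_on N. \<forall>s\<in>X. norm (T \<xi> z s) \<le> e))"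
    for s :: "nat set \<times> nat set \<times> nat \<times> 'e"
  have next_exists: "\<exists>N' n z. Q (J, N', n, z) \<and> n \<in> N \<and> N' \<subseteq> N" if N: "infinite N" "N \<subseteq> N0" for J N
  proof -
    obtain n z where nz: "n \<in> N" "big n z" "\<forall>s\<in>X. norm (T (indicator J) z s) \<le> e"
      using step1[OF N ball_on_bounded[OF indicator_ball[of J]]] by blast
    have "infinite (N \<inter> {n<..})"
      using N(1) unfolding infinite_nat_iff_unbounded by (metis IntI greaterThan_iff max_less_iff_conj)
    then obtain N' where "N' \<subseteq> N \<inter> {n<..}" "infinite N'" "\<forall>\<xi>\<in>ball_on N'. \<forall>s\<in>X. norm (T \<xi> z s) \<le> e"
      using step2[of "N \<inter> {n<..}" z] by blast
    then show ?thesis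
      using nz N(2) by (intro exI[of _ N'] exI[of _ n] exI[of _ z]) (auto simp: Q_def)
  qed
  have "\<exists>f. \<forall>i. (Q (f i) \<and> (i = 0 \<longrightarrow> fst (f i) = {})) \<and>
      (case f i of (J, N, n, z) \<Rightarrow> case f (Suc i) of (J', N', n', z') \<Rightarrow> J' = insert n J \<and> n' \<in> N \<and> N' \<subseteq> N)"
  proof (rule dependent_nat_choice)
    show "\<exists>s. Q s \<and> ((0::nat) = 0 \<longrightarrow> fst s = {})"
      using next_exists[OF N0, of "{}"] by fastforce
  next
    fix s and i :: nat assume "Q s \<and> (i = 0 \<longrightarrow> fst s = {})"
    then obtain J N n z where s: "s = (J, N, n, z)" "infinite N" "N \<subseteq> N0"
      unfolding Q_def by (cases s) auto
    obtain N' n' z' where "Q (insert n J, N', n', z')" "n' \<in> N" "N' \<subseteq> N"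
      using next_exists[OF s(2,3), of "insert n J"] by blast
    then show "\<exists>s'. (Q s' \<and> (Suc i = 0 \<longrightarrow> fst s' = {})) \<and>
      (case s of (J, N, n, z) \<Rightarrow> case s' of (J', N', n', z') \<Rightarrow> J' = insert n J \<and> n' \<in> N \<and> N' \<subseteq> N)"
      by (intro exI[of _ "(insert n J, N', n', z')"]) (simp add: s)
  qed
  then obtain f where f_all: "\<forall>i. (Q (f i) \<and> (i = 0 \<longrightarrow> fst (f i) = {})) \<and>
      (case f i of (J, N, n, z) \<Rightarrow> case f (Suc i) of (J', N', n', z') \<Rightarrow> J' = insert n J \<and> n' \<in> N \<and> N' \<subseteq> N)"
    by (elim exE) (rule that)
  have f: "Q (f i)" "i = 0 \<longrightarrow> fst (f i) = {}"
    "case f i of (J, N, n, z) \<Rightarrow> case f (Suc i) of (J', N', n', z') \<Rightarrow> J' = insert n J \<and> n' \<in> N \<and> N' \<subseteq> N" for i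
    by (fact conjunct1[OF conjunct1[OF spec[OF f_all]]] conjunct2[OF conjunct1[OF spec[OF f_all]]]
        conjunct2[OF spec[OF f_all]])+
  define J where "J i = fst (f i)" for i
  define N where "N i = fst (snd (f i))" for i
  define n where "n i = fst (snd (snd (f i)))" for i
  define z where "z i = snd (snd (snd (f i)))" for i
  have f_eq: "f i = (J i, N i, n i, z i)" for i by (simp add: J_def N_def n_def z_def)
  have N_gt: "N i \<subseteq> {n i<..}" and big_z: "big (n i) (z i)"
    and smallJ: "\<And>s. s \<in> X \<Longrightarrow> norm (T (indicator (J i)) (z i) s) \<le> e"
    and smallN: "\<And>\<xi> s. \<xi> \<in> ball_on (N i) \<Longrightarrow> s \<in> X \<Longrightarrow> norm (T \<xi> (z i) s) \<le> e" for i
    using f(1)[of i] by (auto simp: f_eq Q_def)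
  have J_Suc: "J (Suc i) = insert (n i) (J i)" and n_N: "n (Suc i) \<in> N i" and N_dec: "N (Suc i) \<subseteq> N i" for i
    using f(3)[of i] by (auto simp: f_eq)
  have J_eq: "J i = n ` {..<i}" for i
  proof (induction i)
    case 0 then show ?case using f(2)[of 0] by (simp add: J_def)
  next
    case (Suc i) then show ?case by (simp add: J_Suc lessThan_Suc)
  qed
  have n_mem: "n j \<in> N i" if "i < j" for i j
  proof -
    obtain k where k: "j = Suc k" "i \<le> k" using \<open>i < j\<close> by (cases j) auto
    have "N k \<subseteq> N i" using lift_Suc_antimono_le[of N, OF N_dec k(2)] .
    then show ?thesis using n_N[of k] k(1) by blast
  qed
  have n_mono: "strict_mono n"
    using n_mem N_gt by (intro strict_monoI) blast
  then have n_inj: "inj n" by (rule strict_mono_imp_inj_on)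
  define \<Phi> where "\<Phi> = (indicator (range n) :: nat \<Rightarrow> 'k)"
  have \<Phi>_bd: "bounded (range \<Phi>)" unfolding \<Phi>_def by (rule ball_on_bounded[OF indicator_ball])
  \<comment> \<open>The indicator of the range of n splits into the earlier indices, n i itself and
    the later indices; the two outer parts cost e each.\<close>
  have close: "norm (T \<Phi> (z i) s - T (unit_seq (n i)) (z i) s) \<le> 2 * e" if s: "s \<in> X" for i s
  proof -
    let ?J = "indicator (J i) :: nat \<Rightarrow> 'k" and ?K = "indicator (n ` {i<..}) :: nat \<Rightarrow> 'k"
    note bdd = ball_on_bounded[OF indicator_ball]
    have eq: "\<Phi> = ?J + (unit_seq (n i) + ?K)"
    proof
      fix m
      show "\<Phi> m = (?J + (unit_seq (n i) + ?K)) m"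
      proof (cases "m \<in> range n")
        case True
        then obtain j where j: "m = n j" by blast
        then show ?thesis
          using n_inj by (cases i j rule: linorder_cases)
            (auto simp: \<Phi>_def J_eq unit_seq_def indicator_def inj_eq inj_image_mem_iff)
      next
        case False
        then have "m \<notin> J i" "m \<notin> n ` {i<..}" "m \<noteq> n i" by (auto simp: J_eq)
        then show ?thesis using False by (simp add: \<Phi>_def unit_seq_def)
      qed
    qed
    have "n ` {i<..} \<subseteq> N i" using n_mem by auto
    then have "?K \<in> ball_on (N i)" using indicator_ball ball_on_mono by blast
    then have "norm (T ?K (z i) s) \<le> e" using s by (rule smallN)
    moreover have "T \<Phi> (z i) s = T ?J (z i) s + (T (unit_seq (n i)) (z i) s + T ?K (z i) s)"
      unfolding eq ell_infty_linearD(1)[OF lin1[OF s] bdd bounded_range_add[OF unit_bd bdd]]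
        ell_infty_linearD(1)[OF lin1[OF s] unit_bd bdd] ..
    moreover have "norm (T ?J (z i) s + T ?K (z i) s) \<le> norm (T ?J (z i) s) + norm (T ?K (z i) s)"
      by (rule norm_triangle_ineq)
    ultimately show ?thesis using smallJ[OF s, of i] by (simp add: algebra_simps)
  qed
  have z2: "norm (z i) \<le> 2" and z_big: "\<exists>s\<in>X. 8 * e \<le> norm (T (unit_seq (n i)) (z i) s)" for i
    using big_z[of i] by (auto simp: big_def)
  \<comment> \<open>Compactness of the single operator T \<Phi>: a finite net for the ball of radius
    2 and the pigeonhole principle give one vector whose image is close to those of z i for
    infinitely many i.\<close>
  obtain D where D: "finite D"
    and cover: "\<forall>x\<in>cball 0 2. \<exists>a\<in>D. \<forall>s\<in>X. norm (T \<Phi> (x - a) s) \<le> e"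
    using E.eventually_wnf_cover[where R = 2, OF wk[OF \<Phi>_bd e]] by (elim exE conjE) (rule that)
  have "\<forall>i. \<exists>a. a \<in> D \<and> (\<forall>s\<in>X. norm (T \<Phi> (z i - a) s) \<le> e)" using cover z2 by (auto simp: Bex_def)
  then obtain \<alpha> where \<alpha>: "\<And>i. \<alpha> i \<in> D" "\<And>i s. s \<in> X \<Longrightarrow> norm (T \<Phi> (z i - \<alpha> i) s) \<le> e"
    by metis
  have "finite (range \<alpha>)" using \<alpha>(1) D by (meson finite_subset image_subsetI)
  then obtain i0 where I: "infinite {i. \<alpha> i = \<alpha> i0}"
    using pigeonhole_infinite[of UNIV \<alpha>] by auto
  define I where "I = {i. \<alpha> i = \<alpha> i0}"
  \<comment> \<open>The point s is chosen for the index i0 only. It serves all of I because the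
    images under T \<Phi> are within e of that of \<alpha> i0 uniformly on X.\<close>
  obtain s where s: "s \<in> X" "8 * e \<le> norm (T (unit_seq (n i0)) (z i0) s)" using z_big by blast
  have \<alpha>_close: "norm (T \<Phi> (z i) s - T \<Phi> (\<alpha> i0) s) \<le> e" if "i \<in> I" for i
    using \<alpha>(2)[OF s(1), of i] that by (simp add: I_def Tdiff[OF \<Phi>_bd s(1)])
  have y_big: "5 * e \<le> norm (T \<Phi> (\<alpha> i0) s)"
    using close[OF s(1), of i0] \<alpha>_close[of i0] s(2)
      norm_triangle_ineq2[of "T (unit_seq (n i0)) (z i0) s" "T \<Phi> (z i0) s"]
      norm_triangle_ineq2[of "T \<Phi> (z i0) s" "T \<Phi> (\<alpha> i0) s"]
    by (simp add: I_def norm_minus_commute)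
  obtain \<psi> where \<psi>: "Vector_Spaces.linear sF (*) \<psi>" "\<And>y. norm (\<psi> y) \<le> norm y"
    "norm (\<psi> (T \<Phi> (\<alpha> i0) s)) = norm (T \<Phi> (\<alpha> i0) s)"
    using F.norming_functional[of "T \<Phi> (\<alpha> i0) s"] by blast
  note \<psi>_lin = F.linear_scalarD[OF \<psi>(1)]
  have g_big: "2 * e \<le> norm (\<psi> (T (unit_seq (n i)) (z i) s))" if i: "i \<in> I" for i
  proof -
    have "norm (\<psi> (T \<Phi> (\<alpha> i0) s) - \<psi> (T \<Phi> (z i) s)) \<le> e"
      using order_trans[OF \<psi>(2) \<alpha>_close[OF i]] by (simp add: \<psi>_lin(3) norm_minus_commute)
    moreover have "norm (\<psi> (T \<Phi> (z i) s) - \<psi> (T (unit_seq (n i)) (z i) s)) \<le> 2 * e"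
      using order_trans[OF \<psi>(2) close[OF s(1), of i]] by (simp add: \<psi>_lin(3))
    ultimately show ?thesis
      using y_big \<psi>(3) norm_triangle_ineq2[of "\<psi> (T \<Phi> (\<alpha> i0) s)" "\<psi> (T \<Phi> (z i) s)"]
        norm_triangle_ineq2[of "\<psi> (T \<Phi> (z i) s)" "\<psi> (T (unit_seq (n i)) (z i) s)"]
      by linarith
  qed
  define \<rho> where "\<rho> = enumerate I"
  have infI: "infinite I" using I by (simp add: I_def)
  have \<rho>I: "\<rho> k \<in> I" for k unfolding \<rho>_def by (rule enumerate_in_set[OF infI])
  have \<rho>_inj: "inj \<rho>" unfolding \<rho>_def by (rule strict_mono_imp_inj_on[OF strict_mono_enumerate[OF infI]])
  define g where "g k x = \<psi> (T (unit_seq (n (\<rho> k))) x s)" for k x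
  have "contains_complemented_copy (whole_space sE) (ell_one :: ('k, nat \<Rightarrow> 'k) nspace)"
  proof (rule E.contains_complemented_ell_oneI)
    fix k
    have "Vector_Spaces.linear sE (*) (\<psi> \<circ> (\<lambda>x. T (unit_seq (n (\<rho> k))) x s))"
      by (rule Vector_Spaces.linear_compose[OF lin2[OF unit_bd s(1)] \<psi>(1)])
    then show "Vector_Spaces.linear sE (*) (g k)" by (simp add: g_def[abs_def] o_def)
    show "norm (z (\<rho> k)) \<le> 2" by (rule z2)
    show "2 * e \<le> norm (g k (z (\<rho> k)))" unfolding g_def by (rule g_big[OF \<rho>I])
  next
    fix x and A :: "nat set" assume "finite A"
    have lin: "ell_infty_linear (*) (\<lambda>\<xi>. \<psi> (T \<xi> x s))"
      using lin1[OF s(1), of x] by (simp add: ell_infty_linear_def \<psi>_lin)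
    have inj': "inj (\<lambda>k. n (\<rho> k))" using inj_compose[OF n_inj \<rho>_inj] by (simp add: o_def)
    have "(\<Sum>k\<in>A. norm (g k x)) = (\<Sum>m\<in>(\<lambda>k. n (\<rho> k)) ` A. norm (\<psi> (T (unit_seq m) x s)))"
      by (simp add: g_def sum.reindex[OF inj_on_subset[OF inj']])
    also have "\<dots> \<le> C * norm x"
    proof (rule ell_infty_linear_sum_bound[OF lin])
      show "norm (\<psi> (T \<xi> x s)) \<le> C * norm x" if "\<xi> \<in> ball_on UNIV" for \<xi>
        by (rule order_trans[OF \<psi>(2) bd[OF that s(1)]])
    qed (use \<open>finite A\<close> in simp)
    finally show "(\<Sum>k\<in>A. norm (g k x)) \<le> C * norm x" .
  qed (use e in simp)
  then show False using no_ell_one by blast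
qed

section \<open>Weakly continuous symmetric forms\<close>

context banach_pair
begin

text \<open>A \<open>j\<close>-linear form is given on lists of length \<open>j\<close>; its values on other lists are irrelevant.
  By the last condition, as soon as one argument is free, the form in the free arguments \<open>us\<close> is
  jointly small for weakly small \<open>us\<close>.\<close>

definition wb_form :: "nat \<Rightarrow> ('e list \<Rightarrow> 'f) \<Rightarrow> bool"
  where "wb_form j h \<longleftrightarrow>
    (\<forall>us vs. length us = j \<longrightarrow> mset us = mset vs \<longrightarrow> h us = h vs) \<and>
    (\<forall>us. Suc (length us) = j \<longrightarrow> Vector_Spaces.linear sE sF (\<lambda>x. h (x # us))) \<and>
    (\<forall>as R e. length as < j \<longrightarrow> e > 0 \<longrightarrow> (\<exists>V. eventually (\<lambda>v. v \<in> V) (E.wnf R) \<and>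
      (\<forall>us. set us \<subseteq> V \<longrightarrow> length as + length us = j \<longrightarrow> norm (h (as @ us)) \<le> e)))"

lemma wb_form_symmetric: "wb_form j h \<Longrightarrow> length us = j \<Longrightarrow> mset us = mset vs \<Longrightarrow> h us = h vs"
  by (simp add: wb_form_def)

lemma wb_form_linear:
  "wb_form (Suc j) h \<Longrightarrow> length us = j \<Longrightarrow> Vector_Spaces.linear sE sF (\<lambda>x. h (x # us))"
  by (simp add: wb_form_def)

lemma wb_form_small:
  assumes "wb_form j h" "length as < j" "e > 0"
  shows "\<exists>V. eventually (\<lambda>v. v \<in> V) (E.wnf R) \<and>
    (\<forall>us. set us \<subseteq> V \<longrightarrow> length as + length us = j \<longrightarrow> norm (h (as @ us)) \<le> e)"
  using assms(1)[unfolded wb_form_def, THEN conjunct2, THEN conjunct2, rule_format, OF assms(2,3)] .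

text \<open>The fixed argument is absorbed by the prefix \<open>as\<close>; this stability is the
  reason why the smallness condition carries a prefix.\<close>

lemma wb_form_Cons:
  assumes h: "wb_form (Suc j) h"
  shows "wb_form j (\<lambda>xs. h (a # xs))"
  unfolding wb_form_def
proof (intro conjI allI impI)
  show "h (a # us) = h (a # vs)" if "length us = j" "mset us = mset vs" for us vs
    using that by (intro wb_form_symmetric[OF h]) auto
next
  fix us :: "'e list" assume us: "Suc (length us) = j"
  have "h (a # x # us) = h (x # a # us)" for x
    by (rule wb_form_symmetric[OF h]) (use us in auto)
  then show "Vector_Spaces.linear sE sF (\<lambda>x. h (a # x # us))"
    using wb_form_linear[OF h, of "a # us"] us by simp
next
  fix as :: "'e list" and R e :: real assume "length as < j" "e > 0"
  then show "\<exists>V. eventually (\<lambda>v. v \<in> V) (E.wnf R) \<and>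
      (\<forall>us. set us \<subseteq> V \<longrightarrow> length as + length us = j \<longrightarrow> norm (h (a # as @ us)) \<le> e)"
    using wb_form_small[OF h, of "a # as" e R] by simp
qed

text \<open>The ball is covered by finitely many translates of a weak neighbourhood, and the remaining
  arguments are expanded accordingly.\<close>

lemma wb_form_uniformly_small:
  assumes "wb_form (Suc j) h" "e > 0"
  shows "eventually (\<lambda>v. \<forall>xs. length xs = j \<longrightarrow> set xs \<subseteq> cball 0 R \<longrightarrow> norm (h (v # xs)) \<le> e) (E.wnf R)"
  using assms
proof (induction j arbitrary: h R e)
  case 0
  have "\<exists>V. eventually (\<lambda>v. v \<in> V) (E.wnf R) \<and>
      (\<forall>us. set us \<subseteq> V \<longrightarrow> length us = Suc 0 \<longrightarrow> norm (h us) \<le> e)"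
    using wb_form_small[OF 0(1) _ 0(2), of "[]" R] by simp
  then obtain V where V: "eventually (\<lambda>v. v \<in> V) (E.wnf R)"
    "\<forall>us. set us \<subseteq> V \<longrightarrow> length us = Suc 0 \<longrightarrow> norm (h us) \<le> e"
    by (elim exE conjE) (rule that)
  show ?case
    using V(1) by (rule eventually_mono) (use V(2)[rule_format, of "[_]"] in auto)
next
  case (Suc j)
  note h = Suc.prems(1)
  show ?case
  proof (cases "R < 0")
    case True
    then have "cball (0::'e) R = {}" by simp
    then show ?thesis by (auto intro!: always_eventually)
  next
    case False
    \<comment> \<open>Each of the j + 1 arguments costs one e', and the fully expanded term a last
      one.\<close>
    define e' where "e' = e / (real j + 2)"
    have e': "e' > 0" using Suc.prems(2) by (simp add: e'_def)
    have "\<exists>V. eventually (\<lambda>v. v \<in> V) (E.wnf (2 * R)) \<and>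
        (\<forall>us. set us \<subseteq> V \<longrightarrow> length us = Suc (Suc j) \<longrightarrow> norm (h us) \<le> e')"
      using wb_form_small[OF h _ e', of "[]" "2 * R"] by simp
    then obtain V' where V': "eventually (\<lambda>v. v \<in> V') (E.wnf (2 * R))"
      and V'_small: "\<forall>us. set us \<subseteq> V' \<longrightarrow> length us = Suc (Suc j) \<longrightarrow> norm (h us) \<le> e'"
      by (elim exE conjE) (rule that)
    define V where "V = V' \<inter> cball 0 (2 * R)"
    have V: "eventually (\<lambda>v. v \<in> V) (E.wnf (2 * R))"
      using eventually_conj[OF V' E.eventually_wnf_norm] by (simp add: V_def)
    obtain D where D: "finite D" and cover: "\<forall>x\<in>cball 0 R. \<exists>a\<in>D. x - a \<in> V"
      using E.eventually_wnf_cover[OF V] by (elim exE conjE) (rule that)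
    \<comment> \<open>Fixing a net point a lowers the degree. The radius 2R is required because
      arguments already replaced by differences x - a only lie in that larger ball.\<close>
    have "eventually (\<lambda>v. \<forall>a\<in>D. \<forall>xs. length xs = j \<longrightarrow> set xs \<subseteq> cball 0 (2 * R) \<longrightarrow>
        norm (h (a # v # xs)) \<le> e') (E.wnf (2 * R))"
      using Suc.IH[OF wb_form_Cons[OF h] e'] by (intro eventually_ball_finite D ballI) blast
    from eventually_conj[OF this V] have ev: "eventually (\<lambda>v. (\<forall>a\<in>D. \<forall>xs. length xs = j \<longrightarrow>
        set xs \<subseteq> cball 0 (2 * R) \<longrightarrow> norm (h (a # v # xs)) \<le> e') \<and> v \<in> V) (E.wnf R)"
      using False by (elim filter_leD[rotated]) (intro E.wnf_mono, simp)
    show ?thesis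
      using ev
    proof (rule eventually_mono, intro allI impI)
      fix v and xs :: "'e list"
      assume v: "(\<forall>a\<in>D. \<forall>xs. length xs = j \<longrightarrow> set xs \<subseteq> cball 0 (2 * R) \<longrightarrow>
        norm (h (a # v # xs)) \<le> e') \<and> v \<in> V" and xs: "length xs = Suc j" "set xs \<subseteq> cball 0 R"
      \<comment> \<open>The list xs holds the arguments still to be expanded, vs the differences
        already moved into V. Writing x = a + (x - a) leaves a term with a net point, which is small
        by the lower degree, and moves x - a into vs.\<close>
      have "norm (h (v # vs @ xs)) \<le> (real (length xs) + 1) * e'"
        if "length vs + length xs = Suc j" "set vs \<subseteq> V" "set xs \<subseteq> cball 0 R" for vs xs
        using that
      proof (induction xs arbitrary: vs)
        case Nil
        then show ?case using V'_small[rule_format, of "v # vs"] v by (auto simp: V_def)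
      next
        case (Cons x xs)
        have "x \<in> cball 0 R" using Cons.prems(3) by simp
        then obtain a where a: "a \<in> D" "x - a \<in> V" using cover by blast
        interpret lin: Vector_Spaces.linear sE sF "\<lambda>x. h (x # v # vs @ xs)"
          by (rule wb_form_linear[OF h]) (use Cons.prems in simp)
        have "h (v # vs @ x # xs) = h (x # v # vs @ xs)"
          by (rule wb_form_symmetric[OF h]) (use Cons.prems in auto)
        also have "\<dots> = h (a # v # vs @ xs) + h ((x - a) # v # vs @ xs)"
          using lin.add[of a "x - a"] by simp
        also have "h ((x - a) # v # vs @ xs) = h (v # ((x - a) # vs) @ xs)"
          by (rule wb_form_symmetric[OF h]) (use Cons.prems in auto)
        finally have eq: "h (v # vs @ x # xs) = h (a # v # vs @ xs) + h (v # ((x - a) # vs) @ xs)" .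
        have "set (vs @ xs) \<subseteq> cball 0 (2 * R)"
          using Cons.prems False by (fastforce simp: V_def)
        then have "norm (h (a # v # vs @ xs)) \<le> e'"
          using v a(1) Cons.prems(1) by simp
        moreover have "norm (h (v # ((x - a) # vs) @ xs)) \<le> (real (length xs) + 1) * e'"
          using Cons.prems a(2) by (intro Cons.IH) auto
        moreover have "norm (h (v # vs @ x # xs)) \<le> norm (h (a # v # vs @ xs)) + norm (h (v # ((x - a) # vs) @ xs))"
          unfolding eq by (rule norm_triangle_ineq)
        ultimately show ?case by (simp add: algebra_simps)
      qed
      from this[of "[]" xs] xs have "norm (h (v # xs)) \<le> (real j + 2) * e'" by (simp add: add.commute)
      also have "(real j + 2) * e' = e"
      proof -
        have "real j + 2 \<noteq> 0" by linarith
        then show ?thesis unfolding e'_def by (metis nonzero_mult_div_cancel_left times_divide_eq_right)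
      qed
      finally show "norm (h (v # xs)) \<le> e" .
    qed
  qed
qed

text \<open>Induction on the degree: a family of \<open>(j+1)\<close>-linear forms is a family of compact operators
  into \<open>j\<close>-linear forms.\<close>

lemma null_on_wb_form:
  assumes no_ell_infty: "\<not> contains_copy (whole_space sF) (ell_infty :: ('k, nat \<Rightarrow> 'k) nspace)"
    and no_ell_one: "\<not> contains_complemented_copy (whole_space sE) (ell_one :: ('k, nat \<Rightarrow> 'k) nspace)"
  shows "null_on sF {xs. length xs = j \<and> set xs \<subseteq> cball 0 1} (wb_form j)"
proof (induction j)
  case 0
  show ?case
    unfolding null_on_def
  proof (intro allI impI)
    fix S :: "(nat \<Rightarrow> 'k) \<Rightarrow> 'e list \<Rightarrow> 'f"
    assume lin: "\<forall>t\<in>{xs. length xs = 0 \<and> set xs \<subseteq> cball 0 1}. ell_infty_linear sF (\<lambda>\<xi>. S \<xi> t)"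
      and "\<exists>C. \<forall>\<xi>\<in>ball_on UNIV. \<forall>t\<in>{xs. length xs = 0 \<and> set xs \<subseteq> cball 0 1}. norm (S \<xi> t) \<le> C"
    then obtain C where "\<And>\<xi>. \<xi> \<in> ball_on UNIV \<Longrightarrow> norm (S \<xi> []) \<le> C" by auto
    \<comment> \<open>In degree 0 the empty list is the only point and a form is a vector of F, so
      Rosenthal's theorem on operators from \<open>ell_infty\<close> decides.\<close>
    then have "(\<lambda>n. S (unit_seq n) []) \<longlonglongrightarrow> 0"
      using F.contains_ell_inftyI[of "\<lambda>\<xi>. S \<xi> []" C] lin no_ell_infty by auto
    then show "uniform_limit {xs. length xs = 0 \<and> set xs \<subseteq> cball 0 1} (\<lambda>n. S (unit_seq n)) (\<lambda>_. 0) sequentially"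
      by (auto simp: uniform_limit_iff tendsto_iff elim: eventually_mono)
  qed
next
  case (Suc j)
  let ?X = "\<lambda>j. {xs :: 'e list. length xs = j \<and> set xs \<subseteq> cball 0 1}"
  show ?case
    unfolding null_on_def
  proof (intro allI impI)
    fix S :: "(nat \<Rightarrow> 'k) \<Rightarrow> 'e list \<Rightarrow> 'f"
    assume lin: "\<forall>t\<in>?X (Suc j). ell_infty_linear sF (\<lambda>\<xi>. S \<xi> t)"
      and "\<exists>C. \<forall>\<xi>\<in>ball_on UNIV. \<forall>t\<in>?X (Suc j). norm (S \<xi> t) \<le> C"
      and wb: "\<forall>\<xi>. bounded (range \<xi>) \<longrightarrow> wb_form (Suc j) (S \<xi>)"
    then obtain C where C: "\<And>\<xi> t. \<xi> \<in> ball_on UNIV \<Longrightarrow> t \<in> ?X (Suc j) \<Longrightarrow> norm (S \<xi> t) \<le> C" by blast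
    \<comment> \<open>Linearity in \<xi> and the bound C are given on the unit ball only; writing x
      as a multiple of a vector of the ball extends both to all x.\<close>
    have unit: "\<exists>y. norm y \<le> 1 \<and> x = sE (of_real (norm x)) y" for x
    proof (cases "x = 0")
      case True then show ?thesis by (intro exI[of _ 0]) simp
    next
      case False then show ?thesis
        by (intro exI[of _ "inverse (norm x) *\<^sub>R x"]) (simp add: E.scale_of_real)
    qed
    have scaled: "S \<xi> (sE c y # t) = sF c (S \<xi> (y # t))" if "bounded (range \<xi>)" "length t = j" for \<xi> c y t
    proof -
      interpret Vector_Spaces.linear sE sF "\<lambda>x. S \<xi> (x # t)"
        by (rule wb_form_linear) (use wb that in auto)
      show ?thesis by (rule scale)
    qed
    have "uniform_limit (cball 0 1 \<times> ?X j) (\<lambda>n (x, t). S (unit_seq n) (x # t)) (\<lambda>_. 0) sequentially"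
    proof (rule kalton_step[where T = "\<lambda>\<xi> x t. S \<xi> (x # t)" and G = "wb_form j"])
      fix x t assume t: "t \<in> ?X j"
      obtain y where y: "norm y \<le> 1" "x = sE (of_real (norm x)) y" using unit by blast
      then have yt: "y # t \<in> ?X (Suc j)" using t by auto
      have eq: "S \<xi> (x # t) = sF (of_real (norm x)) (S \<xi> (y # t))" if "bounded (range \<xi>)" for \<xi>
        using scaled[OF that, of t "of_real (norm x)" y] t y(2) by simp
      show "ell_infty_linear sF (\<lambda>\<xi>. S \<xi> (x # t))"
        using bspec[OF lin yt] unfolding ell_infty_linear_def
        by (simp add: eq bounded_range_add[unfolded plus_fun_def] bounded_range_add bounded_range_mult
            F.scale_right_distrib mult.commute)
      show "norm (S \<xi> (x # t)) \<le> C * norm x" if "\<xi> \<in> ball_on UNIV" for \<xi>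
        using mult_right_mono[OF C[OF that yt] norm_ge_zero[of x]] eq[OF ball_on_bounded[OF that]]
        by (simp add: F.norm_scale mult.commute)
    next
      fix \<xi> :: "nat \<Rightarrow> 'k" assume \<xi>: "bounded (range \<xi>)"
      then have wb\<xi>: "wb_form (Suc j) (S \<xi>)" using wb by blast
      show "Vector_Spaces.linear sE sF (\<lambda>x. S \<xi> (x # t))" if "t \<in> ?X j" for t
        using that by (intro wb_form_linear[OF wb\<xi>]) auto
      show "wb_form j (\<lambda>t. S \<xi> (x # t))" for x by (rule wb_form_Cons[OF wb\<xi>])
      show "eventually (\<lambda>v. \<forall>t\<in>?X j. norm (S \<xi> (v # t)) \<le> e) (E.wnf R)" if "e > 0" for e R
      proof -
        \<comment> \<open>\<open>wb_form_uniformly_small\<close> has one radius for v and for the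
          other arguments; max R 1 covers both, and the filter is restricted afterwards.\<close>
        have "eventually (\<lambda>v. \<forall>xs. length xs = j \<longrightarrow> set xs \<subseteq> cball 0 (max R 1) \<longrightarrow>
            norm (S \<xi> (v # xs)) \<le> e) (E.wnf (max R 1))"
          by (rule wb_form_uniformly_small[OF wb\<xi> that])
        then have "eventually (\<lambda>v. \<forall>t\<in>?X j. norm (S \<xi> (v # t)) \<le> e) (E.wnf (max R 1))"
          by (rule eventually_mono) fastforce
        then show ?thesis by (rule filter_leD[OF E.wnf_mono, rotated]) simp
      qed
    qed (use Suc.IH no_ell_one in auto)
    then have lim: "eventually (\<lambda>n. \<forall>p\<in>cball 0 1 \<times> ?X j. dist (case p of (x, t) \<Rightarrow> S (unit_seq n) (x # t)) 0 < e)
        sequentially" if "e > 0" for e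
      using that unfolding uniform_limit_iff by blast
    have "eventually (\<lambda>n. \<forall>xs\<in>?X (Suc j). dist (S (unit_seq n) xs) 0 < e) sequentially" if "e > 0" for e
      using lim[OF that]
    proof (rule eventually_mono, intro ballI)
      fix n xs
      assume *: "\<forall>p\<in>cball 0 1 \<times> ?X j. dist (case p of (x, t) \<Rightarrow> S (unit_seq n) (x # t)) 0 < e"
        and xs: "xs \<in> ?X (Suc j)"
      then obtain x t where "xs = x # t" "x \<in> cball 0 1" "t \<in> ?X j" by (cases xs) auto
      then show "dist (S (unit_seq n) xs) 0 < e" using bspec[OF *, of "(x, t)"] by simp
    qed
    then show "uniform_limit (?X (Suc j)) (\<lambda>n. S (unit_seq n)) (\<lambda>_. 0) sequentially"
      unfolding uniform_limit_iff by blast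
  qed
qed

end

section \<open>Polarization\<close>

text \<open>The permutations of the k slots, written as surjections because inclusion-exclusion over
  subsets selects maps by their image.\<close>

definition surj_maps :: "nat \<Rightarrow> (nat \<Rightarrow> nat) set"
  where "surj_maps k = {g \<in> {..<k} \<rightarrow>\<^sub>E {..<k}. g ` {..<k} = {..<k}}"

lemma finite_surj_maps: "finite (surj_maps k)"
  unfolding surj_maps_def by (rule finite_subset[OF _ finite_PiE[of "{..<k}" "\<lambda>_. {..<k}"]]) auto

lemma surj_maps_nonempty: "card (surj_maps k) \<ge> 1"
proof -
  have "restrict id {..<k} \<in> surj_maps k" by (auto simp: surj_maps_def)
  then show ?thesis using finite_surj_maps[of k] card_gt_0_iff[of "surj_maps k"] by fastforce
qed

text \<open>If some m of K is missing from B, toggling m in I is an involution that reverses the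
  sign.\<close>

lemma sum_supersets_sign:
  assumes "finite K" "B \<subseteq> K"
  shows "(\<Sum>I\<in>Pow K. if B \<subseteq> I then (-1) ^ (card I + card K) else (0::real)) = (if B = K then 1 else 0)"
proof (cases "B = K")
  case True
  have "(\<Sum>I\<in>Pow K. if B \<subseteq> I then (-1) ^ (card I + card K) else (0::real)) =
      (\<Sum>I\<in>Pow K. if I = K then (-1) ^ (card K + card K) else 0)"
    by (intro sum.cong) (auto simp: True)
  then show ?thesis using True assms(1) by (simp add: mult_2[symmetric] power_add[symmetric])
next
  case False
  then obtain m where m: "m \<in> K" "m \<notin> B" using assms by auto
  define f where "f I = (if B \<subseteq> I then (-1) ^ (card I + card K) else (0::real))" for I
  define \<tau> where "\<tau> I = (if m \<in> I then I - {m} else insert m I)" for I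
  have "(\<Sum>I\<in>Pow K. f I) = (\<Sum>I\<in>Pow K. f (\<tau> I))"
    by (rule sum.reindex_bij_witness[where i = \<tau> and j = \<tau>]) (use m in \<open>auto simp: \<tau>_def insert_absorb\<close>)
  also have "\<dots> = (\<Sum>I\<in>Pow K. - f I)"
  proof (rule sum.cong)
    fix I assume "I \<in> Pow K"
    then have fin: "finite I" using assms(1) by (auto intro: finite_subset)
    show "f (\<tau> I) = - f I"
    proof (cases "m \<in> I")
      case True
      have "card I = Suc (card (I - {m}))" by (rule card.remove[OF fin True])
      then have sign: "(-1::real) ^ (card (I - {m}) + card K) = - ((-1) ^ (card I + card K))"
        by simp
      have "B \<subseteq> I - {m} \<longleftrightarrow> B \<subseteq> I" using m by blast
      then show ?thesis using True sign by (simp only: f_def \<tau>_def if_True) simp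
    next
      case False
      moreover have "B \<subseteq> insert m I \<longleftrightarrow> B \<subseteq> I" using m by blast
      ultimately show ?thesis using fin by (simp add: f_def \<tau>_def)
    qed
  qed simp
  also have "\<dots> = - (\<Sum>I\<in>Pow K. f I)" by (rule sum_negf)
  finally show ?thesis using False by (simp add: f_def)
qed

context banach_pair
begin

lemma linear_sumD:
  assumes "Vector_Spaces.linear sE sF L"
  shows "L (\<Sum>j\<in>J. u j) = (\<Sum>j\<in>J. L (u j))"
proof -
  interpret Vector_Spaces.linear sE sF L by fact
  show ?thesis by (rule sum)
qed

text \<open>The arbitrary entries c of the remaining slots are what lets the induction expand one
  further slot: there c is updated by u j.\<close>

lemma multilinear_expand_initial:
  assumes A: "multilinear sE sF k A" and "finite J" "m \<le> k"
  shows "A (\<lambda>i\<in>{..<k}. if i < m then \<Sum>j\<in>J. u j else c i) =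
    (\<Sum>g\<in>{..<m} \<rightarrow>\<^sub>E J. A (\<lambda>i\<in>{..<k}. if i < m then u (g i) else c i))"
  using \<open>m \<le> k\<close>
proof (induction m arbitrary: c)
  case 0
  then show ?case by simp
next
  case (Suc m)
  have m: "m < k" using Suc.prems by simp
  let ?s = "\<Sum>j\<in>J. u j"
  have PE: "{..<Suc m} \<rightarrow>\<^sub>E J = (\<lambda>(y, g). g(m := y)) ` (J \<times> ({..<m} \<rightarrow>\<^sub>E J))"
    by (simp add: lessThan_Suc PiE_insert_eq)
  have inj: "inj_on (\<lambda>(y, g). g(m := y)) (J \<times> ({..<m} \<rightarrow>\<^sub>E J))"
    using inj_combinator[of m "{..<m}" "\<lambda>_. J"] by simp
  define b where "b = (\<lambda>i\<in>{..<k}. if i < m then ?s else c i)"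
  have "Vector_Spaces.linear sE sF (\<lambda>x. A (b(m := x)))"
    using A m unfolding multilinear_def b_def by (meson restrict_PiE_iff UNIV_I)
  then have "A (b(m := ?s)) = (\<Sum>j\<in>J. A (b(m := u j)))" by (rule linear_sumD)
  moreover have "b(m := ?s) = (\<lambda>i\<in>{..<k}. if i < Suc m then ?s else c i)"
    using m by (auto simp: b_def fun_eq_iff)
  moreover have "b(m := u j) = (\<lambda>i\<in>{..<k}. if i < m then ?s else (c(m := u j)) i)" for j
    using m by (auto simp: b_def fun_eq_iff)
  ultimately have "A (\<lambda>i\<in>{..<k}. if i < Suc m then ?s else c i) =
      (\<Sum>j\<in>J. A (\<lambda>i\<in>{..<k}. if i < m then ?s else (c(m := u j)) i))"
    by simp
  also have "\<dots> = (\<Sum>j\<in>J. \<Sum>g\<in>{..<m} \<rightarrow>\<^sub>E J. A (\<lambda>i\<in>{..<k}. if i < m then u (g i) else (c(m := u j)) i))"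
    by (intro sum.cong refl Suc.IH less_imp_le m)
  also have "\<dots> = (\<Sum>(j, g)\<in>J \<times> ({..<m} \<rightarrow>\<^sub>E J). A (\<lambda>i\<in>{..<k}. if i < m then u (g i) else (c(m := u j)) i))"
    by (rule sum.cartesian_product)
  also have "\<dots> = (\<Sum>p\<in>J \<times> ({..<m} \<rightarrow>\<^sub>E J).
      A (\<lambda>i\<in>{..<k}. if i < Suc m then u ((case p of (y, g) \<Rightarrow> g(m := y)) i) else c i))"
  proof (rule sum.cong, simp, clarify)
    fix j g
    show "A (\<lambda>i\<in>{..<k}. if i < m then u (g i) else (c(m := u j)) i) =
      A (\<lambda>i\<in>{..<k}. if i < Suc m then u ((g(m := j)) i) else c i)"
      by (intro arg_cong[where f = A]) (auto simp: fun_eq_iff)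
  qed
  also have "\<dots> = (\<Sum>g\<in>{..<Suc m} \<rightarrow>\<^sub>E J. A (\<lambda>i\<in>{..<k}. if i < Suc m then u (g i) else c i))"
    unfolding PE sum.reindex[OF inj] o_def ..
  finally show ?case .
qed

lemma multilinear_expand:
  assumes "multilinear sE sF k A" "finite J"
  shows "A (\<lambda>i\<in>{..<k}. \<Sum>j\<in>J. u j) = (\<Sum>g\<in>{..<k} \<rightarrow>\<^sub>E J. A (\<lambda>i\<in>{..<k}. u (g i)))"
proof -
  have "(\<lambda>i\<in>{..<k}. \<Sum>j\<in>J. u j) = (\<lambda>i\<in>{..<k}. if i < k then \<Sum>j\<in>J. u j else 0)"
    by (auto simp: fun_eq_iff)
  moreover have "(\<lambda>i\<in>{..<k}. u (g i)) = (\<lambda>i\<in>{..<k}. if i < k then u (g i) else 0)" for g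
    by (auto simp: fun_eq_iff)
  ultimately show ?thesis
    using multilinear_expand_initial[OF assms order_refl, of u "\<lambda>_. 0"] by simp
qed

text \<open>For a k-homogeneous P and k arguments this is k! times the symmetric k-linear form of P.
  Expressed by P alone, it is linear in P and involves no choice of a k-linear map.\<close>

definition polar :: "('e \<Rightarrow> 'f) \<Rightarrow> 'e list \<Rightarrow> 'f"
  where "polar P us = (\<Sum>I\<in>Pow {..<length us}. (-1) ^ (card I + length us) *\<^sub>R P (\<Sum>i\<in>I. us ! i))"

text \<open>Expand every subset sum over the maps of the slots into I and interchange the sums: each
  map is left with a signed count of the supersets of its image, which vanishes unless the image is
  everything.\<close>

lemma polar_multilinear:
  assumes A: "multilinear sE sF k A" and P: "\<And>x. P x = A (\<lambda>i\<in>{..<k}. x)" and us: "length us = k"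
  shows "polar P us = (\<Sum>g\<in>surj_maps k. A (\<lambda>i\<in>{..<k}. us ! (g i)))"
proof -
  let ?K = "{..<k}" and ?F = "\<lambda>g. A (\<lambda>i\<in>{..<k}. us ! (g i))"
  have "polar P us = (\<Sum>I\<in>Pow ?K. (-1) ^ (card I + k) *\<^sub>R (\<Sum>g\<in>?K \<rightarrow>\<^sub>E I. ?F g))"
    unfolding polar_def us P
    by (intro sum.cong refl) (simp add: multilinear_expand[OF A] finite_subset[of _ "{..<k}"])
  also have "\<dots> = (\<Sum>I\<in>Pow ?K. \<Sum>g\<in>?K \<rightarrow>\<^sub>E ?K. (if g ` ?K \<subseteq> I then (-1) ^ (card I + k) else (0::real)) *\<^sub>R ?F g)"
  proof (rule sum.cong[OF refl])
    fix I assume I: "I \<in> Pow ?K"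
    have "(\<Sum>g\<in>?K \<rightarrow>\<^sub>E I. (-1) ^ (card I + k) *\<^sub>R ?F g) =
      (\<Sum>g\<in>?K \<rightarrow>\<^sub>E ?K. (if g ` ?K \<subseteq> I then (-1) ^ (card I + k) else (0::real)) *\<^sub>R ?F g)"
      by (rule sum.mono_neutral_cong_left) (use I in \<open>auto intro!: finite_PiE simp: PiE_iff\<close>)
    then show "(-1) ^ (card I + k) *\<^sub>R (\<Sum>g\<in>?K \<rightarrow>\<^sub>E I. ?F g) =
      (\<Sum>g\<in>?K \<rightarrow>\<^sub>E ?K. (if g ` ?K \<subseteq> I then (-1) ^ (card I + k) else (0::real)) *\<^sub>R ?F g)"
      by (simp add: scaleR_sum_right)
  qed
  also have "\<dots> = (\<Sum>g\<in>?K \<rightarrow>\<^sub>E ?K. (\<Sum>I\<in>Pow ?K. if g ` ?K \<subseteq> I then (-1) ^ (card I + card ?K) else (0::real)) *\<^sub>R ?F g)"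
    unfolding card_lessThan by (subst sum.swap) (simp add: scaleR_sum_left)
  also have "\<dots> = (\<Sum>g\<in>?K \<rightarrow>\<^sub>E ?K. (if g ` ?K = ?K then 1 else 0) *\<^sub>R ?F g)"
    by (intro sum.cong refl) (subst sum_supersets_sign, auto)
  also have "\<dots> = (\<Sum>g\<in>surj_maps k. ?F g)"
    unfolding surj_maps_def by (rule sum.mono_neutral_cong_right) (auto intro!: finite_PiE)
  finally show ?thesis .
qed

lemma polar_symmetric:
  assumes "mset us = mset vs"
  shows "polar P us = polar P vs"
proof -
  obtain \<pi> where \<pi>: "\<pi> permutes {..<length vs}" "permute_list \<pi> vs = us"
    using mset_eq_permutation[OF assms] by blast
  let ?K = "{..<length vs}"
  have len: "length us = length vs" using \<pi>(2) by auto
  have bij: "bij_betw (\<lambda>I. \<pi> ` I) (Pow ?K) (Pow ?K)"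
    by (rule bij_betw_Pow[OF permutes_imp_bij[OF \<pi>(1)]])
  have inj: "inj_on \<pi> I" for I using permutes_inj_on[OF \<pi>(1)] .
  have "polar P us = (\<Sum>I\<in>Pow ?K. (-1) ^ (card (\<pi> ` I) + length vs) *\<^sub>R P (\<Sum>i\<in>\<pi> ` I. vs ! i))"
    unfolding polar_def len
  proof (intro sum.cong refl)
    fix I assume I: "I \<in> Pow ?K"
    have "(\<Sum>i\<in>I. us ! i) = (\<Sum>i\<in>I. vs ! (\<pi> i))"
      using I \<pi> by (intro sum.cong refl) (auto simp: permute_list_nth subset_iff)
    then show "(-1) ^ (card I + length vs) *\<^sub>R P (\<Sum>i\<in>I. us ! i) =
      (-1) ^ (card (\<pi> ` I) + length vs) *\<^sub>R P (\<Sum>i\<in>\<pi> ` I. vs ! i)"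
      by (simp add: sum.reindex[OF inj] card_image[OF inj])
  qed
  also have "\<dots> = polar P vs"
    unfolding polar_def
    by (rule sum.reindex_bij_betw[OF bij, of "\<lambda>I. (-1) ^ (card I + length vs) *\<^sub>R P (\<Sum>i\<in>I. vs ! i)"])
  finally show ?thesis .
qed

text \<open>A surjection of the slots is injective, so x fills exactly one slot in each summand of
  \<open>polar_multilinear\<close>.\<close>

lemma polar_linear:
  assumes A: "multilinear sE sF (Suc (length us)) A"
    and P: "\<And>x. P x = A (\<lambda>i\<in>{..<Suc (length us)}. x)"
  shows "Vector_Spaces.linear sE sF (\<lambda>x. polar P (x # us))"
proof -
  let ?k = "Suc (length us)"
  have pol: "polar P (x # us) = (\<Sum>g\<in>surj_maps ?k. A (\<lambda>i\<in>{..<?k}. (x # us) ! (g i)))" for x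
    by (rule polar_multilinear[OF A P]) simp
  have lin: "Vector_Spaces.linear sE sF (\<lambda>x. A (\<lambda>i\<in>{..<?k}. (x # us) ! (g i)))" if g: "g \<in> surj_maps ?k" for g
  proof -
    have img: "g ` {..<?k} = {..<?k}" using g by (simp add: surj_maps_def)
    then have inj: "inj_on g {..<?k}" by (simp add: eq_card_imp_inj_on)
    obtain m where m: "m < ?k" "g m = 0" using img by (metis imageE lessThan_iff zero_less_Suc)
    define b where "b = (\<lambda>i\<in>{..<?k}. (0 # us) ! (g i))"
    have "(\<lambda>i\<in>{..<?k}. (x # us) ! (g i)) = b(m := x)" for x
    proof
      fix i
      have "g i \<noteq> 0" if "i < ?k" "i \<noteq> m" using inj_onD[OF inj, of i m] that m by auto
      then show "(\<lambda>i\<in>{..<?k}. (x # us) ! (g i)) i = (b(m := x)) i"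
        using m by (auto simp: b_def nth_Cons')
    qed
    moreover have "Vector_Spaces.linear sE sF (\<lambda>x. A (b(m := x)))"
      using A m(1) unfolding multilinear_def b_def by (meson restrict_PiE_iff UNIV_I)
    ultimately show ?thesis by simp
  qed
  have vp: "vector_space_pair sE sF" using E.vector_space_axioms F.vector_space_axioms by (rule vector_space_pair.intro)
  show ?thesis unfolding pol by (rule vector_space_pair.linear_compose_sum[OF vp]) (use lin in blast)
qed

text \<open>On the diagonal every surjection contributes P x, and there is at least one; this
  dominates P by its polar form.\<close>

lemma polar_replicate:
  assumes A: "multilinear sE sF k A" and P: "\<And>x. P x = A (\<lambda>i\<in>{..<k}. x)"
  shows "norm (P x) \<le> norm (polar P (replicate k x))"
proof -
  have "(\<lambda>i\<in>{..<k}. replicate k x ! (g i)) = (\<lambda>i\<in>{..<k}. x)" if "g \<in> surj_maps k" for g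
    using that by (auto simp: surj_maps_def fun_eq_iff PiE_iff)
  then have "polar P (replicate k x) = (\<Sum>g\<in>surj_maps k. P x)"
    unfolding P by (subst polar_multilinear[OF A]) (auto intro: sum.cong)
  then have "norm (polar P (replicate k x)) = real (card (surj_maps k)) * norm (P x)"
    by (simp add: sum_constant_scaleR)
  moreover have "1 * norm (P x) \<le> real (card (surj_maps k)) * norm (P x)"
    using surj_maps_nonempty[of k] by (intro mult_right_mono) auto
  ultimately show ?thesis by simp
qed

lemma polar_add: "polar (\<lambda>x. P x + Q x) us = polar P us + polar Q us"
  by (simp add: polar_def scaleR_right_distrib sum.distrib)

lemma polar_scale: "polar (\<lambda>x. sF c (P x)) us = sF c (polar P us)"
proof -
  have "r *\<^sub>R sF c y = sF c (r *\<^sub>R y)" for r y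
    by (simp add: F.scale_of_real[symmetric] mult.commute)
  then show ?thesis by (simp add: polar_def F.scale_sum_right)
qed

text \<open>The partial sums of k vectors of the unit ball have norm at most k, and there are 2^k of
  them.\<close>

lemma polar_bound:
  assumes P: "\<And>x. norm x \<le> real k \<Longrightarrow> norm (P x) \<le> B" and us: "length us = k" "set us \<subseteq> cball 0 1"
  shows "norm (polar P us) \<le> 2 ^ k * B"
proof -
  have "norm ((-1) ^ (card I + k) *\<^sub>R P (\<Sum>i\<in>I. us ! i)) \<le> B" if I: "I \<in> Pow {..<k}" for I
  proof -
    have "norm (\<Sum>i\<in>I. us ! i) \<le> (\<Sum>i\<in>I. 1)"
      using I us by (intro sum_norm_le) (auto simp: subset_iff)
    also have "\<dots> \<le> real k"
      using I card_mono[of "{..<k}" I] by auto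
    finally show ?thesis using P by simp
  qed
  then have "norm (polar P us) \<le> real (card (Pow {..<k})) * B"
    unfolding polar_def us(1) by (intro sum_norm_bound)
  then show ?thesis by (simp add: card_Pow)
qed

end

section \<open>The space of weakly continuous polynomials\<close>

lemma continuous_map_euclidean_iff:
  fixes f :: "'a \<Rightarrow> 'b::topological_space"
  shows "continuous_map X euclidean f \<longleftrightarrow> (\<forall>x\<in>topspace X. (f \<longlongrightarrow> f x) (atin X x))"
  by (simp add: continuous_map_atin)

lemma continuous_map_mult_field:
  fixes f g :: "'a \<Rightarrow> 'b::real_normed_field"
  assumes "continuous_map X euclidean f" "continuous_map X euclidean g"
  shows "continuous_map X euclidean (\<lambda>x. f x * g x)"
  using assms by (simp add: continuous_map_euclidean_iff tendsto_mult)

lemma continuous_map_prod_field: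
  fixes f :: "'i \<Rightarrow> 'a \<Rightarrow> 'b::real_normed_field"
  assumes "\<And>i. i \<in> I \<Longrightarrow> continuous_map X euclidean (f i)"
  shows "continuous_map X euclidean (\<lambda>x. \<Prod>i\<in>I. f i x)"
  using assms by (auto simp: continuous_map_euclidean_iff intro!: tendsto_prod)

lemma (in banach_over) bounded_linear_scale_left: "bounded_linear (\<lambda>c. scale c x)"
proof (rule bounded_linear_intro[where K = "norm x"])
  show "scale (r *\<^sub>R c) x = r *\<^sub>R scale c x" for r c
    by (simp add: scale_of_real[symmetric] scaleR_conv_of_real)
qed (simp_all add: scale_left_distrib norm_scale)

context banach_over
begin

section \<open>The weak topology and the filter at the origin\<close>

lemma weak_topology_alt: "weak_topology scale = topology_generated_by {\<phi> -` U |\<phi> U. \<phi> \<in> dual \<and> open U}"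
  unfolding weak_topology_def dual_def by simp

lemma topspace_weak_topology: "topspace (weak_topology scale) = UNIV"
proof -
  have "(\<lambda>_. 0) \<in> dual"
    by (intro dualI[where C = 0] linear_vector_spaceI vector_space_axioms vector_space_field) simp_all
  then have "(\<lambda>_. 0) -` (UNIV :: 'k set) \<in> {\<phi> -` U |\<phi> U. \<phi> \<in> dual \<and> open U}" using open_UNIV by blast
  then show ?thesis unfolding weak_topology_alt by auto
qed

lemma continuous_map_weak_dual:
  assumes "\<phi> \<in> dual"
  shows "continuous_map (weak_topology scale) euclidean \<phi>"
proof -
  have "openin (weak_topology scale) (\<phi> -` U)" if "open U" for U
    unfolding weak_topology_alt using assms that by (intro topology_generated_by_Basis) blast
  then show ?thesis
    by (simp add: continuous_map_def topspace_weak_topology vimage_def)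
qed

text \<open>Induction on the generation of W; this is the bridge from the topology to the filter
  \<open>wnf\<close>. Any R is allowed, since the ball only restricts w further.\<close>

lemma openin_weak_wnf:
  assumes "openin (weak_topology scale) W" "b \<in> W"
  shows "eventually (\<lambda>w. b + w \<in> W) (wnf R)"
proof -
  have "generate_topology_on {\<phi> -` U |\<phi> U. \<phi> \<in> dual \<and> open U} W"
    using assms(1) by (simp add: weak_topology_alt openin_topology_generated_by_iff)
  then show ?thesis using assms(2)
  proof induction
    case Empty
    then show ?case by simp
  next
    case (Int a c)
    then show ?case by (auto intro: eventually_conj)
  next
    case (UN K)
    then obtain a where a: "a \<in> K" "b \<in> a" by blast
    show ?case using UN.IH[OF a] by (rule eventually_mono) (use a in blast)
  next
    case (Basis s)
    then obtain \<phi> U where \<phi>: "s = \<phi> -` U" "\<phi> \<in> dual" "open U" by blast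
    then have "\<phi> b \<in> U" using Basis.prems by simp
    then obtain e where e: "e > 0" "ball (\<phi> b) e \<subseteq> U" using \<open>open U\<close> by (meson openE)
    show ?case using eventually_wnf_dual[OF \<phi>(2) e(1)]
    proof (rule eventually_mono)
      fix w assume "norm (\<phi> w) < e"
      then have "\<phi> (b + w) \<in> ball (\<phi> b) e"
        by (simp add: linear_scalarD[OF dual_linear[OF \<phi>(2)]] dist_norm)
      then show "b + w \<in> s" using e(2) \<phi>(1) by blast
    qed
  qed
qed

lemma weakly_continuous_on_bounded_wnf:
  assumes P: "weakly_continuous_on_bounded scale P" and "e > 0"
  shows "eventually (\<lambda>w. norm (P (b + w) - P b) \<le> e) (wnf R)"
proof -
  \<comment> \<open>Large enough for b and for all b + w with norm w <= R; the absolute value keeps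
    b inside for negative R.\<close>
  define B where "B = cball (0::'e) (norm b + \<bar>R\<bar>)"
  have "continuous_map (subtopology (weak_topology scale) B) euclidean P"
    using P by (simp add: weakly_continuous_on_bounded_def B_def)
  then have "openin (subtopology (weak_topology scale) B) {x \<in> B. P x \<in> ball (P b) e}"
    using openin_continuous_map_preimage[of "subtopology (weak_topology scale) B" euclidean P "ball (P b) e"]
    by (simp add: topspace_weak_topology)
  then obtain W where W: "openin (weak_topology scale) W" "{x \<in> B. P x \<in> ball (P b) e} = W \<inter> B"
    unfolding openin_subtopology by blast
  have "b \<in> {x \<in> B. P x \<in> ball (P b) e}" using \<open>e > 0\<close> by (simp add: B_def)
  then have "b \<in> W" using W(2) by blast
  from eventually_conj[OF openin_weak_wnf[OF W(1) this] eventually_wnf_norm] show ?thesis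
  proof (rule eventually_mono)
    fix w assume w: "b + w \<in> W \<and> norm w \<le> R"
    then have "b + w \<in> B" using norm_triangle_ineq[of b w] abs_ge_self[of R] by (simp add: B_def)
    then have "P (b + w) \<in> ball (P b) e" using w W(2) by blast
    then show "norm (P (b + w) - P b) \<le> e" by (simp add: dist_norm norm_minus_commute)
  qed
qed

text \<open>Continuity of addition: each of at most k summands gets radius R and the share \<eta> /
  (k + 1) of the tolerance. The + 1 keeps the share defined for k = 0 and the final estimate strict;
  with fewer than k summands, 0 <= R keeps the norm below k R.\<close>

lemma wnf_sum:
  assumes Q: "eventually Q (wnf (real k * R))"
  shows "\<exists>V. eventually (\<lambda>v. v \<in> V) (wnf R) \<and>
    (\<forall>I u. card (I :: nat set) \<le> k \<longrightarrow> (\<forall>i\<in>I. u i \<in> V) \<longrightarrow> 0 \<le> R \<longrightarrow> Q (\<Sum>i\<in>I. u i))"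
proof -
  obtain \<Phi> \<eta> where \<Phi>: "finite \<Phi>" "\<Phi> \<subseteq> dual" "\<eta> > 0"
    and QD: "\<And>v. norm v \<le> real k * R \<Longrightarrow> (\<And>\<phi>. \<phi> \<in> \<Phi> \<Longrightarrow> norm (\<phi> v) < \<eta>) \<Longrightarrow> Q v"
    using eventually_wnfD[OF Q] by blast
  define \<eta>' where "\<eta>' = \<eta> / (real k + 1)"
  have \<eta>': "\<eta>' > 0" using \<Phi>(3) by (simp add: \<eta>'_def)
  define V where "V = {v. norm v \<le> R \<and> (\<forall>\<phi>\<in>\<Phi>. norm (\<phi> v) < \<eta>')}"
  have "eventually (\<lambda>v. v \<in> V) (wnf R)"
    unfolding V_def mem_Collect_eq
    using \<Phi>(2) by (intro eventually_conj eventually_wnf_norm eventually_ball_finite \<Phi>(1) ballI eventually_wnf_dual \<eta>') blast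
  moreover have "Q (\<Sum>i\<in>I. u i)" if I: "card I \<le> k" "\<forall>i\<in>I. u i \<in> V" "0 \<le> R" for I :: "nat set" and u
  proof (rule QD)
    have "norm (\<Sum>i\<in>I. u i) \<le> (\<Sum>i\<in>I. R)"
      using I(2) by (intro sum_norm_le) (auto simp: V_def)
    also have "\<dots> \<le> real k * R" using I(1,3) by (simp add: mult_right_mono)
    finally show "norm (\<Sum>i\<in>I. u i) \<le> real k * R" .
    fix \<phi> assume \<phi>: "\<phi> \<in> \<Phi>"
    then have "\<phi> \<in> dual" using \<Phi>(2) by blast
    then interpret Vector_Spaces.linear scale "(*)" \<phi> by (rule dual_linear)
    have "norm (\<phi> (\<Sum>i\<in>I. u i)) \<le> (\<Sum>i\<in>I. \<eta>')"
      unfolding sum using I(2) \<phi> by (intro sum_norm_le) (auto simp: V_def intro: less_imp_le)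
    also have "\<dots> \<le> real k * \<eta>'" using I(1) \<eta>' by (simp add: mult_right_mono)
    also have "\<dots> < (real k + 1) * \<eta>'" using \<eta>' by simp
    also have "\<dots> = \<eta>" unfolding \<eta>'_def using of_nat_0_le_iff[of k]
      by (metis add_nonneg_eq_0_iff nonzero_mult_div_cancel_left times_divide_eq_right zero_le_one zero_neq_one)
    finally show "norm (\<phi> (\<Sum>i\<in>I. u i)) < \<eta>" .
  qed
  ultimately show ?thesis by (intro exI[of _ V]) simp
qed

end

context banach_pair
begin

section \<open>Homogeneity, continuity and boundedness of polynomials\<close>

lemma multilinear_homogeneous:
  assumes A: "multilinear sE sF k A"
  shows "A (\<lambda>i\<in>{..<k}. sE c x) = sF (c ^ k) (A (\<lambda>i\<in>{..<k}. x))"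
proof -
  have "A (\<lambda>i\<in>{..<k}. if i < m then sE c x else x) = sF (c ^ m) (A (\<lambda>i\<in>{..<k}. x))" if "m \<le> k" for m
    using that
  proof (induction m)
    case 0
    then show ?case by simp
  next
    case (Suc m)
    define b where "b = (\<lambda>i\<in>{..<k}. if i < m then sE c x else x)"
    have "Vector_Spaces.linear sE sF (\<lambda>u. A (b(m := u)))"
      using A Suc.prems unfolding multilinear_def b_def by (meson restrict_PiE_iff UNIV_I Suc_le_eq)
    then interpret Vector_Spaces.linear sE sF "\<lambda>u. A (b(m := u))" .
    have "(\<lambda>i\<in>{..<k}. if i < Suc m then sE c x else x) = b(m := sE c x)"
      using Suc.prems by (auto simp: b_def fun_eq_iff)
    moreover have "b(m := x) = b" using Suc.prems by (auto simp: b_def fun_eq_iff)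
    ultimately have "A (\<lambda>i\<in>{..<k}. if i < Suc m then sE c x else x) = sF c (A b)"
      using scale[of c x] by simp
    moreover have "A b = sF (c ^ m) (A (\<lambda>i\<in>{..<k}. x))"
      unfolding b_def using Suc.prems by (intro Suc.IH) simp
    ultimately show ?case by (simp only: F.scale_scale power_Suc)
  qed
  from this[of k] show ?thesis by (simp cong: restrict_cong)
qed

lemma homogeneous_polynomial_scale:
  "homogeneous_polynomial sE sF k P \<Longrightarrow> P (sE c x) = sF (c ^ k) (P x)"
  by (auto simp: homogeneous_polynomial_def multilinear_homogeneous)

lemma homogeneous_polynomial_norm_scaleR:
  assumes "homogeneous_polynomial sE sF k P"
  shows "norm (P (r *\<^sub>R x)) = \<bar>r\<bar> ^ k * norm (P x)"
  using homogeneous_polynomial_scale[OF assms, of "of_real r" x]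
  by (simp add: E.scale_of_real F.norm_scale norm_power)

lemma homogeneous_polynomial_continuous:
  assumes "homogeneous_polynomial sE sF k P"
  shows "continuous_on UNIV P"
proof -
  obtain A where A: "continuous_map (product_topology (\<lambda>_. euclidean) {..<k}) euclidean A"
    and P: "\<And>x. P x = A (\<lambda>i\<in>{..<k}. x)"
    using assms unfolding homogeneous_polynomial_def by blast
  have "continuous_map euclidean (product_topology (\<lambda>_. euclidean) {..<k}) (\<lambda>x::'e. \<lambda>i\<in>{..<k}. x)"
    by (rule continuous_map_coordinatewise_then_product) (auto simp: continuous_on_id)
  from continuous_map_compose[OF this A] have "continuous_map euclidean euclidean P"
    by (simp add: o_def P[abs_def])
  then show ?thesis by simp
qed

lemma homogeneous_polynomial_bounded:
  assumes P: "homogeneous_polynomial sE sF k P"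
  obtains B where "\<And>x. norm x \<le> 1 \<Longrightarrow> norm (P x) \<le> B"
proof -
  obtain \<delta> where \<delta>: "\<delta> > 0" "\<And>x. dist x 0 < \<delta> \<Longrightarrow> dist (P x) (P 0) < 1"
    using homogeneous_polynomial_continuous[OF P] unfolding continuous_on_iff
    by (metis UNIV_I zero_less_one)
  \<comment> \<open>The term P 0 is kept because for k = 0 the polynomial is constant.\<close>
  have "norm (P x) \<le> (norm (P 0) + 1) / (\<delta> / 2) ^ k" if "norm x \<le> 1" for x
  proof -
    have "dist ((\<delta> / 2) *\<^sub>R x) 0 < \<delta>"
      using that \<delta>(1) mult_left_mono[OF that, of "\<delta> / 2"] by simp
    then have "norm (P ((\<delta> / 2) *\<^sub>R x)) \<le> norm (P 0) + 1"
      using \<delta>(2) norm_triangle_sub[of "P ((\<delta> / 2) *\<^sub>R x)" "P 0"] by (fastforce simp: dist_norm)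
    then show ?thesis
      using \<delta>(1) by (simp add: homogeneous_polynomial_norm_scaleR[OF P] field_simps)
  qed
  then show thesis using that by blast
qed

section \<open>The normed space of polynomials weakly continuous on bounded sets\<close>

lemma P_wb_carrier [simp]:
  "P \<in> ns_carrier (P_wb sE sF k) \<longleftrightarrow>
    homogeneous_polynomial sE sF k P \<and> weakly_continuous_on_bounded sE P"
  by (simp add: P_wb_def)

lemma P_wb_norm_ge:
  assumes "homogeneous_polynomial sE sF k P" "norm x \<le> 1"
  shows "norm (P x) \<le> ns_norm (P_wb sE sF k) P"
proof -
  obtain B where "\<And>x. norm x \<le> 1 \<Longrightarrow> norm (P x) \<le> B" using homogeneous_polynomial_bounded[OF assms(1)] by blast
  then have "bdd_above ((\<lambda>x. norm (P x)) ` cball 0 1)" by (auto intro!: bdd_aboveI2)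
  then show ?thesis unfolding P_wb_def using assms(2) by (auto intro!: cSUP_upper)
qed

lemma P_wb_norm_le: "(\<And>x. norm x \<le> 1 \<Longrightarrow> norm (P x) \<le> B) \<Longrightarrow> ns_norm (P_wb sE sF k) P \<le> B"
  unfolding P_wb_def by (auto intro!: cSUP_least)

lemma linear_zero_fun: "Vector_Spaces.linear sE sF (\<lambda>_. 0)"
  using vector_space_pair.linear_zero[OF vector_space_pair.intro[OF E.vector_space_axioms F.vector_space_axioms]] .

lemma homogeneous_polynomial_add:
  assumes "homogeneous_polynomial sE sF k P" "homogeneous_polynomial sE sF k Q"
  shows "homogeneous_polynomial sE sF k (\<lambda>x. P x + Q x)"
proof -
  obtain A B where A: "multilinear sE sF k A"
      "continuous_map (product_topology (\<lambda>_. euclidean) {..<k}) euclidean A" "\<And>x. P x = A (\<lambda>i\<in>{..<k}. x)"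
    and B: "multilinear sE sF k B"
      "continuous_map (product_topology (\<lambda>_. euclidean) {..<k}) euclidean B" "\<And>x. Q x = B (\<lambda>i\<in>{..<k}. x)"
    using assms unfolding homogeneous_polynomial_def by metis
  have vp: "vector_space_pair sE sF" using E.vector_space_axioms F.vector_space_axioms by (rule vector_space_pair.intro)
  have "multilinear sE sF k (\<lambda>x. A x + B x)"
    unfolding multilinear_def
  proof (intro ballI allI impI)
    fix x :: "nat \<Rightarrow> 'e" and i assume "x \<in> {..<k} \<rightarrow>\<^sub>E UNIV" "i < k"
    then show "Vector_Spaces.linear sE sF (\<lambda>u. A (x(i := u)) + B (x(i := u)))"
      using A(1) B(1) unfolding multilinear_def by (intro vector_space_pair.linear_compose_add[OF vp]) simp_all
  qed
  then show ?thesis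
    unfolding homogeneous_polynomial_def A(3) B(3) using continuous_map_add[OF A(2) B(2)]
    by (intro exI[of _ "\<lambda>x. A x + B x"] conjI allI refl)
qed

lemma homogeneous_polynomial_scale_left:
  assumes "homogeneous_polynomial sE sF k P"
  shows "homogeneous_polynomial sE sF k (\<lambda>x. sF c (P x))"
proof -
  obtain A where A: "multilinear sE sF k A"
      "continuous_map (product_topology (\<lambda>_. euclidean) {..<k}) euclidean A" "\<And>x. P x = A (\<lambda>i\<in>{..<k}. x)"
    using assms unfolding homogeneous_polynomial_def by metis
  have vp: "vector_space_pair sE sF" using E.vector_space_axioms F.vector_space_axioms by (rule vector_space_pair.intro)
  have "multilinear sE sF k (\<lambda>x. sF c (A x))"
    unfolding multilinear_def
  proof (intro ballI allI impI)
    fix x :: "nat \<Rightarrow> 'e" and i assume "x \<in> {..<k} \<rightarrow>\<^sub>E UNIV" "i < k"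
    then show "Vector_Spaces.linear sE sF (\<lambda>u. sF c (A (x(i := u))))"
      using A(1) unfolding multilinear_def by (intro vector_space_pair.linear_compose_scale_right[OF vp]) simp_all
  qed
  moreover have "continuous_map (product_topology (\<lambda>_. euclidean) {..<k}) euclidean (\<lambda>x. sF c (A x))"
    using A(2) by (auto simp: continuous_map_euclidean_iff intro!: bounded_linear.tendsto[OF F.bounded_linear_scale])
  ultimately show ?thesis
    unfolding homogeneous_polynomial_def A(3) by (intro exI[of _ "\<lambda>x. sF c (A x)"] conjI allI refl)
qed

lemma weakly_continuous_on_bounded_add:
  "weakly_continuous_on_bounded sE P \<Longrightarrow> weakly_continuous_on_bounded sE Q \<Longrightarrow>
    weakly_continuous_on_bounded sE (\<lambda>x. P x + Q x :: 'f)"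
  unfolding weakly_continuous_on_bounded_def by (simp add: continuous_map_add)

lemma weakly_continuous_on_bounded_scale:
  "weakly_continuous_on_bounded sE P \<Longrightarrow> weakly_continuous_on_bounded sE (\<lambda>x. sF c (P x))"
  unfolding weakly_continuous_on_bounded_def continuous_map_euclidean_iff
  by (blast intro: bounded_linear.tendsto[OF F.bounded_linear_scale])

lemma homogeneous_polynomial_zero: "homogeneous_polynomial sE sF k (\<lambda>_. 0)"
  unfolding homogeneous_polynomial_def multilinear_def
  by (intro exI[of _ "\<lambda>_. 0"]) (simp add: linear_zero_fun)

lemma normed_nspace_P_wb: "normed_nspace (P_wb sE sF k)"
proof (rule normed_nspace.intro)
  show "vector_space (ns_scale (P_wb sE sF k))"
    using vector_space_fun[OF F.vector_space_axioms] by (simp add: P_wb_def)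
  show "0 \<in> ns_carrier (P_wb sE sF k)"
    by (simp add: zero_fun_def homogeneous_polynomial_zero weakly_continuous_on_bounded_def)
next
  fix P Q :: "'e \<Rightarrow> 'f" and c
  assume P: "P \<in> ns_carrier (P_wb sE sF k)"
  then have hP: "homogeneous_polynomial sE sF k P" by simp
  have sc: "ns_scale (P_wb sE sF k) c P = (\<lambda>x. sF c (P x))" for c P by (simp add: P_wb_def)
  show "ns_scale (P_wb sE sF k) c P \<in> ns_carrier (P_wb sE sF k)"
    using P by (simp add: sc homogeneous_polynomial_scale_left weakly_continuous_on_bounded_scale)
  show nonneg: "0 \<le> ns_norm (P_wb sE sF k) P"
    using P_wb_norm_ge[OF hP, of 0] order_trans[OF norm_ge_zero] by simp
  show "P = 0" if "ns_norm (P_wb sE sF k) P = 0"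
  proof
    fix x :: 'e
    define r where "r = 1 / (norm x + 1)"
    have pos: "norm x + 1 > 0" by (simp add: add_nonneg_pos)
    then have r: "r > 0" "norm (r *\<^sub>R x) \<le> 1" by (simp_all add: r_def)
    have "\<bar>r\<bar> ^ k * norm (P x) \<le> 0"
      using P_wb_norm_ge[OF hP r(2)] that by (simp only: homogeneous_polynomial_norm_scaleR[OF hP])
    moreover have "\<bar>r\<bar> ^ k > 0" using r(1) by simp
    ultimately have "norm (P x) \<le> 0" by (metis mult_pos_pos not_le)
    then show "P x = 0 x" by simp
  qed
  show "ns_norm (P_wb sE sF k) (ns_scale (P_wb sE sF k) c P) = norm c * ns_norm (P_wb sE sF k) P"
  proof (rule antisym)
    show "ns_norm (P_wb sE sF k) (ns_scale (P_wb sE sF k) c P) \<le> norm c * ns_norm (P_wb sE sF k) P"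
      unfolding sc by (rule P_wb_norm_le) (simp add: F.norm_scale mult_left_mono P_wb_norm_ge[OF hP])
    show "norm c * ns_norm (P_wb sE sF k) P \<le> ns_norm (P_wb sE sF k) (ns_scale (P_wb sE sF k) c P)"
    proof (cases "c = 0")
      case True
      have "ns_norm (P_wb sE sF k) (\<lambda>_. 0) \<ge> norm (0::'f)"
        using P_wb_norm_ge[OF homogeneous_polynomial_zero, of 0 k] by simp
      then show ?thesis using True by (simp add: sc)
    next
      case False
      have "ns_norm (P_wb sE sF k) P \<le> ns_norm (P_wb sE sF k) (\<lambda>x. sF c (P x)) / norm c"
      proof (rule P_wb_norm_le)
        fix x :: 'e assume "norm x \<le> 1"
        from P_wb_norm_ge[OF homogeneous_polynomial_scale_left[OF hP] this, of c]
        show "norm (P x) \<le> ns_norm (P_wb sE sF k) (\<lambda>x. sF c (P x)) / norm c"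
          using False by (simp add: F.norm_scale field_simps)
      qed
      then show ?thesis using False by (simp add: sc field_simps)
    qed
  qed
  assume Q: "Q \<in> ns_carrier (P_wb sE sF k)"
  then have hQ: "homogeneous_polynomial sE sF k Q" by simp
  show "P + Q \<in> ns_carrier (P_wb sE sF k)"
    using P Q by (simp add: plus_fun_def homogeneous_polynomial_add weakly_continuous_on_bounded_add)
  show "ns_norm (P_wb sE sF k) (P + Q) \<le> ns_norm (P_wb sE sF k) P + ns_norm (P_wb sE sF k) Q"
  proof (rule P_wb_norm_le)
    fix x :: 'e assume "norm x \<le> 1"
    then show "norm ((P + Q) x) \<le> ns_norm (P_wb sE sF k) P + ns_norm (P_wb sE sF k) Q"
      using norm_triangle_ineq[of "P x" "Q x"] P_wb_norm_ge[OF hP, of x] P_wb_norm_ge[OF hQ, of x] by simp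
  qed
qed

end

context banach_pair
begin

text \<open>Replacing all free arguments by 0 makes the polar form vanish, by linearity in one of
  them. The value at (as, us) is therefore a sum of 2^k increments of P at the points b I, and weak
  continuity at these finitely many points bounds each by e / 2^k.\<close>

lemma wb_form_polar:
  assumes hP: "homogeneous_polynomial sE sF k P" and wP: "weakly_continuous_on_bounded sE P"
  shows "wb_form k (polar P)"
  unfolding wb_form_def
proof (intro conjI allI impI)
  obtain A where A: "multilinear sE sF k A" and P: "\<And>x. P x = A (\<lambda>i\<in>{..<k}. x)"
    using hP unfolding homogeneous_polynomial_def by blast
  show "polar P us = polar P vs" if "mset us = mset vs" for us vs
    by (rule polar_symmetric[OF that])
  show linear: "Vector_Spaces.linear sE sF (\<lambda>x. polar P (x # us))" if "Suc (length us) = k" for us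
    by (rule polar_linear) (use A P that in auto)
  fix as :: "'e list" and R e :: real
  assume len: "length as < k" and "e > 0"
  define n where "n = k - length as"
  define b where "b I = (\<Sum>i\<in>I. (as @ replicate n 0) ! i)" for I
  have "eventually (\<lambda>w. \<forall>I\<in>Pow {..<k}. norm (P (b I + w) - P (b I)) \<le> e / 2 ^ k) (E.wnf (real k * R))"
    using \<open>e > 0\<close> by (intro eventually_ball_finite ballI E.weakly_continuous_on_bounded_wnf[OF wP]) simp_all
  from E.wnf_sum[OF this] obtain V where V: "eventually (\<lambda>v. v \<in> V) (E.wnf R)"
    and small: "\<forall>J u. card (J :: nat set) \<le> k \<longrightarrow> (\<forall>i\<in>J. u i \<in> V) \<longrightarrow> 0 \<le> R \<longrightarrow>
      (\<forall>I\<in>Pow {..<k}. norm (P (b I + (\<Sum>i\<in>J. u i)) - P (b I)) \<le> e / 2 ^ k)"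
    by (elim exE conjE) (rule that)
  define V' where "V' = V \<inter> cball 0 R"
  have "eventually (\<lambda>v. v \<in> V') (E.wnf R)"
    using eventually_conj[OF V E.eventually_wnf_norm] by (simp add: V'_def)
  moreover have "norm (polar P (as @ us)) \<le> e" if us: "set us \<subseteq> V'" "length as + length us = k" for us
  proof -
    have n: "length us = n" "n > 0" using us(2) len by (simp_all add: n_def)
    then obtain u where "u \<in> set us" by (cases us) auto
    then have "norm u \<le> R" using us(1) by (auto simp: V'_def)
    \<comment> \<open>At least one argument is free, and its presence in the ball of radius R gives
      the sign that \<open>wnf_sum\<close> asks for.\<close>
    then have R: "0 \<le> R" using order_trans[OF norm_ge_zero] by blast
    have zero: "polar P (as @ replicate n 0) = 0"
    proof -
      obtain m where m: "n = Suc m" using n(2) by (cases n) auto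
      have "polar P (as @ replicate n 0) = polar P (0 # as @ replicate m 0)"
        by (rule polar_symmetric) (simp add: m)
      moreover have "Vector_Spaces.linear sE sF (\<lambda>x. polar P (x # as @ replicate m 0))"
        using n us(2) m by (intro linear) simp
      then interpret Vector_Spaces.linear sE sF "\<lambda>x. polar P (x # as @ replicate m 0)" .
      have "polar P (0 # as @ replicate m 0) = 0" by (rule zero)
      ultimately show ?thesis by simp
    qed
    have len_us: "length (as @ us) = k" "length (as @ replicate n 0) = k" using us(2) n by simp_all
    have "polar P (as @ us) = polar P (as @ us) - polar P (as @ replicate n 0)" by (simp add: zero)
    also have "\<dots> = (\<Sum>I\<in>Pow {..<k}. (-1) ^ (card I + k) *\<^sub>R (P (\<Sum>i\<in>I. (as @ us) ! i) - P (b I)))"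
      unfolding polar_def len_us b_def by (simp add: sum_subtractf scaleR_right_diff_distrib)
    finally have eq: "polar P (as @ us) =
      (\<Sum>I\<in>Pow {..<k}. (-1) ^ (card I + k) *\<^sub>R (P (\<Sum>i\<in>I. (as @ us) ! i) - P (b I)))" .
    have "norm ((-1) ^ (card I + k) *\<^sub>R (P (\<Sum>i\<in>I. (as @ us) ! i) - P (b I))) \<le> e / 2 ^ k"
      if I: "I \<in> Pow {..<k}" for I
    proof -
      have fin: "finite I" using I by (auto intro: finite_subset)
      let ?J = "I - {..<length as}"
      have J: "card ?J \<le> k" using I card_mono[of "{..<k}" ?J] by auto
      have "\<forall>i\<in>?J. us ! (i - length as) \<in> V"
      proof
        fix i assume "i \<in> ?J"
        then have "i - length as < length us" using I us(2) by auto
        then show "us ! (i - length as) \<in> V" using us(1) nth_mem by (auto simp: V'_def)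
      qed
      then have "norm (P (b I + (\<Sum>i\<in>?J. us ! (i - length as))) - P (b I)) \<le> e / 2 ^ k"
        using small[rule_format, of ?J "\<lambda>i. us ! (i - length as)" I] J R I by simp
      moreover have "b I + (\<Sum>i\<in>?J. us ! (i - length as)) = (\<Sum>i\<in>I. (as @ us) ! i)"
      proof -
        have "(\<Sum>i\<in>?J. us ! (i - length as)) = (\<Sum>i\<in>I. if i < length as then 0 else us ! (i - length as))"
          using fin by (intro sum.mono_neutral_cong_left) auto
        moreover have "(as @ replicate n 0) ! i + (if i < length as then 0 else us ! (i - length as)) =
          (as @ us) ! i" if "i \<in> I" for i
          using that I n us(2) by (auto simp: nth_append)
        ultimately show ?thesis
          unfolding b_def by (simp add: sum.distrib[symmetric])
      qed
      ultimately show ?thesis by simp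
    qed
    then have "norm (polar P (as @ us)) \<le> real (card (Pow {..<k})) * (e / 2 ^ k)"
      unfolding eq by (intro sum_norm_bound)
    then show ?thesis by (simp add: card_Pow)
  qed
  ultimately show "\<exists>V. eventually (\<lambda>v. v \<in> V) (E.wnf R) \<and>
      (\<forall>us. set us \<subseteq> V \<longrightarrow> length as + length us = k \<longrightarrow> norm (polar P (as @ us)) \<le> e)"
    by blast
qed

text \<open>Polarizing the embedding u gives an operator from \<open>ell_infty\<close> into forms,
  so the polar forms of the images of the unit sequences tend to 0 uniformly. The polynomials are
  dominated by them, against the lower estimate for u.\<close>

theorem P_wb_contains_ell_inftyD:
  assumes copy: "contains_copy (P_wb sE sF k) (ell_infty :: ('k, nat \<Rightarrow> 'k) nspace)"
    and no_ell_infty: "\<not> contains_copy (whole_space sF) (ell_infty :: ('k, nat \<Rightarrow> 'k) nspace)"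
  shows "contains_complemented_copy (whole_space sE) (ell_one :: ('k, nat \<Rightarrow> 'k) nspace)"
proof (rule ccontr)
  let ?X = "P_wb sE sF k" and ?l = "ell_infty :: ('k, nat \<Rightarrow> 'k) nspace"
  assume no_ell_one: "\<not> ?thesis"
  obtain u C where u: "linear_map ?l ?X u" and "C > 0"
    and uC: "\<And>y. y \<in> ns_carrier ?l \<Longrightarrow> ns_norm ?X (u y) \<le> C * ns_norm ?l y"
    and lower: "\<And>y. y \<in> ns_carrier ?l \<Longrightarrow> ns_norm ?l y \<le> C * ns_norm ?X (u y)"
    using contains_copyD[OF normed_nspace_P_wb normed_nspace_ell_infty copy] by blast
  have uX: "homogeneous_polynomial sE sF k (u \<xi>)" "weakly_continuous_on_bounded sE (u \<xi>)"
    if "bounded (range \<xi>)" for \<xi>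
    using linear_mapD(1)[OF u, of \<xi>] that by auto
  have u_lin: "u (\<xi> + \<zeta>) = (\<lambda>x. u \<xi> x + u \<zeta> x)" if "bounded (range \<xi>)" "bounded (range \<zeta>)" for \<xi> \<zeta>
    using linear_mapD(2)[OF u, of \<xi> \<zeta>] that by (simp add: plus_fun_def)
  have u_scale: "u (\<lambda>i. c * \<xi> i) = (\<lambda>x. sF c (u \<xi> x))" if "bounded (range \<xi>)" for c \<xi>
    using linear_mapD(3)[OF u, of \<xi> c] that by (simp add: P_wb_def)
  have u_bound: "norm (u \<xi> x) \<le> real k ^ k * C" if \<xi>: "\<xi> \<in> ball_on UNIV" and x: "norm x \<le> real k" for \<xi> x
  proof -
    have b: "bounded (range \<xi>)" by (rule ball_on_bounded[OF \<xi>])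
    have "ns_norm ?l \<xi> \<le> 1" using \<xi> by (intro ell_infty_norm_le) (simp add: ball_on_def)
    then have "ns_norm ?X (u \<xi>) \<le> C"
      using order_trans[OF uC[of \<xi>] mult_left_mono[of "ns_norm ?l \<xi>" 1 C]] b \<open>C > 0\<close> by simp
    then have C: "norm (u \<xi> y) \<le> C" if "norm y \<le> 1" for y
      using P_wb_norm_ge[OF uX(1)[OF b] that] by linarith
    show ?thesis
    \<comment> \<open>For k = 0 the factor \<open>real k ^ k\<close> is 1 and x is 0, where the
      bound C already applies.\<close>
    proof (cases "k = 0")
      case True
      then have "x = 0" using x by simp
      then show ?thesis using C[of 0] True by simp
    next
      case False
      have "norm (inverse (real k) *\<^sub>R x) \<le> 1" using x False by (simp add: field_simps)
      from mult_left_mono[OF C[OF this], of "real k ^ k"]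
      have "real k ^ k * norm (u \<xi> (inverse (real k) *\<^sub>R x)) \<le> real k ^ k * C" by simp
      moreover have "norm (u \<xi> (real k *\<^sub>R inverse (real k) *\<^sub>R x)) = real k ^ k * norm (u \<xi> (inverse (real k) *\<^sub>R x))"
        using homogeneous_polynomial_norm_scaleR[OF uX(1)[OF b], of "real k" "inverse (real k) *\<^sub>R x"]
        by (simp del: scaleR_scaleR)
      ultimately show ?thesis using False by simp
    qed
  qed
  \<comment> \<open>Half of the lower bound 1 / C for the norms of the images of the unit
    sequences.\<close>
  define e where "e = 1 / (2 * C)"
  have e: "e > 0" using \<open>C > 0\<close> by (simp add: e_def)
  have "eventually (\<lambda>n. \<forall>us\<in>{xs. length xs = k \<and> set xs \<subseteq> cball 0 1}. norm (polar (u (unit_seq n)) us) < e) sequentially"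
  proof (rule null_onD[OF null_on_wb_form[OF no_ell_infty no_ell_one, of k], where S = "\<lambda>\<xi>. polar (u \<xi>)"])
    show "ell_infty_linear sF (\<lambda>\<xi>. polar (u \<xi>) t)" for t
      unfolding ell_infty_linear_def by (auto simp: u_lin u_scale polar_add polar_scale)
    show "norm (polar (u \<xi>) t) \<le> 2 ^ k * (real k ^ k * C)"
      if "\<xi> \<in> ball_on UNIV" "t \<in> {xs. length xs = k \<and> set xs \<subseteq> cball 0 1}" for \<xi> t
      using that by (intro polar_bound u_bound) auto
    show "wb_form k (polar (u \<xi>))" if "bounded (range \<xi>)" for \<xi>
      by (rule wb_form_polar[OF uX[OF that]])
  qed (rule e)
  then obtain n where n: "\<And>us. length us = k \<Longrightarrow> set us \<subseteq> cball 0 1 \<Longrightarrow> norm (polar (u (unit_seq n)) us) < e"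
    using eventually_happens'[OF sequentially_bot] by blast
  have unit_bd: "bounded (range (unit_seq n :: nat \<Rightarrow> 'k))" by (rule ball_on_bounded[OF unit_seq_ball])
  obtain A where A: "multilinear sE sF k A" and P: "\<And>x. u (unit_seq n) x = A (\<lambda>i\<in>{..<k}. x)"
    using uX(1)[OF unit_bd] unfolding homogeneous_polynomial_def by blast
  have "norm (u (unit_seq n) x) \<le> e" if "norm x \<le> 1" for x
    using polar_replicate[OF A P, of x] n[of "replicate k x"] that by force
  then have "ns_norm ?X (u (unit_seq n)) \<le> e" by (rule P_wb_norm_le)
  moreover have "1 \<le> ns_norm ?l (unit_seq n)"
    using ell_infty_norm_ge[OF unit_bd, of n] by (simp add: unit_seq_def)
  then have "1 \<le> C * ns_norm ?X (u (unit_seq n))"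
    using lower[of "unit_seq n"] unit_bd by simp
  ultimately have "1 \<le> C * e" using \<open>C > 0\<close> by (smt (verit) mult_left_mono)
  then show False using \<open>C > 0\<close> by (simp add: e_def)
qed

subsection \<open>Copies of \<open>\<ell>\<^sub>\<infinity>\<close> in the polynomials\<close>

text \<open>One shape serves both embeddings: \<phi> = \<psi> with y varying for a copy in F, and
  \<phi> varying with \<psi> and y fixed for a complemented \<open>ell_one\<close> in E.\<close>

lemma product_polynomial_in_P_wb:
  assumes \<phi>: "\<phi> \<in> E.dual" and \<psi>: "\<psi> \<in> E.dual" and "k \<ge> 1"
  shows "(\<lambda>x. sF (\<phi> x * \<psi> x ^ (k - 1)) y) \<in> ns_carrier (P_wb sE sF k)"
proof -
  note l\<phi> = E.linear_scalarD[OF E.dual_linear[OF \<phi>]] and l\<psi> = E.linear_scalarD[OF E.dual_linear[OF \<psi>]]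
  note linI = linear_vector_spaceI[OF E.vector_space_axioms F.vector_space_axioms]
  define A where "A x = sF (\<phi> (x 0) * (\<Prod>i\<in>{1..<k}. \<psi> (x i))) y" for x :: "nat \<Rightarrow> 'e"
  have "multilinear sE sF k A"
    unfolding multilinear_def
  proof (intro ballI allI impI)
    fix x :: "nat \<Rightarrow> 'e" and i assume "i < k"
    show "Vector_Spaces.linear sE sF (\<lambda>u. A (x(i := u)))"
    proof (cases "i = 0")
      case True
      then have "A (x(i := u)) = sF (\<phi> u * (\<Prod>i\<in>{1..<k}. \<psi> (x i))) y" for u
        unfolding A_def by (auto intro!: arg_cong[where f = "\<lambda>c. sF (\<phi> u * c) y"] prod.cong)
      then show ?thesis
        by (intro linI) (simp_all add: l\<phi> distrib_right F.scale_left_distrib mult.assoc)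
    next
      case False
      then have i: "i \<in> {1..<k}" using \<open>i < k\<close> by simp
      have "(\<Prod>j\<in>{1..<k}. \<psi> ((x(i := u)) j)) = \<psi> u * (\<Prod>j\<in>{1..<k} - {i}. \<psi> (x j))" for u
        using prod.remove[OF _ i, of "\<lambda>j. \<psi> ((x(i := u)) j)"] by simp
      then have "A (x(i := u)) = sF (\<psi> u * (\<phi> (x 0) * (\<Prod>j\<in>{1..<k} - {i}. \<psi> (x j)))) y" for u
        using False by (simp add: A_def mult.left_commute)
      then show ?thesis
        by (intro linI) (simp_all add: l\<psi> distrib_right F.scale_left_distrib mult.assoc)
    qed
  qed
  moreover have cont: "continuous_map X euclidean (\<lambda>x. sF (g x) y)" if "continuous_map X euclidean g"
    for X :: "'z topology" and g
    using that by (auto simp: continuous_map_euclidean_iff intro!: bounded_linear.tendsto[OF F.bounded_linear_scale_left])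
  have comp: "continuous_map (product_topology (\<lambda>_. euclidean) {..<k}) euclidean (\<lambda>x. \<theta> (x i))"
    if "\<theta> \<in> E.dual" "i < k" for \<theta> i
    using continuous_map_compose[OF continuous_map_product_projection[of i "{..<k}" "\<lambda>_. euclidean :: 'e topology"], of euclidean \<theta>] that
    by (simp add: o_def E.dual_def)
  have "continuous_map (product_topology (\<lambda>_. euclidean) {..<k}) euclidean A"
    unfolding A_def using \<open>k \<ge> 1\<close>
    by (intro cont continuous_map_mult_field continuous_map_prod_field comp \<phi> \<psi>) auto
  moreover have "sF (\<phi> x * \<psi> x ^ (k - 1)) y = A (\<lambda>i\<in>{..<k}. x)" for x
    using \<open>k \<ge> 1\<close> by (simp add: A_def)
  ultimately have "homogeneous_polynomial sE sF k (\<lambda>x. sF (\<phi> x * \<psi> x ^ (k - 1)) y)"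
    unfolding homogeneous_polynomial_def by blast
  moreover have "weakly_continuous_on_bounded sE (\<lambda>x. sF (\<phi> x * \<psi> x ^ (k - 1)) y)"
    unfolding weakly_continuous_on_bounded_def
  proof (intro allI impI)
    fix B :: "'e set"
    note c = continuous_map_from_subtopology[OF E.continuous_map_weak_dual]
    have "continuous_map (subtopology (weak_topology sE) B) euclidean (\<lambda>x. \<phi> x * (\<Prod>i\<in>{1..<k}. \<psi> x))"
      by (intro continuous_map_mult_field continuous_map_prod_field c \<phi> \<psi>)
    then show "continuous_map (subtopology (weak_topology sE) B) euclidean (\<lambda>x. sF (\<phi> x * \<psi> x ^ (k - 1)) y)"
      using cont by simp
  qed
  ultimately show ?thesis by simp
qed

lemma P_wb_contains_ell_inftyI:
  fixes J :: "(nat \<Rightarrow> 'k) \<Rightarrow> 'e \<Rightarrow> 'f"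
  assumes mem: "\<And>a. bounded (range a) \<Longrightarrow> J a \<in> ns_carrier (P_wb sE sF k)"
    and lin: "\<And>x. ell_infty_linear sF (\<lambda>a. J a x)"
    and upper: "\<And>a x. bounded (range a) \<Longrightarrow> norm x \<le> 1 \<Longrightarrow> norm (J a x) \<le> C * ns_norm ell_infty a"
    and "c > 0" and lower: "\<And>a. bounded (range a) \<Longrightarrow> c * ns_norm ell_infty a \<le> ns_norm (P_wb sE sF k) (J a)"
  shows "contains_copy (P_wb sE sF k) (ell_infty :: ('k, nat \<Rightarrow> 'k) nspace)"
proof (rule contains_copy_ell_inftyI[OF normed_nspace_P_wb _ \<open>c > 0\<close> lower])
  show "linear_map ell_infty (P_wb sE sF k) J"
    unfolding linear_map_def
  proof (intro conjI funcsetI ballI allI)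
    show "J a \<in> ns_carrier (P_wb sE sF k)" if "a \<in> ns_carrier ell_infty" for a
      using mem that by simp
    show "J (a + b) = J a + J b" if "a \<in> ns_carrier ell_infty" "b \<in> ns_carrier ell_infty" for a b
      using ell_infty_linearD(1)[OF lin, of a b] that by (simp add: fun_eq_iff)
    show "J (ns_scale ell_infty d a) = ns_scale (P_wb sE sF k) d (J a)" if "a \<in> ns_carrier ell_infty" for d a
      using ell_infty_linearD(2)[OF lin, of a d] that by (simp add: fun_eq_iff P_wb_def)
  qed
  show "ns_norm (P_wb sE sF k) (J a) \<le> C * ns_norm ell_infty a" if "bounded (range a)" for a
    by (rule P_wb_norm_le) (rule upper[OF that])
qed

end

text \<open>A nonzero vector of E provides a functional and a vector e of the unit ball with norm
  (\<phi> e) = 1, where J a has the norm of u a. For E = {0} and k >= 1 all these polynomials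
  vanish, whatever F contains.\<close>

lemma (in banach_pair) contains_copy_P_wb_if_range:
  assumes copy: "contains_copy (whole_space sF) (ell_infty :: ('k, nat \<Rightarrow> 'k) nspace)"
    and E: "\<exists>x::'e. x \<noteq> 0" and k: "k \<ge> 1"
  shows "contains_copy (P_wb sE sF k) (ell_infty :: ('k, nat \<Rightarrow> 'k) nspace)"
proof -
  let ?X = "whole_space sF" and ?l = "ell_infty :: ('k, nat \<Rightarrow> 'k) nspace"
  obtain u C where u: "linear_map ?l ?X u" and "C > 0"
    and uC: "\<And>y. y \<in> ns_carrier ?l \<Longrightarrow> ns_norm ?X (u y) \<le> C * ns_norm ?l y"
    and lower: "\<And>y. y \<in> ns_carrier ?l \<Longrightarrow> ns_norm ?l y \<le> C * ns_norm ?X (u y)"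
    using contains_copyD[OF F.normed_nspace_whole_space normed_nspace_ell_infty copy] by blast
  have u_upper: "norm (u a) \<le> C * ns_norm ?l a" if "bounded (range a)" for a
    using uC[of a] that by (simp add: whole_space_def)
  have u_lower: "ns_norm ?l a \<le> C * norm (u a)" if "bounded (range a)" for a
    using lower[of a] that by (simp add: whole_space_def)
  have u_lin: "ell_infty_linear sF u"
    using linear_mapD(2,3)[OF u] by (simp add: ell_infty_linear_def whole_space_def)
  obtain x0 :: 'e where x0: "x0 \<noteq> 0" using E by blast
  obtain \<phi> where \<phi>: "Vector_Spaces.linear sE (*) \<phi>" "\<And>x. norm (\<phi> x) \<le> norm x"
    "norm (\<phi> x0) = norm x0"
    using E.norming_functional[of x0] by blast
  have dual: "\<phi> \<in> E.dual" by (rule E.dualI[OF \<phi>(1), of 1]) (simp add: \<phi>(2))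
  define e where "e = inverse (norm x0) *\<^sub>R x0"
  have e: "norm e \<le> 1" "norm (\<phi> e) = 1"
    using x0 \<phi>(3) by (simp_all add: e_def E.linear_scalarD(5)[OF \<phi>(1)])
  define J where "J a x = sF (\<phi> x * \<phi> x ^ (k - 1)) (u a)" for a x
  have J_norm: "norm (J a x) = norm (\<phi> x) ^ k * norm (u a)" for a x
    using k by (cases k) (simp_all add: J_def F.norm_scale norm_mult norm_power)
  show ?thesis
  proof (rule P_wb_contains_ell_inftyI[of J k C "1 / C"])
    fix a :: "nat \<Rightarrow> 'k" assume a: "bounded (range a)"
    show mem: "J a \<in> ns_carrier (P_wb sE sF k)"
      unfolding J_def[abs_def] by (rule product_polynomial_in_P_wb[OF dual dual k])
    show "norm (J a x) \<le> C * ns_norm ?l a" if "norm x \<le> 1" for x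
    proof -
      have "norm (\<phi> x) ^ k \<le> 1" using \<phi>(2)[of x] that by (intro power_le_one) auto
      then have "norm (J a x) \<le> 1 * norm (u a)" unfolding J_norm by (intro mult_right_mono) auto
      then show ?thesis using u_upper[OF a] by simp
    qed
    have "norm (u a) \<le> ns_norm (P_wb sE sF k) (J a)"
      using P_wb_norm_ge[OF _ e(1), of k "J a"] mem by (simp add: J_norm e(2))
    then have "C * norm (u a) \<le> C * ns_norm (P_wb sE sF k) (J a)" using \<open>C > 0\<close> by simp
    then show "1 / C * ns_norm ?l a \<le> ns_norm (P_wb sE sF k) (J a)"
      using order_trans[OF u_lower[OF a]] \<open>C > 0\<close> by (simp add: field_simps)
  next
    show "ell_infty_linear sF (\<lambda>a. J a x)" for x
      using u_lin by (auto simp: ell_infty_linear_def J_def F.scale_right_distrib mult.commute)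
    show "1 / C > 0" using \<open>C > 0\<close> by simp
  qed
qed

text \<open>The projection extends the coordinates of the copy of \<open>ell_one\<close> to
  functionals on all of E. Their absolute summability at every x allows any bounded sequence a as
  coefficients in \<phi> a.\<close>

lemma (in banach_pair) contains_copy_P_wb_if_domain:
  assumes copy: "contains_complemented_copy (whole_space sE) (ell_one :: ('k, nat \<Rightarrow> 'k) nspace)"
    and F: "\<exists>y::'f. y \<noteq> 0" and k: "k \<ge> 1"
  shows "contains_copy (P_wb sE sF k) (ell_infty :: ('k, nat \<Rightarrow> 'k) nspace)"
proof -
  let ?X = "whole_space sE" and ?l = "ell_one :: ('k, nat \<Rightarrow> 'k) nspace"
  interpret X: normed_nspace ?X by (rule E.normed_nspace_whole_space)
  obtain W p where W: "W \<subseteq> ns_carrier ?X" "module.subspace (ns_scale ?X) W"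
    and hom: "linearly_homeomorphic (?X\<lparr>ns_carrier := W\<rparr>) ?l" and p: "bounded_projection_onto ?X W p"
    using copy unfolding contains_complemented_copy_def closed_linear_subspace_def by blast
  obtain h u C where h: "linear_map (?X\<lparr>ns_carrier := W\<rparr>) ?l h" and u: "linear_map ?l (?X\<lparr>ns_carrier := W\<rparr>) u"
    and "C > 0" and hu: "\<And>y. y \<in> ns_carrier ?l \<Longrightarrow> h (u y) = y"
    and hC: "\<And>P. P \<in> ns_carrier (?X\<lparr>ns_carrier := W\<rparr>) \<Longrightarrow> ns_norm ?l (h P) \<le> C * ns_norm (?X\<lparr>ns_carrier := W\<rparr>) P"
    and uC: "\<And>y. y \<in> ns_carrier ?l \<Longrightarrow> ns_norm (?X\<lparr>ns_carrier := W\<rparr>) (u y) \<le> C * ns_norm ?l y"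
    using linearly_homeomorphicD[OF X.normed_subspace[OF W] normed_nspace_ell_one hom] by metis
  have p_add: "p (x + y) = p x + p y" and p_scale: "p (sE c x) = sE c (p x)"
    and pW: "p x \<in> W" and pp: "x \<in> W \<Longrightarrow> p x = x" for x y c
    using p unfolding bounded_projection_onto_def linear_map_def by (auto simp: whole_space_def)
  obtain B where B: "\<And>x. norm (p x) \<le> B * norm x"
    using p unfolding bounded_projection_onto_def by (auto simp: whole_space_def)
  define g where "g n x = h (p x) n" for n x
  have hp: "summable (\<lambda>n. norm (g n x))" for x
    using linear_mapD(1)[OF h, of "p x"] pW[of x] by (simp add: g_def)
  \<comment> \<open>The added 1 makes M positive even if B = 0.\<close>
  define M where "M = C * \<bar>B\<bar> + 1"
  have M: "M > 0" using \<open>C > 0\<close> by (simp add: M_def add_nonneg_pos)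
  have g_sum: "(\<Sum>n. norm (g n x)) \<le> M * norm x" for x
  proof -
    have "(\<Sum>n. norm (g n x)) \<le> C * norm (p x)"
      using hC[of "p x"] pW[of x] by (simp add: g_def ell_one_norm whole_space_def)
    also have "\<dots> \<le> C * (\<bar>B\<bar> * norm x)"
      using B[of x] mult_right_mono[OF abs_ge_self norm_ge_zero, of B x] \<open>C > 0\<close>
      by (intro mult_left_mono) auto
    also have "\<dots> \<le> M * norm x" by (simp add: M_def algebra_simps)
    finally show ?thesis .
  qed
  have g_add: "g n (x + y) = g n x + g n y" and g_scale: "g n (sE c x) = c * g n x" for n x y c
    using linear_mapD(2)[OF h, of "p x" "p y"] linear_mapD(3)[OF h, of "p x" c] pW
    by (simp_all add: g_def p_add p_scale whole_space_def)
  note linI = linear_vector_spaceI[OF E.vector_space_axioms vector_space_field]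
  define \<phi> where "\<phi> a x = (\<Sum>n. a n * g (Suc n) x)" for a x
  have ag: "summable (\<lambda>n. norm (a n * g (Suc n) x))"
    and \<phi>_le: "norm (\<phi> a x) \<le> ns_norm ell_infty a * (M * norm x)" if a: "bounded (range a)" for a x
  proof -
    have gs: "summable (\<lambda>n. norm (g (Suc n) x))" 
      using hp[of x] summable_Suc_iff[of "\<lambda>n. norm (g n x)"] by blast
    have le: "norm (a n * g (Suc n) x) \<le> ns_norm ell_infty a * norm (g (Suc n) x)" for n
      unfolding norm_mult by (intro mult_right_mono ell_infty_norm_ge[OF a]) simp
    show s: "summable (\<lambda>n. norm (a n * g (Suc n) x))"
      by (rule summable_comparison_test'[OF summable_mult[OF gs], of 0]) (use le in auto)
    have "norm (\<phi> a x) \<le> (\<Sum>n. norm (a n * g (Suc n) x))" unfolding \<phi>_def by (rule summable_norm[OF s])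
    also have "\<dots> \<le> ns_norm ell_infty a * (\<Sum>n. norm (g (Suc n) x))"
      unfolding suminf_mult[OF gs, symmetric] by (intro suminf_le le s summable_mult gs)
    also have "\<dots> \<le> ns_norm ell_infty a * (M * norm x)"
    proof (rule mult_left_mono)
      show "(\<Sum>n. norm (g (Suc n) x)) \<le> M * norm x"
        using g_sum[of x] suminf_split_head[OF hp[of x]] norm_ge_zero[of "g 0 x"] by linarith
      show "0 \<le> ns_norm ell_infty a" using order_trans[OF norm_ge_zero ell_infty_norm_ge[OF a]] .
    qed
    finally show "norm (\<phi> a x) \<le> ns_norm ell_infty a * (M * norm x)" .
  qed
  note ag' = summable_norm_cancel[OF ag]
  have \<phi>_dual: "\<phi> a \<in> E.dual" if a: "bounded (range a)" for a
  proof (rule E.dualI)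
    show "Vector_Spaces.linear sE (*) (\<phi> a)"
    proof (rule linI)
      show "\<phi> a (x + y) = \<phi> a x + \<phi> a y" for x y
        using suminf_add[OF ag'[OF a] ag'[OF a], of x y] by (simp add: \<phi>_def g_add distrib_left)
      show "\<phi> a (sE c x) = c * \<phi> a x" for c x
        using suminf_mult[OF ag'[OF a], of c x] by (simp add: \<phi>_def g_scale mult.left_commute)
    qed
    show "norm (\<phi> a x) \<le> (ns_norm ell_infty a * M) * norm x" for x using \<phi>_le[OF a, of x] by simp
  qed
  have g0_le: "norm (g 0 x) \<le> M * norm x" for x
    using order_trans[OF sum_le_suminf[OF hp, of "{0}"] g_sum, of x] by simp
  have g0: "g 0 \<in> E.dual" by (rule E.dualI[OF linI g0_le]) (simp_all add: g_add g_scale)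
  obtain y :: 'f where y: "y \<noteq> 0" using F by blast
  define J where "J a x = sF (\<phi> a x * g 0 x ^ (k - 1)) y" for a x
  define e where "e n = u (unit_seq n)" for n
  have unit_l1: "unit_seq n \<in> ns_carrier ?l" "ns_norm ?l (unit_seq n) = 1" for n
  proof -
    have "(\<lambda>i. norm (unit_seq n i :: 'k)) = (\<lambda>i. if i = n then 1 else 0)" by (auto simp: unit_seq_def)
    then have "(\<lambda>i. norm (unit_seq n i :: 'k)) sums 1" using sums_single[of n "\<lambda>_. 1::real"] by simp
    then show "unit_seq n \<in> ns_carrier ?l" "ns_norm ?l (unit_seq n) = 1"
      by (simp_all add: ell_one_norm sums_iff)
  qed
  have eW: "e n \<in> W" for n using linear_mapD(1)[OF u unit_l1(1)] by (simp add: e_def)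
  have e_norm: "norm (e n) \<le> C" for n
    using uC[OF unit_l1(1), of n] by (simp add: e_def unit_l1(2) whole_space_def)
  have ge: "g m (e n) = (if m = n then 1 else 0)" for m n
    using hu[OF unit_l1(1), of n] by (simp add: g_def pp[OF eW]) (simp add: e_def unit_seq_def)
  \<comment> \<open>The test vectors e 0 + e (Suc n) have norm at most 2 C; scaling them into the
    unit ball costs (2 C)^k by homogeneity.\<close>
  define d where "d = 1 / (2 * C) ^ k * norm y"
  have d: "d > 0" using y \<open>C > 0\<close> by (simp add: d_def)
  show ?thesis
  proof (rule P_wb_contains_ell_inftyI[of J k "M ^ k * norm y" d])
    fix a :: "nat \<Rightarrow> 'k" assume a: "bounded (range a)"
    show mem: "J a \<in> ns_carrier (P_wb sE sF k)"
      unfolding J_def[abs_def] by (rule product_polynomial_in_P_wb[OF \<phi>_dual[OF a] g0 k])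
    then have hJ: "homogeneous_polynomial sE sF k (J a)" by simp
    have a0: "0 \<le> ns_norm ell_infty a" using order_trans[OF norm_ge_zero ell_infty_norm_ge[OF a]] .
    show "norm (J a x) \<le> M ^ k * norm y * ns_norm ell_infty a" if x: "norm x \<le> 1" for x
    proof -
      have Mx: "M * norm x \<le> M" using mult_left_mono[OF x, of M] M by simp
      have "norm (\<phi> a x) \<le> ns_norm ell_infty a * M"
        using order_trans[OF \<phi>_le[OF a] mult_left_mono[OF Mx a0]] .
      moreover have "norm (g 0 x) ^ (k - 1) \<le> M ^ (k - 1)"
        using order_trans[OF g0_le Mx] by (intro power_mono) auto
      ultimately have "norm (\<phi> a x) * norm (g 0 x) ^ (k - 1) \<le> (ns_norm ell_infty a * M) * M ^ (k - 1)"
        using a0 M by (intro mult_mono) auto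
      also have "\<dots> = ns_norm ell_infty a * M ^ k" using k by (cases k) simp_all
      finally show ?thesis
        using mult_right_mono[OF _ norm_ge_zero[of y]]
        by (fastforce simp: J_def F.norm_scale norm_mult norm_power mult_ac)
    qed
    have "norm (a n) \<le> ns_norm (P_wb sE sF k) (J a) / d" for n
    proof -
      \<comment> \<open>At this vector g 0 is 1 and \<phi> a reduces to a n; the shift by one in
        \<phi> keeps index 0 free for g 0.\<close>
      define x where "x = e 0 + e (Suc n)"
      have "norm x \<le> 2 * C"
        using norm_triangle_ineq[of "e 0" "e (Suc n)"] e_norm[of 0] e_norm[of "Suc n"] by (simp add: x_def)
      then have x: "norm ((1 / (2 * C)) *\<^sub>R x) \<le> 1" using \<open>C > 0\<close> by simp
      have "a i * g (Suc i) x = (if i = n then a i else 0)" for i by (simp add: x_def g_add ge)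
      then have "\<phi> a x = a n"
        unfolding \<phi>_def using sums_single[of n a] by (simp add: sums_iff)
      moreover have "g 0 x = 1" by (simp add: x_def g_add ge)
      ultimately have "norm (J a x) = norm (a n) * norm y" by (simp add: J_def F.norm_scale)
      moreover have "norm (J a ((1 / (2 * C)) *\<^sub>R x)) = (1 / (2 * C)) ^ k * norm (J a x)"
        using homogeneous_polynomial_norm_scaleR[OF hJ, of "1 / (2 * C)" x] \<open>C > 0\<close> by simp
      ultimately have "norm (a n) * d = norm (J a ((1 / (2 * C)) *\<^sub>R x))"
        by (simp add: d_def power_one_over)
      also have "\<dots> \<le> ns_norm (P_wb sE sF k) (J a)" by (rule P_wb_norm_ge[OF hJ x])
      finally show ?thesis using d by (simp add: field_simps)
    qed
    from ell_infty_norm_le[OF this] show "d * ns_norm ell_infty a \<le> ns_norm (P_wb sE sF k) (J a)"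
      using d by (simp add: field_simps)
  next
    show "ell_infty_linear sF (\<lambda>a. J a x)" for x
      unfolding ell_infty_linear_def
    proof (intro conjI allI impI)
      fix a b :: "nat \<Rightarrow> 'k" assume "bounded (range a)" "bounded (range b)"
      then have "\<phi> (a + b) x = \<phi> a x + \<phi> b x"
        using suminf_add[OF ag' ag', of a b x x] by (simp add: \<phi>_def distrib_right)
      then show "J (a + b) x = J a x + J b x" by (simp add: J_def distrib_right F.scale_left_distrib)
    next
      fix c and a :: "nat \<Rightarrow> 'k" assume "bounded (range a)"
      then have "\<phi> (\<lambda>i. c * a i) x = c * \<phi> a x"
        using suminf_mult[OF ag', of a c x] by (simp add: \<phi>_def mult.assoc)
      then show "J (\<lambda>i. c * a i) x = sF c (J a x)" by (simp add: J_def mult.assoc)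
    qed
  qed (rule d)
qed

theorem theorem3:
  fixes sE :: "'k::real_or_complex \<Rightarrow> 'e::banach \<Rightarrow> 'e"
    and sF :: "'k \<Rightarrow> 'f::banach \<Rightarrow> 'f"
    and k :: nat
  assumes "banach_over sE" and "banach_over sF"
    and "\<exists>x::'e. x \<noteq> 0" and "\<exists>y::'f. y \<noteq> 0"
    and "k \<ge> 1"
  shows "contains_copy (P_wb sE sF k) (ell_infty :: ('k, nat \<Rightarrow> 'k) nspace) \<longleftrightarrow>
    contains_copy (whole_space sF) (ell_infty :: ('k, nat \<Rightarrow> 'k) nspace) \<or>
    contains_complemented_copy (whole_space sE) (ell_one :: ('k, nat \<Rightarrow> 'k) nspace)"
proof -
  interpret banach_pair sE sF using assms(1,2) by (rule banach_pair.intro)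
  show ?thesis
    using P_wb_contains_ell_inftyD contains_copy_P_wb_if_range[OF _ assms(3,5)]
      contains_copy_P_wb_if_domain[OF _ assms(4,5)] by blast
qed

end
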